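(* Let $q = p^k$ with $p$ prime and $k \geq 1$, and let $\boldsymbol{f} = \{f_1, \dots, f_r\}$ be a system of polynomials in $\mathbb{F}_q[x_1, \dots, x_n]$ with $d_i = \deg(f_i)$ and $d = d_1 + \cdots + d_r$. Let $Z(\boldsymbol{f}, \mathbb{F}_q^n)$ denote the set of common zeros of $f_1, \dots, f_r$ in $\mathbb{F}_q^n$ and $N(\boldsymbol{f}, \mathbb{F}_q^n) = |Z(\boldsymbol{f}, \mathbb{F}_q^n)|$. Suppose that $n>d$, $Z(\boldsymbol{f}, \mathbb{F}_q^{n})$ is non-empty, and $Z(\boldsymbol{f}, \mathbb{F}_q^n)$ is not an affine space of $\mathbb{F}_q^{n}$ (i.e., not a coset of a linear subspace). Then the following statements hold. (1) For $q=2$, $N(\boldsymbol{f},\mathbb{F}_2^{n}) \geq 2^{n-d} + 2$. (2) For $q \geq 3$, $N(\boldsymbol{f},\mathbb{F}_q^{n}) \geq 2q^{n-d}$. (3) For $q \geq 2$, $N(\boldsymbol{f},\mathbb{F}_q^{n}) > \dfrac{q^{n+1-d}-1}{q-1} \cdot \dfrac{q}{n+2-d}$ provided that the polynomials $f_{1}, \dots, f_{r}$ are homogeneous. (4) For $q \geq 3$, $N(\boldsymbol{f}, \mathbb{F}_q^n) \geq 2q^{n-d} + (q-2)q$ provided that the polynomials $f_1, \dots, f_r$ are homogeneous. Moreover, the bounds in (1), (2), and (4) are sharp under these hypotheses (i.e., they are attained by some systems satisfying the stated hypotheses).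
   Context: Here $\mathbb{F}_q$ is the finite field with $q$ elements. An affine space in $\mathbb{F}_q^n$ is a coset of a linear subspace. A polynomial is a (homogeneous) form of degree $d$ if it is nonzero and every monomial has degree $d$. *)

theory Defs
  imports
    Complex_Main
    "HOL-Library.Cardinality"
    "HOL-Library.Poly_Mapping"
    "HOL-Library.Function_Algebras"
    "HOL-Computational_Algebra.Primes"
begin

text \<open>A monomial is a finitely supported exponent vector, and a polynomial is a finitely
  supported map from monomials to coefficients; the variables are indexed from 0.\<close>

type_synonym 'a mvpoly = "(nat \<Rightarrow>\<^sub>0 nat) \<Rightarrow>\<^sub>0 'a"

definition mvpolys :: "nat \<Rightarrow> 'a::zero mvpoly set" where
  "mvpolys n = {p. \<forall>m\<in>Poly_Mapping.keys p. Poly_Mapping.keys m \<subseteq> {..<n}}"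

definition monom_degree :: "(nat \<Rightarrow>\<^sub>0 nat) \<Rightarrow> nat" where
  "monom_degree m = (\<Sum>i\<in>Poly_Mapping.keys m. Poly_Mapping.lookup m i)"

text \<open>The zero polynomial gets degree 0.\<close>

definition total_degree :: "'a::zero mvpoly \<Rightarrow> nat" where
  "total_degree p = Max (insert 0 (monom_degree ` Poly_Mapping.keys p))"

definition eval_mvpoly :: "'a::comm_semiring_1 mvpoly \<Rightarrow> (nat \<Rightarrow> 'a) \<Rightarrow> 'a" where
  "eval_mvpoly p x =
     (\<Sum>m\<in>Poly_Mapping.keys p.
        Poly_Mapping.lookup p m * (\<Prod>i\<in>Poly_Mapping.keys m. x i ^ Poly_Mapping.lookup m i))"

definition homogeneous_form :: "nat \<Rightarrow> 'a::zero mvpoly \<Rightarrow> bool" where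
  "homogeneous_form e p \<longleftrightarrow> p \<noteq> 0 \<and> (\<forall>m\<in>Poly_Mapping.keys p. monom_degree m = e)"

text \<open>The space \<open>F\<^sup>n\<close> is the set of sequences over \<open>F\<close> that vanish from index \<open>n\<close> on, a finite
  dimensional subspace of the space of all sequences.\<close>

definition affine_n_space :: "nat \<Rightarrow> (nat \<Rightarrow> 'a::zero) set" where
  "affine_n_space n = {x. \<forall>i\<ge>n. x i = 0}"

global_interpretation seq: vector_space "\<lambda>(c::'a::field) (x :: nat \<Rightarrow> 'a) i. c * x i"
  defines seq_subspace = seq.subspace
  by unfold_locales (auto simp: fun_eq_iff algebra_simps)

definition is_affine_space :: "nat \<Rightarrow> (nat \<Rightarrow> 'a::field) set \<Rightarrow> bool" where
  "is_affine_space n S \<longleftrightarrow>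
     (\<exists>v\<in>affine_n_space n. \<exists>W. W \<subseteq> affine_n_space n \<and> seq_subspace W \<and> S = (\<lambda>w. v + w) ` W)"

text \<open>A system \<open>f\<^sub>1, \<dots>, f\<^sub>r\<close> is given by \<open>f i\<close> for \<open>i < r\<close>.\<close>

definition common_zeros ::
    "nat \<Rightarrow> nat \<Rightarrow> (nat \<Rightarrow> 'a::comm_semiring_1 mvpoly) \<Rightarrow> (nat \<Rightarrow> 'a) set" where
  "common_zeros n r f = {x \<in> affine_n_space n. \<forall>i<r. eval_mvpoly (f i) x = 0}"

definition num_zeros :: "nat \<Rightarrow> nat \<Rightarrow> (nat \<Rightarrow> 'a::comm_semiring_1 mvpoly) \<Rightarrow> nat" where
  "num_zeros n r f = card (common_zeros n r f)"

definition system_degree :: "nat \<Rightarrow> (nat \<Rightarrow> 'a::zero mvpoly) \<Rightarrow> nat" where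
  "system_degree r f = (\<Sum>i<r. total_degree (f i))"

definition homogeneous_system :: "nat \<Rightarrow> (nat \<Rightarrow> 'a::zero mvpoly) \<Rightarrow> bool" where
  "homogeneous_system r f \<longleftrightarrow> (\<forall>i<r. homogeneous_form (total_degree (f i)) (f i))"

definition standing_hypotheses :: "nat \<Rightarrow> nat \<Rightarrow> (nat \<Rightarrow> 'a::field mvpoly) \<Rightarrow> bool" where
  "standing_hypotheses n r f \<longleftrightarrow>
     (\<forall>i<r. f i \<in> mvpolys n) \<and> n > system_degree r f \<and>
     common_zeros n r f \<noteq> {} \<and> \<not> is_affine_space n (common_zeros n r f)"

end

(*
Everything rests on a congruence in the spirit of Ax and Katz: if L and L' are parallel affine
subspaces of dimension d, then Z meets them in the same number of points modulo q (not only modulo p);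
hence Z meets every affine subspace of dimension larger than d in a multiple of q points. To get it, the
indicator function of Z is written in Teichmueller elements of the group ring Z[F*], modulo powers of
the kernel of Z[F*] -> F. After a multinomial expansion the p-adic valuation of each coefficient is a
digit sum (Legendre). Rotating digits cyclically turns the degree condition into k inequalities, one for
each power of Frobenius, and the integrality of each of them contributes one factor p.

The rest is counting. Let M be an affine subspace of dimension k < d. Every point of Z outside M lies in
exactly one of the (q^(n-k) - 1)/(q - 1) subspaces of dimension k + 1 containing M. If k < d - 1, one new
point in each of them is already enough for the lower bounds; if k = d - 1, two are enough. For q >= 3
and |Z| < 2 q^(n-d) this shows, descending from dimension d, that Z meets every affine subspace in 0 or 1
points modulo q (in dimension d - 1 the residue -1 is excluded by looking at all directions at once).
For lines this says that Z is affine. For q = 2 one ascends from a plane with exactly three points of Z.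

In the homogeneous case count projectively: let b >= 2 be minimal such that some plane spanned by two
points of Z has b projective points of Z. Such a plane extends to dimension d without acquiring points,
and each further extension to dimension d + 1 has 1 modulo q projective points. Either all of them have
at least 2 q + 1, or one of them has q + 1 and contains a plane with at most q + 2 - b, so 2 b <= q + 2.
*)
theory Submission
  imports
    Defs
    "HOL-Library.FuncSet"
    "HOL-Computational_Algebra.Polynomial"
    "HOL-Number_Theory.Cong"
begin

text \<open>To compare the slices x_l = a of a zero set, its points are weighted by powers
  teich(x_l)^b with b < q - 1. Under every rotation of digits b stays below q - 1, so the weight
  never costs a whole degree, and "degree less than number of variables" still suffices. Fourier
  inversion over F* then isolates the slice at a together with the slice at 0. Two parallel flats of
  dimension d are two such slices of a system in d + 1 variables.

  The expansion replaces the Teichmueller element of a polynomial value by a sum of Teichmueller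
  elements of monomials, which is correct only up to residue 0. Raising to the power p^(k-1) turns
  this into an error of order k and does not change the (q - 1)-st power of a Teichmueller element;
  hence the exponent (q - 1) p^(k-1).

  Both homogeneous bounds follow from the same three alternatives by algebra in X = q^(n-d).
  Equality is attained by the quadric cone x0 x1 = x2^2 and, for prime q, by two parallel
  lines.\<close>

section \<open>Digit sums and rotations of digits\<close>

text \<open>The base-\<open>p\<close> digit with index \<open>l\<close> gets the weight \<open>p\<close> to the power \<open>(j + l) mod k\<close>, so numbers
  below \<open>p ^ k\<close> have their \<open>k\<close> digits rotated by \<open>j\<close> places; for \<open>k = 1\<close> all weights are 1.\<close>

fun rot_digits :: "nat \<Rightarrow> nat \<Rightarrow> nat \<Rightarrow> nat \<Rightarrow> nat" where
  "rot_digits p k j a =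
     (if a = 0 \<or> p < 2 then 0 else (a mod p) * p ^ (j mod k) + rot_digits p k (Suc j) (a div p))"

declare rot_digits.simps [simp del]

abbreviation digit_sum :: "nat \<Rightarrow> nat \<Rightarrow> nat" where
  "digit_sum p \<equiv> rot_digits p 1 0"

lemma rot_digits_0 [simp]: "rot_digits p k j 0 = 0"
  by (simp add: rot_digits.simps)

lemma rot_digits_rec:
  assumes "p \<ge> 2"
  shows "rot_digits p k j a = (a mod p) * p ^ (j mod k) + rot_digits p k (Suc j) (a div p)"
  using assms by (cases "a = 0") (simp_all add: rot_digits.simps[of p k j a])

lemma rot_digits_1_shift: "rot_digits p 1 j a = digit_sum p a"
proof (induction a arbitrary: j rule: less_induct)
  case (less a)
  have "rot_digits p 1 i a = (if a = 0 \<or> p < 2 then 0 else a mod p + digit_sum p (a div p))" for i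
    using less[of "a div p" "Suc i"] by (cases "a = 0 \<or> p < 2") (auto simp: rot_digits.simps[of p _ _ a])
  from this[of j] this[of 0] show ?case by simp
qed

lemma digit_sum_rec:
  assumes "p \<ge> 2"
  shows "digit_sum p a = a mod p + digit_sum p (a div p)"
  using rot_digits_rec[OF assms, of 1 0 a] rot_digits_1_shift[of p "Suc 0" "a div p"] by simp

lemma digit_sum_mult_power:
  assumes "p \<ge> 2"
  shows "digit_sum p (a * p ^ l) = digit_sum p a"
proof (induction l)
  case (Suc l)
  have "digit_sum p (a * p ^ Suc l) = digit_sum p ((a * p ^ l) * p)" by (simp add: mult_ac)
  also have "\<dots> = digit_sum p (a * p ^ l)"
    using assms by (subst digit_sum_rec) auto
  finally show ?case using Suc by simp
qed simp

lemma digit_sum_power_minus_1: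
  assumes "p \<ge> 2"
  shows "digit_sum p (p ^ k - 1) = k * (p - 1)"
proof (induction k)
  case (Suc k)
  have pos: "p ^ k \<ge> 1" using assms by simp
  have eq: "p ^ Suc k - 1 = (p ^ k - 1) * p + (p - 1)"
    using assms pos by (simp add: algebra_simps diff_mult_distrib2)
  have "(p ^ Suc k - 1) mod p = p - 1" "(p ^ Suc k - 1) div p = p ^ k - 1"
    unfolding eq using assms by (simp_all only: mod_mult_self3 div_mult_self3) auto
  then show ?case using Suc assms digit_sum_rec[of p "p ^ Suc k - 1"] by simp
qed simp

text \<open>Adding 1 to n turns its trailing digits p - 1, whose number is the multiplicity of p in
  n + 1, into zeros and raises the next digit by 1. The induction removes one trailing digit at a
  time.\<close>

lemma multiplicity_digit_sum:
  assumes "prime p"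
  shows "(p - 1) * multiplicity p (Suc n) + digit_sum p (Suc n) = digit_sum p n + 1"
proof (induction n rule: less_induct)
  case (less n)
  have p2: "p \<ge> 2" using assms prime_ge_2_nat by blast
  show ?case
  proof (cases "p dvd Suc n")
    case False
    then have "Suc n mod p = Suc (n mod p)" "Suc n div p = n div p"
      by (auto simp: mod_Suc div_Suc dvd_eq_mod_eq_0)
    then show ?thesis
      using False p2 digit_sum_rec[of p "Suc n"] digit_sum_rec[of p n]
      by (simp add: not_dvd_imp_multiplicity_0)
  next
    case True
    then obtain m' where m': "Suc n = p * m'" by auto
    then have "m' > 0" by (cases m') auto
    then obtain m where m: "m' = Suc m" by (cases m') auto
    have n: "n = m * p + (p - 1)" using m' m p2 by (simp add: algebra_simps)
    have "m * 1 \<le> m * p" using p2 by (intro mult_left_mono) auto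
    then have "m < n" using n p2 by linarith
    have "n mod p = p - 1" "n div p = m"
      unfolding n using p2 by (simp_all only: mod_mult_self3 div_mult_self3) auto
    then have 1: "digit_sum p n = p - 1 + digit_sum p m" using p2 digit_sum_rec[of p n] by simp
    have 2: "digit_sum p (Suc n) = digit_sum p (Suc m)"
      using digit_sum_mult_power[OF p2, of "Suc m" 1] m' m by (simp add: mult.commute)
    have 3: "multiplicity p (Suc n) = Suc (multiplicity p (Suc m))"
      unfolding m' m using assms by (intro multiplicity_times_same) auto
    show ?thesis using less[OF \<open>m < n\<close>] 1 2 3 p2 by simp
  qed
qed

lemma legendre_digit_sum:
  assumes "prime p"
  shows "(p - 1) * multiplicity p (fact n :: nat) + digit_sum p n = n"
proof (induction n)
  case (Suc n)
  have "multiplicity p (fact (Suc n) :: nat) = multiplicity p (Suc n) + multiplicity p (fact n :: nat)"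
    unfolding fact_Suc of_nat_id using assms
    by (subst prime_elem_multiplicity_mult_distrib) auto
  then show ?case using Suc multiplicity_digit_sum[OF assms, of n] by (simp add: algebra_simps)
qed simp

text \<open>Kummer's theorem: the multiplicity is the number of carries in the sum of a and n - a.
  In this form without division the equations can be added up along an iterated binomial
  expansion.\<close>

lemma multiplicity_binomial:
  assumes "prime p" "a \<le> n"
  shows "(p - 1) * multiplicity p (n choose a) + digit_sum p n = digit_sum p a + digit_sum p (n - a)"
proof -
  have "fact n = fact a * fact (n - a) * (n choose a)"
    using binomial_fact_lemma[OF assms(2)] by simp
  moreover have "n choose a \<noteq> 0" using assms(2) by simp
  ultimately have "multiplicity p (fact n :: nat) =
      multiplicity p (fact a :: nat) + multiplicity p (fact (n - a) :: nat) + multiplicity p (n choose a)"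
    using assms(1) by (simp add: prime_elem_multiplicity_mult_distrib)
  then have "(p - 1) * multiplicity p (fact n :: nat) =
      (p - 1) * multiplicity p (fact a :: nat) + (p - 1) * multiplicity p (fact (n - a) :: nat)
       + (p - 1) * multiplicity p (n choose a)"
    by (simp add: algebra_simps)
  then show ?thesis
    using legendre_digit_sum[OF assms(1), of n] legendre_digit_sum[OF assms(1), of a]
      legendre_digit_sum[OF assms(1), of "n - a"] assms(2) by linarith
qed

section \<open>Rotating digits as multiplication by a power of p modulo p^k - 1\<close>

lemma power_mod_exponent_cong:
  fixes p k j :: nat
  assumes "p \<ge> 2"
  shows "[p ^ (j mod k) = p ^ j] (mod p ^ k - 1)"
proof -
  have "[p ^ k = 1] (mod p ^ k - 1)"
    using assms by (simp add: cong_altdef_nat)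
  then have "[(p ^ k) ^ (j div k) * p ^ (j mod k) = 1 ^ (j div k) * p ^ (j mod k)] (mod p ^ k - 1)"
    by (intro cong_mult cong_pow cong_refl)
  moreover have "(p ^ k) ^ (j div k) * p ^ (j mod k) = p ^ j"
    by (metis power_mult power_add mult_div_mod_eq)
  ultimately show ?thesis by (simp add: cong_sym)
qed

text \<open>Modulo p^k - 1 the weights depend only on their exponents modulo k, so a rotation acts
  like a shift by j places. This covers numbers with more than k digits, whose higher digits wrap
  around.\<close>

lemma rot_digits_cong:
  assumes "p \<ge> 2"
  shows "[rot_digits p k j a = p ^ j * a] (mod p ^ k - 1)"
proof (induction a arbitrary: j rule: less_induct)
  case (less a)
  show ?case
  proof (cases "a = 0")
    case False
    then have "[rot_digits p k (Suc j) (a div p) = p ^ Suc j * (a div p)] (mod p ^ k - 1)"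
      using assms by (intro less) auto
    then have "[(a mod p) * p ^ (j mod k) + rot_digits p k (Suc j) (a div p)
        = (a mod p) * p ^ j + p ^ Suc j * (a div p)] (mod p ^ k - 1)"
      by (intro cong_add cong_mult power_mod_exponent_cong assms) auto
    moreover have "(a mod p) * p ^ j + p ^ Suc j * (a div p) = p ^ j * (a mod p + p * (a div p))"
      by (simp only: distrib_left power_Suc mult_ac)
    ultimately show ?thesis
      using rot_digits_rec[OF assms, of k j a] by simp
  qed simp
qed

lemma rot_digits_pos:
  assumes "p \<ge> 2" "a > 0"
  shows "rot_digits p k j a > 0"
  using assms(2)
proof (induction a arbitrary: j rule: less_induct)
  case (less a)
  have rec: "rot_digits p k j a = (a mod p) * p ^ (j mod k) + rot_digits p k (Suc j) (a div p)"
    by (rule rot_digits_rec[OF assms(1)])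
  show ?case
  proof (cases "a mod p = 0")
    case True
    then have "p \<le> a" using less.prems by (metis mod_less not_le neq0_conv)
    then have "0 < a div p" "a div p < a" using less.prems assms(1) by (auto simp: div_greater_zero_iff)
    then have "rot_digits p k (Suc j) (a div p) > 0" by (intro less.IH)
    then show ?thesis unfolding rec by linarith
  next
    case False
    then have "(a mod p) * p ^ (j mod k) > 0" using assms(1) by simp
    then show ?thesis unfolding rec by linarith
  qed
qed

lemma sum_mod_shift:
  fixes g :: "nat \<Rightarrow> 'a::comm_monoid_add"
  assumes "k > 0" and g: "\<And>j. g (j + k) = g j"
  shows "(\<Sum>j<k. g (i + j)) = (\<Sum>j<k. g j)"
proof (induction i)
  case (Suc i)
  obtain k' where k': "k = Suc k'" using assms(1) by (cases k) auto
  have "(\<Sum>j<k. g (i + j)) = g i + (\<Sum>j<k'. g (Suc i + j))"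
    unfolding k' by (subst sum.lessThan_Suc_shift) simp
  also have "\<dots> = (\<Sum>j<k'. g (Suc i + j)) + g (Suc i + k')"
    using g[of i] by (simp add: k' add_ac)
  also have "\<dots> = (\<Sum>j<k. g (Suc i + j))"
    unfolding k' by simp
  finally show ?case using Suc by simp
qed simp

lemma rot_digits_period: "rot_digits p k (j + k) a = rot_digits p k j a"
proof (induction a arbitrary: j rule: less_induct)
  case (less a)
  show ?case
  proof (cases "a = 0 \<or> p < 2")
    case False
    then have "rot_digits p k (Suc j + k) (a div p) = rot_digits p k (Suc j) (a div p)"
      by (intro less) auto
    then show ?thesis by (simp add: rot_digits.simps[of p k _ a])
  qed (auto simp: rot_digits.simps)
qed

lemma sum_power_mod:
  fixes p k i :: nat
  assumes "p \<ge> 2" "k > 0"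
  shows "(p - 1) * (\<Sum>j<k. p ^ ((i + j) mod k)) = p ^ k - 1"
proof -
  have "(\<Sum>j<k. p ^ ((i + j) mod k)) = (\<Sum>j<k. p ^ (j mod k))"
    by (rule sum_mod_shift[OF assms(2)]) simp
  also have "\<dots> = (\<Sum>j<k. p ^ j)" by (intro sum.cong) auto
  finally have "(p - 1) * (\<Sum>j<k. p ^ ((i + j) mod k)) = (p - 1) * (\<Sum>j<k. p ^ j)" by simp
  moreover have "(p - 1) * (\<Sum>j<l. p ^ j) + 1 = p ^ l" for l
  proof (induction l)
    case (Suc l)
    have "(p - 1) * (\<Sum>j<Suc l. p ^ j) + 1 = ((p - 1) * (\<Sum>j<l. p ^ j) + 1) + (p - 1) * p ^ l"
      by (simp add: distrib_left)
    also have "\<dots> = (p - 1 + 1) * p ^ l" unfolding Suc by (simp only: distrib_right mult_1 add.commute)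
    finally show ?case using assms(1) by simp
  qed simp
  ultimately show ?thesis by (metis add_diff_cancel_right')
qed

text \<open>As j runs, each digit meets every weight p^0, ..., p^(k-1) exactly once, and these
  weights add up to (p^k - 1)/(p - 1). This converts digit sums, hence valuations, into totals over
  all rotations.\<close>

lemma sum_rot_digits:
  assumes "p \<ge> 2" "k > 0"
  shows "(p - 1) * (\<Sum>j<k. rot_digits p k j a) = digit_sum p a * (p ^ k - 1)"
proof (induction a rule: less_induct)
  case (less a)
  show ?case
  proof (cases "a = 0")
    case False
    have "(\<Sum>j<k. rot_digits p k (Suc j) (a div p)) = (\<Sum>j<k. rot_digits p k j (a div p))"
      using sum_mod_shift[of k "\<lambda>j. rot_digits p k j (a div p)" 1] assms rot_digits_period by simp
    then have 1: "(\<Sum>j<k. rot_digits p k j a)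
        = (a mod p) * (\<Sum>j<k. p ^ (j mod k)) + (\<Sum>j<k. rot_digits p k j (a div p))"
      by (simp add: rot_digits_rec[OF assms(1), of k _ a] sum.distrib sum_distrib_left)
    have 2: "(p - 1) * (\<Sum>j<k. rot_digits p k j (a div p)) = digit_sum p (a div p) * (p ^ k - 1)"
      using False assms by (intro less) auto
    have "(p - 1) * (\<Sum>j<k. rot_digits p k j a)
        = (a mod p) * ((p - 1) * (\<Sum>j<k. p ^ (j mod k))) + (p - 1) * (\<Sum>j<k. rot_digits p k j (a div p))"
      unfolding 1 by (simp add: algebra_simps)
    also have "\<dots> = (a mod p) * (p ^ k - 1) + digit_sum p (a div p) * (p ^ k - 1)"
      using 2 sum_power_mod[OF assms, of 0] by simp
    also have "\<dots> = digit_sum p a * (p ^ k - 1)"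
      using digit_sum_rec[OF assms(1), of a] by (simp add: algebra_simps)
    finally show ?thesis .
  qed simp
qed

lemma rot_digits_le:
  assumes "p \<ge> 2" "a < p ^ l"
  shows "rot_digits p k j a \<le> (p - 1) * (\<Sum>i<l. p ^ ((j + i) mod k))"
  using assms(2)
proof (induction l arbitrary: a j)
  case (Suc l)
  have "a div p < p ^ l" using Suc.prems assms
    by (metis less_mult_imp_div_less mult.commute power_Suc)
  then have 1: "rot_digits p k (Suc j) (a div p) \<le> (p - 1) * (\<Sum>i<l. p ^ ((Suc j + i) mod k))"
    by (rule Suc.IH)
  have 2: "(a mod p) * p ^ (j mod k) \<le> (p - 1) * p ^ (j mod k)"
  proof -
    have "a mod p < p" using assms by simp
    then show ?thesis by (intro mult_right_mono) auto
  qed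
  have "rot_digits p k j a \<le> (p - 1) * p ^ (j mod k) + (p - 1) * (\<Sum>i<l. p ^ ((Suc j + i) mod k))"
    using 1 2 rot_digits_rec[OF assms(1), of k j a] by linarith
  also have "\<dots> = (p - 1) * (\<Sum>i<Suc l. p ^ ((j + i) mod k))"
    by (subst sum.lessThan_Suc_shift) (simp add: algebra_simps)
  finally show ?case .
qed simp

text \<open>The rotated value is at most p^k - 1, reached only if all weights carry the digit p - 1;
  equality would make p^k - 1 divide a, hence a = 0, whose rotation is 0. The strictness pays for
  the extra weight in one variable.\<close>

lemma rot_digits_less:
  assumes "p \<ge> 2" "k > 0" "a < p ^ k - 1"
  shows "rot_digits p k j a < p ^ k - 1"
proof (rule ccontr)
  assume neg: "\<not> ?thesis"
  have le: "rot_digits p k j a \<le> p ^ k - 1"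
    using rot_digits_le[OF assms(1), of a k k j] sum_power_mod[OF assms(1,2), of j] assms(3) by simp
  with neg have eq: "rot_digits p k j a = p ^ k - 1" by simp
  then have "[p ^ j * a = 0] (mod p ^ k - 1)"
    using rot_digits_cong[OF assms(1), of k j a] by (simp add: cong_def)
  moreover have "coprime (p ^ j) (p ^ k - 1)"
  proof -
    have "coprime (p ^ k) (p ^ k - 1)"
      using assms(1) coprime_diff_one_right_nat[of "p ^ k"] by simp
    then have "coprime p (p ^ k - 1)"
      using assms(2) by (simp add: coprime_power_left_iff)
    then show ?thesis by (cases j) (auto)
  qed
  ultimately have "p ^ k - 1 dvd a"
    by (metis cong_0_iff coprime_commute coprime_dvd_mult_right_iff)
  then have "a = 0" using assms(3) by (metis dvd_imp_le gr0I not_le)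
  then show False using eq assms by simp
qed

text \<open>\<open>al i m\<close> is the exponent of the m-th monomial in a term of the expanded
  i-th power, \<open>e i m\<close> the exponent vector of that monomial, and \<open>v i\<close> the
  valuation given by Legendre's formula; k (p - 1) is the digit sum of (p^k - 1) p^(k-1).
  \<open>E t\<close> is the resulting exponent of variable t, with the weight b added at t =
  l.\<close>

lemma katz_valuation_bound:
  fixes al :: "'i \<Rightarrow> 'm \<Rightarrow> nat" and e :: "'i \<Rightarrow> 'm \<Rightarrow> nat \<Rightarrow> nat"
  assumes p: "p \<ge> 2" and k: "k > 0" and A: "finite A" and I: "\<And>i. i \<in> A \<Longrightarrow> finite (I i)"
    and al: "\<And>i. i \<in> A \<Longrightarrow> (\<Sum>m\<in>I i. al i m) = (p ^ k - 1) * p ^ (k - 1)"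
    and v: "\<And>i. i \<in> A \<Longrightarrow> (p - 1) * v i + k * (p - 1) = (\<Sum>m\<in>I i. digit_sum p (al i m))"
    and D: "\<And>i m. i \<in> A \<Longrightarrow> m \<in> I i \<Longrightarrow> (\<Sum>t<n. e i m t) \<le> D i"
    and n: "(\<Sum>i\<in>A. D i) < n" and b: "b < p ^ k - 1" and l: "l < n"
    and E: "\<And>t. t < n \<Longrightarrow> E t = (if t = l then b else 0) + (\<Sum>i\<in>A. \<Sum>m\<in>I i. al i m * e i m t)"
    and pos: "\<And>t. t < n \<Longrightarrow> E t > 0" and dvd: "\<And>t. t < n \<Longrightarrow> p ^ k - 1 dvd E t"
  shows "k \<le> (\<Sum>i\<in>A. v i)"
proof -
  define Q where "Q = p ^ k - 1"
  let ?r = "rot_digits p k"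
  have Qpos: "Q > 0" using b by (simp add: Q_def)
  have "\<exists>c. (\<Sum>m\<in>I i. ?r j (al i m)) = Q * c \<and> c > 0" if i: "i \<in> A" for i j
  proof -
    have "[(\<Sum>m\<in>I i. ?r j (al i m)) = (\<Sum>m\<in>I i. p ^ j * al i m)] (mod Q)"
      unfolding Q_def by (intro cong_sum rot_digits_cong p)
    moreover have "(\<Sum>m\<in>I i. p ^ j * al i m) = Q * (p ^ j * p ^ (k - 1))"
      using al[OF i] by (simp add: Q_def mult_ac flip: sum_distrib_left)
    ultimately have "Q dvd (\<Sum>m\<in>I i. ?r j (al i m))"
      by (simp add: cong_dvd_iff)
    then obtain c where c: "(\<Sum>m\<in>I i. ?r j (al i m)) = Q * c" by auto
    have "(\<Sum>m\<in>I i. al i m) > 0" using al[OF i] Qpos p by (simp add: Q_def)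
    then obtain m where "m \<in> I i" "al i m > 0"
      by (metis gr0I not_gr_zero sum.neutral)
    then have "(\<Sum>m\<in>I i. ?r j (al i m)) > 0"
      using rot_digits_pos[OF p, of "al i m" k j] I[OF i] by (metis gr0I sum_eq_0_iff not_gr_zero)
    then show ?thesis using c by (auto intro!: exI[of _ c])
  qed
  \<comment> \<open>\<open>c i j\<close> acts as a multiplicity of the i-th equation under rotation
    j: the degree inequality becomes n <= sum of \<open>c i j * D i\<close>, while summing over j
    recovers \<open>v i + k\<close>.\<close>
  then obtain c where c: "\<And>i j. i \<in> A \<Longrightarrow> (\<Sum>m\<in>I i. ?r j (al i m)) = Q * c i j"
    and cpos: "\<And>i j. i \<in> A \<Longrightarrow> c i j > 0" by metis
  have sumc: "(\<Sum>j<k. c i j) = v i + k" if i: "i \<in> A" for i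
  proof -
    have "(p - 1) * (\<Sum>j<k. \<Sum>m\<in>I i. ?r j (al i m)) = (\<Sum>m\<in>I i. (p - 1) * (\<Sum>j<k. ?r j (al i m)))"
      by (subst sum.swap) (simp add: sum_distrib_left)
    also have "\<dots> = (\<Sum>m\<in>I i. digit_sum p (al i m)) * Q"
      using sum_rot_digits[OF p k] by (simp add: Q_def sum_distrib_right)
    also have "\<dots> = (p - 1) * (Q * (v i + k))" using v[OF i, symmetric] by (simp add: algebra_simps)
    finally have "(\<Sum>j<k. \<Sum>m\<in>I i. ?r j (al i m)) = Q * (v i + k)" using p by simp
    then have "Q * (\<Sum>j<k. c i j) = Q * (v i + k)" using c[OF i] by (simp add: sum_distrib_left)
    then show ?thesis using Qpos by simp
  qed
  have big: "(\<Sum>i\<in>A. c i j) \<ge> card A + 1" for j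
  proof -
    let ?E = "\<lambda>t. (if t = l then ?r j b else 0) + (\<Sum>i\<in>A. \<Sum>m\<in>I i. ?r j (al i m) * e i m t)"
    \<comment> \<open>\<open>?E t\<close> is \<open>E t\<close> computed with rotated digits: it is
      congruent to p^j \<open>E t\<close>, hence divisible by Q, and it stays positive.\<close>
    have "Q \<le> ?E t" if t: "t < n" for t
    proof -
      have "[?E t = (if t = l then p ^ j * b else 0) + (\<Sum>i\<in>A. \<Sum>m\<in>I i. (p ^ j * al i m) * e i m t)] (mod Q)"
        unfolding Q_def
        by (cases "t = l"; simp only: if_True if_False simp_thms)
          (intro cong_add cong_sum cong_mult cong_refl rot_digits_cong p)+
      moreover have "(if t = l then p ^ j * b else 0) + (\<Sum>i\<in>A. \<Sum>m\<in>I i. (p ^ j * al i m) * e i m t) = p ^ j * E t"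
        using E[OF t] by (simp add: sum_distrib_left mult_ac distrib_left)
      moreover have "Q dvd p ^ j * E t" using dvd[OF t] by (simp add: Q_def)
      ultimately have "Q dvd ?E t" by (simp add: cong_dvd_iff)
      moreover have "?E t > 0"
      proof (rule ccontr)
        assume "\<not> ?E t > 0"
        then have z: "?E t = 0" by simp
        have b0: "(if t = l then b else 0) = 0"
          using z rot_digits_pos[OF p, of b k j] by (cases "b = 0") (auto split: if_splits)
        have "al i m * e i m t = 0" if "i \<in> A" "m \<in> I i" for i m
        proof -
          have "(\<Sum>i\<in>A. \<Sum>m\<in>I i. ?r j (al i m) * e i m t) = 0" using z by simp
          then have "?r j (al i m) * e i m t = 0" using that A I by (simp add: sum_eq_0_iff)
          then show ?thesis using rot_digits_pos[OF p, of "al i m" k j] by (cases "al i m = 0") auto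
        qed
        then have "(\<Sum>i\<in>A. \<Sum>m\<in>I i. al i m * e i m t) = 0" by (intro sum.neutral ballI)
        then have "E t = 0" using E[OF t] b0 by simp
        then show False using pos[OF t] by simp
      qed
      ultimately show ?thesis by (simp add: dvd_imp_le)
    qed
    then have "(\<Sum>t<n. Q) \<le> (\<Sum>t<n. ?E t)" by (intro sum_mono) auto
    also have "\<dots> = ?r j b + (\<Sum>t<n. \<Sum>i\<in>A. \<Sum>m\<in>I i. ?r j (al i m) * e i m t)"
      using l by (simp add: sum.distrib sum.delta)
    also have "(\<Sum>t<n. \<Sum>i\<in>A. \<Sum>m\<in>I i. ?r j (al i m) * e i m t)
        = (\<Sum>i\<in>A. \<Sum>m\<in>I i. ?r j (al i m) * (\<Sum>t<n. e i m t))"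
      by (subst sum.swap, rule sum.cong, rule refl, subst sum.swap) (simp add: sum_distrib_left)
    also have "\<dots> \<le> (\<Sum>i\<in>A. \<Sum>m\<in>I i. ?r j (al i m) * D i)"
      using D by (intro sum_mono mult_left_mono) auto
    also have "\<dots> = Q * (\<Sum>i\<in>A. c i j * D i)"
      unfolding sum_distrib_left by (rule sum.cong) (simp_all add: c mult.assoc flip: sum_distrib_right)
    finally have "Q * n \<le> ?r j b + Q * (\<Sum>i\<in>A. c i j * D i)" by (simp add: mult.commute)
    \<comment> \<open>Being strictly below Q, the rotated weight disappears after division by Q, so
      n itself is reached and not just n - 1.\<close>
    moreover have "?r j b < Q" using rot_digits_less[OF p k b] by (simp add: Q_def)
    ultimately have "Q * n < Q * Suc (\<Sum>i\<in>A. c i j * D i)" by simp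
    then have le: "n \<le> (\<Sum>i\<in>A. c i j * D i)" using Qpos by (metis less_Suc_eq_le mult_less_cancel1)
    have "\<exists>i\<in>A. c i j \<ge> 2"
    proof (rule ccontr)
      assume "\<not> ?thesis"
      then have "c i j \<le> 1" if "i \<in> A" for i using that by force
      then have "(\<Sum>i\<in>A. c i j * D i) \<le> (\<Sum>i\<in>A. 1 * D i)" by (intro sum_mono mult_right_mono) auto
      then show False using le n by simp
    qed
    then obtain i0 where i0: "i0 \<in> A" "c i0 j \<ge> 2" by blast
    have "(\<Sum>i\<in>A. 1 + (if i = i0 then 1 else 0)) \<le> (\<Sum>i\<in>A. c i j)"
      using i0 cpos by (intro sum_mono) (auto simp: Suc_le_eq)
    moreover have "(\<Sum>i\<in>A. 1 + (if i = i0 then 1 else 0)) = card A + (1::nat)"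
      unfolding sum.distrib using i0 A by simp
    ultimately show ?thesis by simp
  qed
  \<comment> \<open>Summed over the k rotations, the surplus of 1 in each gives k in total; the
    terms k times \<open>card A\<close> cancel.\<close>
  have "(\<Sum>j<k. card A + 1) \<le> (\<Sum>j<k. \<Sum>i\<in>A. c i j)" using big by (intro sum_mono) auto
  also have "\<dots> = (\<Sum>i\<in>A. v i + k)" by (subst sum.swap) (simp add: sumc)
  finally show ?thesis by (simp add: sum.distrib algebra_simps)
qed

section \<open>Multinomial expansion with divisibility\<close>

lemma closed_nat_multiple:
  fixes M :: "('x \<Rightarrow> 'r::comm_ring_1) set"
  assumes "(\<lambda>_. 0) \<in> M" "\<And>f g. f \<in> M \<Longrightarrow> g \<in> M \<Longrightarrow> (\<lambda>x. f x + g x) \<in> M" "f \<in> M"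
  shows "(\<lambda>x. of_nat c * f x) \<in> M"
proof (induction c)
  case (Suc c)
  have "(\<lambda>x. of_nat (Suc c) * f x) = (\<lambda>x. f x + of_nat c * f x)"
    by (simp add: algebra_simps)
  then show ?case using assms(2)[OF assms(3) Suc] by simp
qed (use assms in simp)

lemma closed_sum:
  fixes M :: "('x \<Rightarrow> 'r::comm_ring_1) set"
  assumes "(\<lambda>_. 0) \<in> M" "\<And>f g. f \<in> M \<Longrightarrow> g \<in> M \<Longrightarrow> (\<lambda>x. f x + g x) \<in> M"
    and "\<And>i. i \<in> S \<Longrightarrow> f i \<in> M"
  shows "(\<lambda>x. \<Sum>i\<in>S. f i x) \<in> M"
  using assms(3)
proof (induction S rule: infinite_finite_induct)
  case (insert i S)
  then have "(\<lambda>x. f i x + (\<Sum>i\<in>S. f i x)) \<in> M" by (intro assms(2)) auto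
  then show ?case using insert.hyps by simp
qed (use assms(1) in simp_all)

text \<open>Splitting off one summand at a time turns a multinomial coefficient into a product of
  binomial ones. Only its power of p is recorded, because the cofactor is absorbed by the additive
  closure of \<open>M\<close>; the digit sums telescope to the equation for \<open>v\<close>. The
  factor \<open>z\<close> collects what has already been split off. Membership in \<open>M\<close>
  concerns functions, so that a condition on a sum over all points can be inserted later.\<close>

lemma power_sum_expand:
  fixes Y :: "'m \<Rightarrow> 'x \<Rightarrow> 'r::comm_ring_1" and M :: "('x \<Rightarrow> 'r) set"
  assumes p: "prime p" and zero: "(\<lambda>_. 0) \<in> M"
    and add: "\<And>f g. f \<in> M \<Longrightarrow> g \<in> M \<Longrightarrow> (\<lambda>x. f x + g x) \<in> M"
    and I: "finite I"
    and H: "\<And>al v. (\<Sum>m\<in>I. al m) = n \<Longrightarrow>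
              (p - 1) * v + digit_sum p n = (\<Sum>m\<in>I. digit_sum p (al m)) \<Longrightarrow>
              (\<lambda>x. of_nat p ^ v * (\<Prod>m\<in>I. Y m x ^ al m) * z x) \<in> M"
  shows "(\<lambda>x. (\<Sum>m\<in>I. Y m x) ^ n * z x) \<in> M"
  using I H
proof (induction I arbitrary: n z rule: finite_induct)
  case empty
  show ?case
  proof (cases "n = 0")
    case True
    then show ?thesis using empty[of "\<lambda>_. 0" 0] by simp
  qed (use zero in \<open>simp add: power_0_left\<close>)
next
  case (insert i I)
  have term_mem: "(\<lambda>x. of_nat (n choose a) * Y i x ^ a * (\<Sum>m\<in>I. Y m x) ^ (n - a) * z x) \<in> M"
    if a: "a \<le> n" for a
  proof -
    define v0 where "v0 = multiplicity p (n choose a)"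
    obtain c where c: "n choose a = p ^ v0 * c"
      using multiplicity_dvd[of p "n choose a"] by (auto simp: v0_def)
    have v0: "(p - 1) * v0 + digit_sum p n = digit_sum p a + digit_sum p (n - a)"
      unfolding v0_def by (rule multiplicity_binomial[OF p a])
    have "(\<lambda>x. (\<Sum>m\<in>I. Y m x) ^ (n - a) * (of_nat p ^ v0 * Y i x ^ a * z x)) \<in> M"
    proof (rule insert.IH)
      fix al :: "'m \<Rightarrow> nat" and v
      assume al: "(\<Sum>m\<in>I. al m) = n - a"
        and v: "(p - 1) * v + digit_sum p (n - a) = (\<Sum>m\<in>I. digit_sum p (al m))"
      let ?al = "al(i := a)"
      have eqI: "(\<Sum>m\<in>I. g (?al m)) = (\<Sum>m\<in>I. g (al m))" for g :: "nat \<Rightarrow> nat"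
        using insert.hyps by (intro sum.cong) auto
      have prodI: "(\<Prod>m\<in>I. Y m x ^ ?al m) = (\<Prod>m\<in>I. Y m x ^ al m)" for x
        using insert.hyps by (intro prod.cong) auto
      have "(\<lambda>x. of_nat p ^ (v0 + v) * (\<Prod>m\<in>insert i I. Y m x ^ ?al m) * z x) \<in> M"
      proof (rule insert.prems)
        show "(\<Sum>m\<in>insert i I. ?al m) = n"
          using eqI[of "\<lambda>x. x"] insert.hyps al a by simp
        show "(p - 1) * (v0 + v) + digit_sum p n = (\<Sum>m\<in>insert i I. digit_sum p (?al m))"
        proof -
          have "(\<Sum>m\<in>insert i I. digit_sum p (?al m)) = digit_sum p a + (\<Sum>m\<in>I. digit_sum p (al m))"
            unfolding sum.insert[OF insert.hyps] eqI[of "digit_sum p"] by simp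
          then show ?thesis unfolding distrib_left using v v0 by linarith
        qed
      qed
      then show "(\<lambda>x. of_nat p ^ v * (\<Prod>m\<in>I. Y m x ^ al m) * (of_nat p ^ v0 * Y i x ^ a * z x)) \<in> M"
        unfolding prod.insert[OF insert.hyps] prodI by (simp add: power_add mult_ac)
    qed
    then have "(\<lambda>x. of_nat c * ((\<Sum>m\<in>I. Y m x) ^ (n - a) * (of_nat p ^ v0 * Y i x ^ a * z x))) \<in> M"
      by (intro closed_nat_multiple[where M = M]) (use zero add in auto)
    moreover have "(\<lambda>x. of_nat c * ((\<Sum>m\<in>I. Y m x) ^ (n - a) * (of_nat p ^ v0 * Y i x ^ a * z x)))
        = (\<lambda>x. of_nat (n choose a) * Y i x ^ a * (\<Sum>m\<in>I. Y m x) ^ (n - a) * z x)"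
      unfolding c by (simp add: mult_ac)
    ultimately show ?thesis by simp
  qed
  have "(\<lambda>x. \<Sum>a\<in>{..n}. of_nat (n choose a) * Y i x ^ a * (\<Sum>m\<in>I. Y m x) ^ (n - a) * z x) \<in> M"
    by (intro closed_sum[where M = M] zero add term_mem) auto
  moreover have "(\<Sum>m\<in>insert i I. Y m x) ^ n * z x
      = (\<Sum>a\<in>{..n}. of_nat (n choose a) * Y i x ^ a * (\<Sum>m\<in>I. Y m x) ^ (n - a) * z x)" for x
    using insert.hyps by (simp add: binomial_ring sum_distrib_right)
  ultimately show ?case by simp
qed

lemma prod_power_sum_expand:
  fixes Y :: "'i \<Rightarrow> 'm \<Rightarrow> 'x \<Rightarrow> 'r::comm_ring_1" and M :: "('x \<Rightarrow> 'r) set"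
  assumes p: "prime p" and zero: "(\<lambda>_. 0) \<in> M"
    and add: "\<And>f g. f \<in> M \<Longrightarrow> g \<in> M \<Longrightarrow> (\<lambda>x. f x + g x) \<in> M"
    and A: "finite A" and I: "\<And>i. finite (I i)"
    and H: "\<And>al v. (\<And>i. i \<in> A \<Longrightarrow> (\<Sum>m\<in>I i. al i m) = n) \<Longrightarrow>
              (\<And>i. i \<in> A \<Longrightarrow> (p - 1) * v i + digit_sum p n = (\<Sum>m\<in>I i. digit_sum p (al i m))) \<Longrightarrow>
              (\<lambda>x. of_nat p ^ (\<Sum>i\<in>A. v i) * (\<Prod>i\<in>A. \<Prod>m\<in>I i. Y i m x ^ al i m) * z x) \<in> M"
  shows "(\<lambda>x. (\<Prod>i\<in>A. (\<Sum>m\<in>I i. Y i m x) ^ n) * z x) \<in> M"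
  using A H
proof (induction A arbitrary: z rule: finite_induct)
  case empty
  from empty[of "\<lambda>_ _. 0" "\<lambda>_. 0"] show ?case by simp
next
  case (insert j A)
  have "(\<lambda>x. (\<Sum>m\<in>I j. Y j m x) ^ n * ((\<Prod>i\<in>A. (\<Sum>m\<in>I i. Y i m x) ^ n) * z x)) \<in> M"
  proof (rule power_sum_expand[OF p zero add I])
    fix be :: "'m \<Rightarrow> nat" and w
    assume be: "(\<Sum>m\<in>I j. be m) = n"
      and w: "(p - 1) * w + digit_sum p n = (\<Sum>m\<in>I j. digit_sum p (be m))"
    have "(\<lambda>x. (\<Prod>i\<in>A. (\<Sum>m\<in>I i. Y i m x) ^ n) * (of_nat p ^ w * (\<Prod>m\<in>I j. Y j m x ^ be m) * z x)) \<in> M"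
    proof (rule insert.IH)
      fix al :: "'i \<Rightarrow> 'm \<Rightarrow> nat" and v
      assume al: "\<And>i. i \<in> A \<Longrightarrow> (\<Sum>m\<in>I i. al i m) = n"
        and v: "\<And>i. i \<in> A \<Longrightarrow> (p - 1) * v i + digit_sum p n = (\<Sum>m\<in>I i. digit_sum p (al i m))"
      let ?al = "al(j := be)" and ?v = "v(j := w)"
      have 1: "(\<Prod>i\<in>A. \<Prod>m\<in>I i. Y i m x ^ ?al i m) = (\<Prod>i\<in>A. \<Prod>m\<in>I i. Y i m x ^ al i m)" for x
        using insert.hyps by (intro prod.cong refl) auto
      have 2: "(\<Sum>i\<in>A. ?v i) = (\<Sum>i\<in>A. v i)"
        using insert.hyps by (intro sum.cong refl) auto
      have "(\<lambda>x. of_nat p ^ (\<Sum>i\<in>insert j A. ?v i)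
          * (\<Prod>i\<in>insert j A. \<Prod>m\<in>I i. Y i m x ^ ?al i m) * z x) \<in> M"
        by (rule insert.prems) (use al v be w in auto)
      then show "(\<lambda>x. of_nat p ^ (\<Sum>i\<in>A. v i) * (\<Prod>i\<in>A. \<Prod>m\<in>I i. Y i m x ^ al i m)
          * (of_nat p ^ w * (\<Prod>m\<in>I j. Y j m x ^ be m) * z x)) \<in> M"
        unfolding sum.insert[OF insert.hyps] prod.insert[OF insert.hyps] 1 2
        by (simp add: power_add mult_ac)
    qed
    then show "(\<lambda>x. of_nat p ^ w * (\<Prod>m\<in>I j. Y j m x ^ be m)
        * ((\<Prod>i\<in>A. (\<Sum>m\<in>I i. Y i m x) ^ n) * z x)) \<in> M"
      by (simp add: mult_ac)
  qed
  then show ?case using insert.hyps by (simp add: mult_ac)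
qed

section \<open>The group ring of the units and Teichmueller elements\<close>

text \<open>The unit group is written additively because the product of \<open>poly_mapping\<close>
  adds keys; finitely supported integer maps on it then form the group ring Z[F*].\<close>

typedef (overloaded) 'a munit = "{x::'a::field. x \<noteq> 0}"
  by (rule exI[of _ 1]) simp

setup_lifting type_definition_munit

instantiation munit :: (field) ab_group_add
begin
lift_definition zero_munit :: "'a munit" is 1 by simp
lift_definition plus_munit :: "'a munit \<Rightarrow> 'a munit \<Rightarrow> 'a munit" is "(*)" by simp
lift_definition uminus_munit :: "'a munit \<Rightarrow> 'a munit" is inverse by simp
lift_definition minus_munit :: "'a munit \<Rightarrow> 'a munit \<Rightarrow> 'a munit" is "(/)" by simp
instance by standard (transfer; simp add: field_simps)+
end

instance munit :: ("{field,finite}") finite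
proof
  have "(UNIV :: 'a munit set) = Abs_munit ` {x. x \<noteq> 0}"
    using type_definition.Abs_image[OF type_definition_munit] by metis
  then show "finite (UNIV :: 'a munit set)" by (metis finite finite_imageI)
qed

type_synonym 'a unit_ring = "'a munit \<Rightarrow>\<^sub>0 int"

lemma poly_mapping_eq_sum_single:
  fixes P :: "'k::finite \<Rightarrow>\<^sub>0 'b::comm_monoid_add"
  shows "P = (\<Sum>u\<in>UNIV. Poly_Mapping.single u (Poly_Mapping.lookup P u))"
  by (rule poly_mapping_eqI) (simp add: lookup_sum lookup_single when_def)

text \<open>The ring homomorphism Z[F*] -> F extending the inclusion of the units. It takes the
  place of reduction modulo p in an unramified extension of the p-adic integers.\<close>

definition residue :: "'a::{field,finite} unit_ring \<Rightarrow> 'a" where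
  "residue P = (\<Sum>u\<in>UNIV. of_int (Poly_Mapping.lookup P u) * Rep_munit u)"

lemma residue_single [simp]: "residue (Poly_Mapping.single u c) = of_int c * Rep_munit u"
proof -
  have "residue (Poly_Mapping.single u c) = (\<Sum>v\<in>UNIV. if v = u then of_int c * Rep_munit u else 0)"
    unfolding residue_def by (intro sum.cong) (auto simp: lookup_single when_def)
  then show ?thesis by simp
qed

lemma residue_0 [simp]: "residue 0 = 0"
  by (simp add: residue_def)

lemma residue_1 [simp]: "residue 1 = 1"
  using residue_single[of 0 1] by (simp add: zero_munit.rep_eq)

lemma residue_add [simp]: "residue (P + Q) = residue P + residue Q"
  by (simp add: residue_def lookup_add sum.distrib distrib_right)

lemma residue_uminus [simp]: "residue (- P) = - residue P"
  by (simp add: residue_def sum_negf)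

lemma residue_diff [simp]: "residue (P - Q) = residue P - residue Q"
  using residue_add[of P "- Q"] by simp

lemma residue_sum [simp]: "residue (\<Sum>i\<in>A. f i) = (\<Sum>i\<in>A. residue (f i))"
  by (induction A rule: infinite_finite_induct) auto

lemma residue_mult [simp]: "residue (P * Q) = residue P * residue Q"
proof -
  have "residue (P * Q) = residue ((\<Sum>u\<in>UNIV. Poly_Mapping.single u (Poly_Mapping.lookup P u))
      * (\<Sum>u\<in>UNIV. Poly_Mapping.single u (Poly_Mapping.lookup Q u)))"
    using poly_mapping_eq_sum_single[of P] poly_mapping_eq_sum_single[of Q] by simp
  also have "\<dots> = residue P * residue Q"
    unfolding sum_product mult_single residue_sum residue_single
    by (simp add: plus_munit.rep_eq residue_def sum_product mult_ac)
  finally show ?thesis .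
qed

lemma residue_power [simp]: "residue (P ^ n) = residue P ^ n"
  by (induction n) auto

lemma residue_of_nat [simp]: "residue (of_nat n) = of_nat n"
  by (induction n) auto

text \<open>The zero of the field goes to the zero of the ring and not to a basis element; this
  makes the map multiplicative on all of F.\<close>

definition teich :: "'a::{field,finite} \<Rightarrow> 'a unit_ring" where
  "teich a = (if a = 0 then 0 else Poly_Mapping.single (Abs_munit a) 1)"

lemma teich_0 [simp]: "teich 0 = 0"
  by (simp add: teich_def)

lemma teich_1 [simp]: "teich 1 = 1"
  by (simp add: teich_def flip: zero_munit_def)

lemma residue_teich [simp]: "residue (teich a) = a"
  by (simp add: teich_def Abs_munit_inverse)

lemma teich_mult: "teich (a * b) = teich a * teich b"
proof (cases "a = 0 \<or> b = 0")
  case False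
  then have "Abs_munit a + Abs_munit b = Abs_munit (a * b)"
    by (metis (mono_tags, lifting) Abs_munit_inverse Rep_munit_inverse mem_Collect_eq plus_munit.rep_eq)
  then show ?thesis using False by (simp add: teich_def mult_single)
qed auto

lemma teich_power: "teich (a ^ n) = teich a ^ n"
  by (induction n) (auto simp: teich_mult)

lemma teich_prod: "teich (\<Prod>i\<in>A. f i) = (\<Prod>i\<in>A. teich (f i))"
  by (induction A rule: infinite_finite_induct) (auto simp: teich_mult)

section \<open>Powers and power sums in a finite field\<close>

lemma power_card_minus_1:
  fixes x :: "'a::{field,finite}"
  assumes "x \<noteq> 0"
  shows "x ^ (CARD('a) - 1) = 1"
proof -
  have "(\<Prod>y\<in>UNIV-{0}. x * y) = x ^ (CARD('a) - 1) * \<Prod>(UNIV-{0::'a})"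
    by (simp add: prod.distrib card_Diff_singleton)
  moreover have "(\<Prod>y\<in>UNIV-{0}. x * y) = (\<Prod>y\<in>UNIV-{0}. y)"
    by (rule prod.reindex_bij_witness[of _ "\<lambda>y. y / x" "\<lambda>y. x * y"]) (use assms in auto)
  moreover have "(\<Prod>y\<in>UNIV-{0}. y) \<noteq> (0::'a)" by (simp add: prod_zero_iff)
  ultimately show ?thesis by simp
qed

lemma power_card_eq:
  fixes x :: "'a::{field,finite}"
  shows "x ^ CARD('a) = x"
proof (cases "x = 0")
  case False
  have "x ^ CARD('a) = x * x ^ (CARD('a) - 1)"
    using finite_UNIV_card_ge_0[where ?'a = 'a] by (simp flip: power_Suc)
  then show ?thesis using power_card_minus_1[OF False] by simp
qed (use finite_UNIV_card_ge_0[where ?'a = 'a] in auto)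

lemma card_field_ge_2: "CARD('a::{field,finite}) \<ge> 2"
proof -
  have "card {0, 1::'a} \<le> CARD('a)" by (intro card_mono) auto
  then show ?thesis by simp
qed

lemma of_nat_card_field: "of_nat CARD('a::{field,finite}) = (0::'a)"
proof -
  have "(\<Sum>x\<in>UNIV. x + 1) = (\<Sum>x\<in>UNIV. x::'a)"
    by (rule sum.reindex_bij_witness[of _ "\<lambda>y. y - 1" "\<lambda>y. y + 1"]) auto
  then show ?thesis by (simp add: sum.distrib)
qed

text \<open>X^e - 1 has at most e roots, fewer than there are units. This replaces the choice of a
  generator of the unit group.\<close>

lemma exists_power_neq_1:
  assumes "0 < e" "e < CARD('a::{field,finite}) - 1"
  shows "\<exists>c::'a. c \<noteq> 0 \<and> c ^ e \<noteq> 1"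
proof (rule ccontr)
  assume "\<not> ?thesis"
  then have sub: "UNIV - {0::'a} \<subseteq> {x. poly (monom 1 e - 1) x = 0}"
    by (auto simp: poly_monom)
  let ?P = "monom 1 e - 1 :: 'a poly"
  have "coeff ?P e = 1" using assms(1) by simp
  then have nz: "?P \<noteq> 0" by (metis coeff_0 zero_neq_one)
  have "degree ?P \<le> e" by (intro degree_diff_le) (auto simp: degree_monom_eq)
  moreover have "card (UNIV - {0::'a}) \<le> card {x. poly ?P x = 0}"
    using sub nz by (intro card_mono poly_roots_finite)
  ultimately have "CARD('a) - 1 \<le> e"
    using card_poly_roots_bound[OF nz] by (simp add: card_Diff_singleton)
  then show False using assms(2) by simp
qed

lemma exists_power_neq_1':
  assumes "\<not> (CARD('a::{field,finite}) - 1) dvd e"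
  shows "\<exists>c::'a. c \<noteq> 0 \<and> c ^ e \<noteq> 1"
proof -
  let ?Q = "CARD('a) - 1"
  have Q: "?Q > 0" using card_field_ge_2[where 'a='a] by simp
  have "e mod ?Q > 0" using assms by (simp add: dvd_eq_mod_eq_0)
  then obtain c :: 'a where c: "c \<noteq> 0" "c ^ (e mod ?Q) \<noteq> 1"
    using exists_power_neq_1[where 'a='a and e="e mod ?Q"] Q by auto
  have "c ^ e = (c ^ ?Q) ^ (e div ?Q) * c ^ (e mod ?Q)"
    by (metis power_add power_mult mult_div_mod_eq)
  then show ?thesis using c power_card_minus_1[OF c(1)] by auto
qed

lemma sum_mult_unit:
  fixes g :: "'a::{field,finite} \<Rightarrow> 'r::comm_monoid_add"
  assumes "c \<noteq> 0"
  shows "(\<Sum>a\<in>UNIV. g (c * a)) = (\<Sum>a\<in>UNIV. g a)"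
  by (rule sum.reindex_bij_witness[of _ "\<lambda>y. y / c" "\<lambda>y. c * y"]) (use assms in auto)

lemma sum_power_field:
  assumes "\<not> (CARD('a::{field,finite}) - 1) dvd e"
  shows "(\<Sum>a\<in>UNIV. a ^ e) = (0::'a)"
proof -
  obtain c :: 'a where c: "c \<noteq> 0" "c ^ e \<noteq> 1" using exists_power_neq_1'[OF assms] by blast
  have "c ^ e * (\<Sum>a\<in>UNIV. a ^ e) = (\<Sum>a\<in>UNIV. (c * a) ^ e)"
    by (simp add: sum_distrib_left power_mult_distrib)
  also have "\<dots> = 1 * (\<Sum>a\<in>UNIV. a ^ e)" using sum_mult_unit[OF c(1), of "\<lambda>a. a ^ e"] by simp
  finally show ?thesis using c(2) by (metis mult_cancel_right)
qed

locale finite_field_card =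
  fixes p k :: nat and ty :: "'a::{field,finite} itself"
  assumes prime_p: "prime p" and card_field: "CARD('a) = p ^ k"
begin

lemma p_ge_2: "p \<ge> 2"
  using prime_p prime_ge_2_nat by blast

lemma k_pos: "k > 0"
  using card_field card_field_ge_2[where 'a='a] by (cases k) auto

lemma CHAR_eq_p: "CHAR('a) = p"
proof -
  have "prime CHAR('a)"
    by (intro prime_CHAR_semidom finite_imp_CHAR_pos) simp
  moreover have "CHAR('a) dvd p ^ k" using of_nat_card_field[where 'a='a] card_field
    by (simp add: of_nat_eq_0_iff_char_dvd del: of_nat_power)
  ultimately show ?thesis using prime_p by (metis prime_dvd_power primes_dvd_imp_eq)
qed

lemma of_nat_p [simp]: "of_nat p = (0::'a)"
  using of_nat_CHAR[where 'a='a] CHAR_eq_p by simp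

section \<open>The absolute trace and the prime subfield\<close>

definition trace :: "'a \<Rightarrow> 'a" where
  "trace a = (\<Sum>j<k. a ^ (p ^ j))"

lemma frobenius_sum: "(\<Sum>i\<in>A. f i) ^ (p ^ j) = (\<Sum>i\<in>A. (f i :: 'a) ^ (p ^ j))"
  using freshmans_dream_sum'[of "p ^ j" j f A] CHAR_eq_p prime_p by simp

lemma trace_sum: "trace (\<Sum>i\<in>A. f i) = (\<Sum>i\<in>A. trace (f i))"
  unfolding trace_def frobenius_sum by (rule sum.swap)

lemma trace_0 [simp]: "trace 0 = 0"
  using p_ge_2 by (simp add: trace_def power_0_left)

text \<open>Frobenius permutes the summands cyclically.\<close>

lemma trace_power_p: "trace a ^ p = trace a"
proof -
  have "trace a ^ p = (\<Sum>j<k. a ^ (p ^ Suc j))"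
    unfolding trace_def using frobenius_sum[of "\<lambda>j. a ^ (p ^ j)" "{..<k}" 1]
    by (simp add: power_mult[symmetric] mult.commute)
  also have "\<dots> = (\<Sum>j<k. a ^ (p ^ j))"
  proof -
    have "a ^ p ^ k = a ^ p ^ 0" using power_card_eq[of a] card_field by simp
    then have "(\<Sum>j<Suc k. a ^ (p ^ j)) = a ^ p ^ 0 + (\<Sum>j<k. a ^ (p ^ j))" by simp
    moreover have "(\<Sum>j<Suc k. a ^ (p ^ j)) = a ^ p ^ 0 + (\<Sum>j<k. a ^ (p ^ Suc j))"
      by (rule sum.lessThan_Suc_shift)
    ultimately show ?thesis by simp
  qed
  finally show ?thesis by (simp add: trace_def)
qed

lemma of_nat_power_p: "(of_nat m :: 'a) ^ p = of_nat m"
proof (induction m)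
  case (Suc m)
  have "(of_nat (Suc m) :: 'a) ^ p = (1 + of_nat m) ^ p" by simp
  also have "\<dots> = 1 ^ p + of_nat m ^ p"
    by (rule freshmans_dream) (simp_all add: CHAR_eq_p prime_p)
  finally show ?case unfolding Suc by simp
qed (use p_ge_2 in auto)

text \<open>The p distinct images of 0, ..., p - 1 already exhaust the possible roots of X^p -
  X.\<close>

lemma prime_subfield:
  assumes "(a::'a) ^ p = a"
  shows "\<exists>m::nat. of_nat m = a"
proof (rule ccontr)
  assume neg: "\<not> ?thesis"
  let ?P = "monom 1 p - monom 1 1 :: 'a poly"
  let ?S = "insert a ((of_nat :: nat \<Rightarrow> 'a) ` {..<p})"
  have "coeff ?P p = 1" using p_ge_2 by simp
  then have nz: "?P \<noteq> 0" by (metis coeff_0 zero_neq_one)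
  have "inj_on (of_nat :: nat \<Rightarrow> 'a) {..<p}"
  proof (rule inj_onI)
    fix x y assume "x \<in> {..<p}" "y \<in> {..<p}" "of_nat x = (of_nat y :: 'a)"
    then show "x = y" using of_nat_eq_iff_cong_CHAR[where 'a='a, of x y] CHAR_eq_p
      by (simp add: cong_def)
  qed
  then have "card ?S = p + 1"
    using neg by (subst card_insert_disjoint) (auto simp: card_image)
  moreover have "card ?S \<le> card {x. poly ?P x = 0}"
    using nz assms of_nat_power_p by (intro card_mono poly_roots_finite) (auto simp: poly_monom)
  moreover have "degree ?P \<le> p"
    using p_ge_2 by (intro degree_diff_le) (auto simp: degree_monom_eq)
  ultimately show False using card_poly_roots_bound[OF nz] by simp
qed

text \<open>An integer lift of the trace, usable as a coefficient in the group ring; only its class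
  modulo p will matter.\<close>

definition int_trace :: "'a \<Rightarrow> int" where
  "int_trace a = int (SOME m::nat. of_nat m = trace a)"

lemma of_int_int_trace: "of_int (int_trace a) = trace a"
proof -
  have "of_nat (SOME m::nat. of_nat m = trace a) = trace a"
    by (rule someI_ex, rule prime_subfield, rule trace_power_p)
  then show ?thesis by (simp add: int_trace_def)
qed

text \<open>Multiplication by this element kills the kernel of the residue map modulo \<open>p\<close>. This makes
  \<open>deep m\<close> below a substitute for the \<open>m\<close>-th power of the kernel whose intersection with the
  integers is easy to determine.\<close>

definition wt :: "'a unit_ring" where
  "wt = (\<Sum>u\<in>UNIV. Poly_Mapping.single u (int_trace (Rep_munit (- u))))"

text \<open>Modulo p, the coefficient of \<open>wt * x\<close> at g is the trace of
  \<open>residue x\<close> divided by g, since the trace is linear over the prime field.\<close>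

lemma dvd_wt_mult:
  assumes "residue x = (0::'a)"
  shows "of_nat p dvd wt * x"
proof -
  let ?c = "\<lambda>g. \<Sum>h\<in>UNIV. int_trace (Rep_munit (h - g)) * Poly_Mapping.lookup x h"
  have look: "Poly_Mapping.lookup (wt * x) g = ?c g" for g
  proof -
    have "wt * x = wt * (\<Sum>h\<in>UNIV. Poly_Mapping.single h (Poly_Mapping.lookup x h))"
      using poly_mapping_eq_sum_single[of x] by simp
    also have "\<dots> = (\<Sum>u\<in>UNIV. \<Sum>h\<in>UNIV. Poly_Mapping.single (u + h)
        (int_trace (Rep_munit (- u)) * Poly_Mapping.lookup x h))"
      by (simp add: wt_def sum_product mult_single)
    also have "Poly_Mapping.lookup \<dots> g = (\<Sum>h\<in>UNIV. \<Sum>u\<in>UNIV.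
        if u = g - h then int_trace (Rep_munit (h - g)) * Poly_Mapping.lookup x h else 0)"
      unfolding lookup_sum
      by (subst sum.swap, intro sum.cong) (auto simp: lookup_single when_def algebra_simps)
    finally show ?thesis by simp
  qed
  have p_dvd: "int p dvd ?c g" for g
  proof -
    have "of_int (?c g) = (\<Sum>h\<in>UNIV. trace (Rep_munit (h - g) ) * of_int (Poly_Mapping.lookup x h))"
      by (simp add: of_int_int_trace)
    also have "\<dots> = trace (\<Sum>h\<in>UNIV. Rep_munit (h - g) * of_int (Poly_Mapping.lookup x h))"
    proof -
      have frob: "(of_int z :: 'a) ^ (p ^ j) = of_int z" for z :: int and j
      proof -
        obtain m :: nat where m: "(of_int z :: 'a) = of_nat m"
        proof -
          have "(of_int z :: 'a) = of_int (z mod int p)"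
            using of_int_eq_iff_cong_CHAR[where 'a='a, of z "z mod int p"] CHAR_eq_p by (simp add: cong_def)
          also have "\<dots> = of_nat (nat (z mod int p))" using p_ge_2 by simp
          finally show ?thesis using that by blast
        qed
        show ?thesis unfolding m by (induction j) (simp_all add: power_mult of_nat_power_p mult.commute[of p])
      qed
      have "trace (b * of_int z) = trace b * of_int z" for b z
        by (simp add: trace_def power_mult_distrib frob sum_distrib_right)
      then show ?thesis by (simp add: trace_sum)
    qed
    also have "(\<Sum>h\<in>UNIV. Rep_munit (h - g) * of_int (Poly_Mapping.lookup x h)) = residue x / Rep_munit g"
      by (simp add: residue_def minus_munit.rep_eq sum_divide_distrib mult_ac)
    also have "\<dots> = 0" using assms by simp
    finally show ?thesis
      using of_int_eq_0_iff_char_dvd[where 'a='a, of "?c g"] CHAR_eq_p by simp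
  qed
  define d where "d g = ?c g div int p" for g
  have d: "?c g = int p * d g" for g
    unfolding d_def by (rule dvd_mult_div_cancel[OF p_dvd, symmetric])
  have "wt * x = of_nat p * (\<Sum>g\<in>UNIV. Poly_Mapping.single g (d g))"
  proof -
    have "wt * x = (\<Sum>g\<in>UNIV. Poly_Mapping.single g (int p * d g))"
      using poly_mapping_eq_sum_single[of "wt * x"] look d by simp
    also have "\<dots> = of_nat p * (\<Sum>g\<in>UNIV. Poly_Mapping.single g (d g))"
      by (simp add: sum_distrib_left mult_single flip: single_of_nat)
    finally show ?thesis .
  qed
  then show ?thesis by simp
qed

text \<open>The residue is the sum of Tr(a)/a over the nonzero a, that is, of a^(p^j - 1) over j and
  a. For 0 < j < k the exponent lies strictly between 0 and q - 1 and the power sum vanishes; j = 0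
  contributes q - 1 = -1.\<close>

lemma residue_wt: "residue wt = -1"
proof -
  have s: "(\<Sum>u\<in>UNIV. g (Rep_munit (u :: 'a munit))) = (\<Sum>a\<in>UNIV - {0}. g a)" for g :: "'a \<Rightarrow> 'a"
    using type_definition.Rep_range[OF type_definition_munit, where 'a1='a]
    by (subst sum.reindex[symmetric, unfolded o_def, where h = Rep_munit])
      (auto simp: inj_on_def Rep_munit_inject intro!: sum.cong)
  have "residue wt = (\<Sum>u\<in>UNIV. trace (inverse (Rep_munit u)) * Rep_munit u)"
    by (simp add: wt_def of_int_int_trace uminus_munit.rep_eq)
  also have "\<dots> = (\<Sum>a\<in>UNIV - {0}. trace (inverse a) * a)"
    by (rule s)
  also have "\<dots> = (\<Sum>a\<in>UNIV - {0}. trace a * inverse a)"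
    by (rule sum.reindex_bij_witness[of _ inverse inverse]) auto
  also have "\<dots> = (\<Sum>j<k. \<Sum>a\<in>UNIV - {0}. a ^ (p ^ j - 1))"
    unfolding trace_def sum_distrib_right
  proof (subst sum.swap, intro sum.cong refl)
    fix j a assume "a \<in> UNIV - {0::'a}"
    moreover have "p ^ j > 0" using p_ge_2 by simp
    ultimately show "a ^ p ^ j * inverse a = a ^ (p ^ j - 1)"
      by (cases "p ^ j") simp_all
  qed
  also have "\<dots> = (\<Sum>j<k. if j = 0 then -1 else 0)"
  proof (intro sum.cong refl)
    fix j assume j: "j \<in> {..<k}"
    show "(\<Sum>a\<in>UNIV - {0}. a ^ (p ^ j - 1)) = (if j = 0 then -1 else 0 :: 'a)"
    proof (cases "j = 0")
      case True
      have "of_nat (CARD('a) - 1) = (of_nat (CARD('a)) - 1 :: 'a)"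
        using card_field_ge_2[where 'a='a] by (subst of_nat_diff) auto
      also have "\<dots> = -1" by (simp add: card_field k_pos)
      finally show ?thesis using True by (simp add: card_Diff_singleton)
    next
      case False
      then have "1 < p ^ j" using p_ge_2 by (intro one_less_power) auto
      moreover have "p ^ j < p ^ k" using j p_ge_2 by (intro power_strict_increasing) auto
      ultimately have r: "0 < p ^ j - 1" "p ^ j - 1 < CARD('a) - 1" using card_field by auto
      then have "(\<Sum>a\<in>UNIV. a ^ (p ^ j - 1)) = (0::'a)"
        by (intro sum_power_field) (auto dest: dvd_imp_le)
      moreover have "(0::'a) ^ (p ^ j - 1) = 0" using r by (simp add: power_0_left)
      ultimately show ?thesis using False by (simp only: sum_diff1[OF finite] UNIV_I if_True if_False diff_0_right)
    qed
  qed
  also have "\<dots> = -1" using k_pos by simp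
  finally show ?thesis .
qed

definition deep :: "nat \<Rightarrow> 'a unit_ring set" where
  "deep m = {x. of_nat (p ^ m) dvd wt ^ m * x}"

section \<open>Calculus of the filtration \<open>deep\<close>\<close>

lemma deep_0 [simp]: "0 \<in> deep m"
  by (simp add: deep_def)

lemma deep_add: "x \<in> deep m \<Longrightarrow> y \<in> deep m \<Longrightarrow> x + y \<in> deep m"
  by (simp add: deep_def distrib_left)

lemma deep_diff: "x \<in> deep m \<Longrightarrow> y \<in> deep m \<Longrightarrow> x - y \<in> deep m"
  by (simp add: deep_def right_diff_distrib)

lemma deep_mult_right: "x \<in> deep m \<Longrightarrow> x * y \<in> deep m"
  by (simp add: deep_def flip: mult.assoc)

lemma deep_mult_left: "x \<in> deep m \<Longrightarrow> y * x \<in> deep m"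
  using deep_mult_right[of x m y] by (simp add: mult.commute)

lemma deep_mult:
  assumes "x \<in> deep m" "y \<in> deep l"
  shows "x * y \<in> deep (m + l)"
proof -
  have "of_nat (p ^ m) * of_nat (p ^ l) dvd (wt ^ m * x) * (wt ^ l * y)"
    using assms by (intro mult_dvd_mono) (auto simp: deep_def)
  then show ?thesis by (simp add: deep_def power_add mult_ac)
qed

lemma deep_sum: "(\<And>i. i \<in> A \<Longrightarrow> f i \<in> deep m) \<Longrightarrow> (\<Sum>i\<in>A. f i) \<in> deep m"
  by (induction A rule: infinite_finite_induct) (auto intro: deep_add)

lemma deep_1: "residue x = 0 \<Longrightarrow> x \<in> deep 1"
  using dvd_wt_mult by (simp add: deep_def)

lemma deep_power: "residue x = 0 \<Longrightarrow> x ^ m \<in> deep m"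
  by (induction m) (use deep_mult[OF deep_1] in \<open>auto simp: deep_def[of 0]\<close>)

lemma of_nat_p_power_deep: "of_nat p ^ m \<in> deep m"
  by (rule deep_power) simp

text \<open>Let N = p^v c with c prime to p. If v < m, cancelling p^v leaves
  \<open>wt ^ m * of_int c\<close> divisible by p, so its residue is 0; but that residue is c up to
  sign.\<close>

lemma of_int_deep:
  assumes "of_int N \<in> deep m"
  shows "int (p ^ m) dvd N"
proof (rule ccontr)
  assume neg: "\<not> ?thesis"
  define v where "v = multiplicity (int p) N"
  have N0: "N \<noteq> 0" using neg by auto
  obtain c where c: "N = int p ^ v * c" and pc: "\<not> int p dvd c"
    using N0 p_ge_2 multiplicity_decompose'[of N "int p"] by (auto simp: v_def)
  have "v < m" using neg c le_imp_power_dvd[of m v "int p"] by (metis dvd_mult2 not_le of_nat_power)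
  from assms obtain y where y: "wt ^ m * of_int N = of_nat (p ^ m) * y"
    by (auto simp: deep_def)
  have eq: "of_nat (p ^ v) * (wt ^ m * of_int c) = of_nat (p ^ v) * (of_nat (p ^ (m - v)) * y)"
  proof -
    have "p ^ m = p ^ v * p ^ (m - v)" using \<open>v < m\<close> by (simp flip: power_add)
    then show ?thesis using y unfolding c by (simp add: mult_ac)
  qed
  have cancel: "x = z" if "of_nat (p ^ v) * x = of_nat (p ^ v) * z" for x z :: "'a unit_ring"
  proof (rule poly_mapping_eqI)
    fix u
    have l: "Poly_Mapping.lookup (of_nat n * x) u = int n * Poly_Mapping.lookup x u" for n and x :: "'a unit_ring"
      by (induction n) (simp_all add: lookup_add distrib_right)
    have "int (p ^ v) * Poly_Mapping.lookup x u = int (p ^ v) * Poly_Mapping.lookup z u"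
      using that l by metis
    then show "Poly_Mapping.lookup x u = Poly_Mapping.lookup z u" using p_ge_2 by simp
  qed
  have "wt ^ m * of_int c = of_nat (p ^ (m - v)) * y" by (rule cancel[OF eq])
  then have "residue (wt ^ m * of_int c) = residue (of_nat (p ^ (m - v)) * y)" by simp
  moreover have "residue (of_int c) = (of_int c :: 'a)"
    by (cases c rule: int_cases2) simp_all
  ultimately have "(of_int c :: 'a) = 0"
    using \<open>v < m\<close> by (simp add: residue_wt power_0_left)
  then show False using pc of_int_eq_0_iff_char_dvd[where 'a='a, of c] CHAR_eq_p by simp
qed

text \<open>Up to residue 0, \<open>teich a - 1\<close> has the inverse
  \<open>teich (inverse (a - 1))\<close>; a geometric series in the error e improves this to an
  error e^m, which lies in \<open>deep m\<close>.\<close>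

lemma deep_cancel:
  assumes "(teich a - 1) * y \<in> deep m" "a \<noteq> (1::'a)"
  shows "y \<in> deep m"
proof -
  define e where "e = 1 - teich (inverse (a - 1)) * (teich a - 1)"
  have re: "residue e = 0" using assms(2) by (simp add: e_def)
  have "(1 - e) * y \<in> deep m"
    using deep_mult_left[OF assms(1), of "teich (inverse (a - 1))"] by (simp add: e_def mult_ac)
  then have "(\<Sum>i<m. e ^ i) * ((1 - e) * y) \<in> deep m" by (rule deep_mult_left)
  moreover have "(\<Sum>i<m. e ^ i) * ((1 - e) * y) = (1 - e ^ m) * y"
    using one_diff_power_eq[of e m] by (simp add: mult_ac)
  ultimately have "(1 - e ^ m) * y \<in> deep m" by simp
  moreover have "e ^ m * y \<in> deep m" using deep_power[OF re] by (rule deep_mult_right)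
  ultimately have "(1 - e ^ m) * y + e ^ m * y \<in> deep m" by (rule deep_add)
  then show ?thesis by (simp add: algebra_simps)
qed

text \<open>In the binomial expansion in d = x - y every term contains d and one more factor of
  residue 0: the binomial coefficient if i < p, and d^(p-1) if i = p.\<close>

lemma power_p_cong:
  assumes "x - y \<in> deep (Suc m)" "residue x = residue y"
  shows "x ^ p - y ^ p \<in> deep (Suc (Suc m))"
proof -
  define d where "d = x - y"
  have rd: "residue d = 0" using assms(2) by (simp add: d_def)
  have x: "x = d + y" by (simp add: d_def)
  have "x ^ p = (\<Sum>i\<le>p. of_nat (p choose i) * d ^ i * y ^ (p - i))"
    unfolding x by (rule binomial_ring)
  also have "\<dots> = y ^ p + (\<Sum>i\<in>{1..p}. of_nat (p choose i) * d ^ i * y ^ (p - i))"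
    by (subst sum.atMost_shift) (simp add: sum.shift_bounds_Suc_ivl sum.atLeast1_atMost_eq)
  finally have "x ^ p - y ^ p = (\<Sum>i\<in>{1..p}. of_nat (p choose i) * d ^ i * y ^ (p - i))" by simp
  also have "\<dots> \<in> deep (Suc (Suc m))"
  proof (rule deep_sum)
    fix i assume i: "i \<in> {1..p}"
    have di: "d ^ i = d * d ^ (i - 1)" using i by (cases i) auto
    have "of_nat (p choose i) * d ^ (i - 1) \<in> deep 1"
    proof (rule deep_1, cases "i = p")
      case True
      then show "residue (of_nat (p choose i) * d ^ (i - 1)) = 0"
        using rd p_ge_2 by (simp add: power_0_left)
    next
      case False
      then have "p dvd (p choose i)" using i prime_p by (intro dvd_choose_prime) auto
      then have "of_nat (p choose i) = (0::'a)" using CHAR_eq_p of_nat_eq_0_iff_char_dvd by blast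
      then show "residue (of_nat (p choose i) * d ^ (i - 1)) = 0" by simp
    qed
    then have "d * (of_nat (p choose i) * d ^ (i - 1)) \<in> deep (Suc m + 1)"
      using assms(1) by (intro deep_mult) (simp_all add: d_def)
    then have "(d * (of_nat (p choose i) * d ^ (i - 1))) * y ^ (p - i) \<in> deep (Suc m + 1)"
      by (rule deep_mult_right)
    then show "of_nat (p choose i) * d ^ i * y ^ (p - i) \<in> deep (Suc (Suc m))"
      unfolding di by (simp add: mult_ac)
  qed
  finally show ?thesis .
qed

lemma power_p_power_cong:
  assumes "residue x = residue y"
  shows "x ^ (p ^ m) - y ^ (p ^ m) \<in> deep (Suc m)"
proof (induction m)
  case (Suc m)
  have "(x ^ (p ^ m)) ^ p - (y ^ (p ^ m)) ^ p \<in> deep (Suc (Suc m))"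
    using Suc assms by (intro power_p_cong) auto
  then show ?case by (simp add: power_mult[symmetric] mult.commute)
qed (use assms in \<open>auto intro!: deep_1[unfolded One_nat_def]\<close>)

end

section \<open>Slices of zero sets modulo q\<close>

lemma affine_n_space_0: "affine_n_space 0 = {\<lambda>_. 0}"
  by (auto simp: affine_n_space_def)

lemma affine_n_space_Suc:
  "affine_n_space (Suc n) = (\<lambda>(x, a). x(n := a)) ` (affine_n_space n \<times> UNIV)"
proof (rule set_eqI, rule iffI)
  fix x :: "nat \<Rightarrow> 'a" assume "x \<in> affine_n_space (Suc n)"
  then have "x i = 0" if "i > n" for i using that by (auto simp: affine_n_space_def Suc_le_eq)
  then have "(x(n := 0), x n) \<in> affine_n_space n \<times> UNIV"
    by (auto simp: affine_n_space_def)
  then have "(\<lambda>(x, a). x(n := a)) (x(n := 0), x n) \<in> (\<lambda>(x, a). x(n := a)) ` (affine_n_space n \<times> UNIV)"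
    by (rule imageI)
  then show "x \<in> (\<lambda>(x, a). x(n := a)) ` (affine_n_space n \<times> UNIV)" by simp
qed (auto simp: affine_n_space_def)

lemma inj_on_affine_n_space_upd:
  "inj_on (\<lambda>(x, a). x(n := a)) (affine_n_space n \<times> (UNIV :: 'a::zero set))"
proof (rule inj_onI, clarify)
  fix x y :: "nat \<Rightarrow> 'a" and a b
  assume x: "x \<in> affine_n_space n" and y: "y \<in> affine_n_space n" and eq: "x(n := a) = y(n := b)"
  have "a = b" using fun_cong[OF eq, of n] by simp
  moreover have "x i = y i" for i
    using fun_cong[OF eq, of i] x y by (cases "i = n") (auto simp: affine_n_space_def)
  ultimately show "x = y \<and> a = b" by auto
qed

lemma sum_affine_n_space_Suc:
  "(\<Sum>x\<in>affine_n_space (Suc n). h x) = (\<Sum>x\<in>affine_n_space n. \<Sum>a\<in>(UNIV :: 'a::zero set). h (x(n := a)))"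
  unfolding affine_n_space_Suc sum.reindex[OF inj_on_affine_n_space_upd] o_def
  by (simp add: sum.cartesian_product case_prod_unfold)

lemma finite_affine_n_space [simp]: "finite (affine_n_space n :: (nat \<Rightarrow> 'a::{zero,finite}) set)"
  by (induction n) (simp_all add: affine_n_space_0 affine_n_space_Suc)

lemma card_affine_n_space: "card (affine_n_space n :: (nat \<Rightarrow> 'a::{zero,finite}) set) = CARD('a) ^ n"
  by (induction n)
    (simp_all add: affine_n_space_0 affine_n_space_Suc card_image inj_on_affine_n_space_upd card_cartesian_product)

lemma sum_prod_affine_n_space:
  fixes g :: "nat \<Rightarrow> 'a::{zero,finite} \<Rightarrow> 'r::comm_semiring_1"
  shows "(\<Sum>x\<in>affine_n_space n. \<Prod>t<n. g t (x t)) = (\<Prod>t<n. \<Sum>a\<in>UNIV. g t a)"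
proof (induction n)
  case (Suc n)
  have "(\<Sum>x\<in>affine_n_space (Suc n). \<Prod>t<Suc n. g t (x t))
      = (\<Sum>x\<in>affine_n_space n. \<Sum>a\<in>UNIV. (\<Prod>t<n. g t (x t)) * g n a)"
  proof -
    have "(\<Prod>t<Suc n. g t ((x(n := a)) t)) = (\<Prod>t<n. g t (x t)) * g n a" for x a
      unfolding prod.lessThan_Suc by (intro arg_cong2[where f="(*)"] prod.cong) auto
    then show ?thesis unfolding sum_affine_n_space_Suc by simp
  qed
  also have "\<dots> = (\<Sum>x\<in>affine_n_space n. \<Prod>t<n. g t (x t)) * (\<Sum>a\<in>UNIV. g n a)"
    by (simp add: sum_product)
  finally show ?case using Suc by simp
qed (simp add: affine_n_space_0)

text \<open>Polynomial functions given by a list of terms, possibly with repeated exponent vectors: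
  the expansion only needs an index set, coefficients and exponents, and affine substitution then
  requires no normal form.\<close>

definition poly_fun :: "nat \<Rightarrow> nat \<Rightarrow> ((nat \<Rightarrow> 'a) \<Rightarrow> 'a::comm_ring_1) \<Rightarrow> bool" where
  "poly_fun D n g \<longleftrightarrow> (\<exists>(N::nat) c e. (\<forall>m<N. (\<Sum>t<n. e m t) \<le> D) \<and>
     (\<forall>x. g x = (\<Sum>m<N. c m * (\<Prod>t<n. x t ^ e m t))))"

section \<open>Character sums over zero sets\<close>

context finite_field_card
begin

text \<open>For e = 0 the sum is the integer q = p^k, as 0^0 = 1. Otherwise the substitution a -> c
  a shows that \<open>teich (c ^ e) - 1\<close> annihilates it, and this factor can be
  cancelled.\<close>

lemma sum_teich_power:
  assumes "\<not> (e > 0 \<and> p ^ k - 1 dvd e)"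
  shows "(\<Sum>a\<in>(UNIV::'a set). teich a ^ e) \<in> deep k"
proof (cases "e = 0")
  case True
  then show ?thesis using of_nat_p_power_deep[of k] by (simp add: card_field)
next
  case False
  then have "\<not> CARD('a) - 1 dvd e" using assms card_field by auto
  then obtain c :: 'a where c: "c \<noteq> 0" "c ^ e \<noteq> 1" using exists_power_neq_1' by blast
  have "teich (c ^ e) * (\<Sum>a\<in>(UNIV::'a set). teich a ^ e) = (\<Sum>a\<in>UNIV. teich (c * a) ^ e)"
    by (simp add: sum_distrib_left teich_mult teich_power power_mult_distrib)
  also have "\<dots> = (\<Sum>a\<in>UNIV. teich a ^ e)" using sum_mult_unit[OF c(1), of "\<lambda>a. teich a ^ e"] .
  finally have "(teich (c ^ e) - 1) * (\<Sum>a\<in>(UNIV::'a set). teich a ^ e) = 0"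
    by (simp add: left_diff_distrib)
  then show ?thesis using c(2) deep_cancel[of "c ^ e" "\<Sum>a\<in>UNIV. teich a ^ e" k] by simp
qed

lemma teich_power_card_minus_1: "teich (y::'a) ^ (p ^ k - 1) = (if y = 0 then 0 else 1)"
proof (cases "y = 0")
  case True
  have "p ^ k - 1 > 0" using card_field_ge_2[where 'a='a] card_field by simp
  then show ?thesis using True by (simp add: power_0_left)
next
  case False
  then show ?thesis using power_card_minus_1[OF False] card_field by (simp flip: teich_power)
qed

lemmas teich_power_card_minus_Suc_0 = teich_power_card_minus_1[unfolded One_nat_def]

lemma deep_power_diff: "x - y \<in> deep m \<Longrightarrow> x ^ j - y ^ j \<in> deep m"
proof (induction j)
  case (Suc j)
  have "x ^ Suc j - y ^ Suc j = (x - y) * x ^ j + y * (x ^ j - y ^ j)"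
    by (simp add: algebra_simps)
  then show ?case using Suc by (auto intro: deep_add deep_mult_left deep_mult_right)
qed simp

lemma deep_prod_diff:
  "(\<And>i. i \<in> A \<Longrightarrow> f i - g i \<in> deep m) \<Longrightarrow> (\<Prod>i\<in>A. f i) - (\<Prod>i\<in>A. g i) \<in> deep m"
proof (induction A rule: infinite_finite_induct)
  case (insert i A)
  have "(\<Prod>i\<in>insert i A. f i) - (\<Prod>i\<in>insert i A. g i)
      = (f i - g i) * (\<Prod>i\<in>A. f i) + g i * ((\<Prod>i\<in>A. f i) - (\<Prod>i\<in>A. g i))"
    using insert.hyps by (simp add: algebra_simps)
  then show ?case using insert by (auto intro: deep_add deep_mult_left deep_mult_right)
qed simp_all

text \<open>After expansion each term factors into one-variable sums over F. Either one of these
  sums is already in \<open>deep k\<close>, or all exponents are positive multiples of q - 1 and the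
  coefficient is divisible by p^k.\<close>

lemma sum_prod_teich_power_deep:
  fixes g :: "'i \<Rightarrow> (nat \<Rightarrow> 'a) \<Rightarrow> 'a"
  assumes A: "finite A" and g: "\<And>i. i \<in> A \<Longrightarrow> poly_fun (D i) n (g i)"
    and n: "(\<Sum>i\<in>A. D i) < n" and l: "l < n" and b: "b < p ^ k - 1"
  shows "(\<Sum>x\<in>affine_n_space n. (\<Prod>i\<in>A. teich (g i x) ^ (p ^ k - 1)) * teich (x l) ^ b) \<in> deep k"
proof -
  define Q where "Q = p ^ k - 1"
  have "\<forall>i\<in>A. \<exists>N c e. (\<forall>m<N. (\<Sum>t<n. e m t) \<le> D i) \<and> (\<forall>x. g i x = (\<Sum>m<(N::nat). c m * (\<Prod>t<n. x t ^ e m t)))"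
    using g by (auto simp: poly_fun_def)
  then obtain N :: "'i \<Rightarrow> nat" and c and e :: "'i \<Rightarrow> nat \<Rightarrow> nat \<Rightarrow> nat"
    where "\<forall>i\<in>A. (\<forall>m<N i. (\<Sum>t<n. e i m t) \<le> D i) \<and> (\<forall>x. g i x = (\<Sum>m<N i. c i m * (\<Prod>t<n. x t ^ e i m t)))"
    unfolding bchoice_iff by blast
  then have e: "\<And>i m. i \<in> A \<Longrightarrow> m < N i \<Longrightarrow> (\<Sum>t<n. e i m t) \<le> D i"
    and gi: "\<And>i x. i \<in> A \<Longrightarrow> g i x = (\<Sum>m<N i. c i m * (\<Prod>t<n. x t ^ e i m t))"
    by blast+
  define Y where "Y i m x = teich (c i m) * (\<Prod>t<n. teich (x t) ^ e i m t)" for i m and x :: "nat \<Rightarrow> 'a"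
  define M where "M = {f :: (nat \<Rightarrow> 'a) \<Rightarrow> 'a unit_ring. (\<Sum>x\<in>affine_n_space n. f x) \<in> deep k}"
  let ?E = "Q * p ^ (k - 1)"
  have resY: "residue (\<Sum>m<N i. Y i m x) = g i x" if "i \<in> A" for i x
  proof -
    have "Y i m x = teich (c i m * (\<Prod>t<n. x t ^ e i m t))" for m
      by (simp add: Y_def teich_mult teich_prod teich_power)
    then show ?thesis using gi[OF that] by simp
  qed
  \<comment> \<open>The power p^(k-1) upgrades equal residues to a congruence modulo
    \<open>deep k\<close>; on the left it has no effect, because the (q - 1)-st power of a
    Teichmueller element is 0 or 1.\<close>
  have step: "(\<Prod>i\<in>A. teich (g i x) ^ Q) - (\<Prod>i\<in>A. (\<Sum>m<N i. Y i m x) ^ ?E) \<in> deep k" for x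
  proof (rule deep_prod_diff)
    fix i assume i: "i \<in> A"
    have "teich (g i x) ^ (p ^ (k - 1)) - (\<Sum>m<N i. Y i m x) ^ (p ^ (k - 1)) \<in> deep (Suc (k - 1))"
      using resY[OF i] by (intro power_p_power_cong) simp
    then have "(teich (g i x) ^ (p ^ (k - 1))) ^ Q - ((\<Sum>m<N i. Y i m x) ^ (p ^ (k - 1))) ^ Q \<in> deep k"
      using k_pos by (subst (asm) Suc_diff_1) (simp, rule deep_power_diff)
    moreover have "(teich (g i x) ^ (p ^ (k - 1))) ^ Q = (teich (g i x) ^ Q) ^ (p ^ (k - 1))"
      by (simp add: mult.commute flip: power_mult)
    moreover have "\<dots> = teich (g i x) ^ Q"
      using p_ge_2 by (simp add: Q_def teich_power_card_minus_Suc_0 power_0_left)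
    ultimately show "teich (g i x) ^ Q - (\<Sum>m<N i. Y i m x) ^ ?E \<in> deep k"
      by (simp add: mult.commute flip: power_mult)
  qed
  have "(\<lambda>x. (\<Prod>i\<in>A. (\<Sum>m\<in>{..<N i}. Y i m x) ^ ?E) * teich (x l) ^ b) \<in> M"
  proof (rule prod_power_sum_expand[OF prime_p _ _ A])
    show "(\<lambda>_. 0) \<in> M" by (simp add: M_def)
    show "(\<lambda>x. f x + h x) \<in> M" if "f \<in> M" "h \<in> M" for f h
      using that by (simp add: M_def sum.distrib deep_add)
    show "finite {..<N i}" for i by simp
  next
    fix al :: "'i \<Rightarrow> nat \<Rightarrow> nat" and v :: "'i \<Rightarrow> nat"
    assume al: "\<And>i. i \<in> A \<Longrightarrow> (\<Sum>m<N i. al i m) = ?E"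
      and v: "\<And>i. i \<in> A \<Longrightarrow> (p - 1) * v i + digit_sum p ?E = (\<Sum>m<N i. digit_sum p (al i m))"
    \<comment> \<open>\<open>E t\<close> is the total exponent of the t-th variable in the chosen
      term, weight included; \<open>C\<close> below gathers the coefficients.\<close>
    define E where "E t = (if t = l then b else 0) + (\<Sum>i\<in>A. \<Sum>m<N i. al i m * e i m t)" for t
    define C where "C = (\<Prod>i\<in>A. \<Prod>m<N i. teich (c i m) ^ al i m)"
    have mon: "(\<Prod>i\<in>A. \<Prod>m<N i. Y i m x ^ al i m) * teich (x l) ^ b = C * (\<Prod>t<n. teich (x t) ^ E t)" for x
    proof -
      have "(\<Prod>i\<in>A. \<Prod>m<N i. Y i m x ^ al i m)
          = C * (\<Prod>i\<in>A. \<Prod>m<N i. \<Prod>t<n. teich (x t) ^ (al i m * e i m t))"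
        by (simp add: C_def Y_def power_mult_distrib prod.distrib prod_power_distrib mult.commute flip: power_mult)
      also have "(\<Prod>i\<in>A. \<Prod>m<N i. \<Prod>t<n. teich (x t) ^ (al i m * e i m t))
          = (\<Prod>t<n. \<Prod>i\<in>A. \<Prod>m<N i. teich (x t) ^ (al i m * e i m t))"
        by (subst (2) prod.swap, subst prod.swap) (rule refl)
      also have "\<dots> = (\<Prod>t<n. teich (x t) ^ (\<Sum>i\<in>A. \<Sum>m<N i. al i m * e i m t))"
        by (simp add: power_sum)
      finally have 1: "(\<Prod>i\<in>A. \<Prod>m<N i. Y i m x ^ al i m)
          = C * (\<Prod>t<n. teich (x t) ^ (\<Sum>i\<in>A. \<Sum>m<N i. al i m * e i m t))" .
      have "(\<Prod>t<n. teich (x t) ^ (if t = l then b else 0)) = (\<Prod>t<n. if t = l then teich (x l) ^ b else 1)"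
        by (intro prod.cong) auto
      also have "\<dots> = teich (x l) ^ b" using l by simp
      finally show ?thesis unfolding 1 E_def by (simp add: power_add prod.distrib mult_ac)
    qed
    let ?V = "\<Sum>i\<in>A. v i"
    have "(\<Sum>x\<in>affine_n_space n. of_nat p ^ ?V * (\<Prod>i\<in>A. \<Prod>m<N i. Y i m x ^ al i m) * teich (x l) ^ b)
        = of_nat p ^ ?V * C * (\<Sum>x\<in>affine_n_space n. \<Prod>t<n. teich (x t) ^ E t)"
      using mon by (simp add: mult.assoc flip: sum_distrib_left)
    also have "\<dots> = of_nat p ^ ?V * C * (\<Prod>t<n. \<Sum>a\<in>UNIV. teich a ^ E t)"
      by (simp only: sum_prod_affine_n_space[of "\<lambda>t a. teich a ^ E t"])
    also have "\<dots> \<in> deep k"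
    proof (cases "\<forall>t<n. E t > 0 \<and> p ^ k - 1 dvd E t")
      case True
      have "digit_sum p ?E = k * (p - 1)"
        unfolding Q_def digit_sum_mult_power[OF p_ge_2] by (rule digit_sum_power_minus_1[OF p_ge_2])
      then have "k \<le> ?V"
        using al v e True
        by (intro katz_valuation_bound[where A=A and I="\<lambda>i. {..<N i}" and al=al and v=v and D=D and n=n and b=b
              and l=l and E=E and e=e, OF p_ge_2 k_pos A _ _ _ _ n b l E_def]) (auto simp: Q_def)
      then have "of_nat p ^ ?V = of_nat p ^ k * (of_nat p ^ (?V - k) :: 'a unit_ring)"
        by (simp flip: power_add)
      then show ?thesis using of_nat_p_power_deep[of k] by (simp add: deep_mult_right mult.assoc)
    next
      case False
      then obtain t where t: "t < n" "\<not> (E t > 0 \<and> p ^ k - 1 dvd E t)" by blast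
      have "(\<Prod>t<n. \<Sum>a\<in>UNIV. teich (a::'a) ^ E t)
          = (\<Sum>a\<in>UNIV. teich a ^ E t) * (\<Prod>s\<in>{..<n} - {t}. \<Sum>a\<in>UNIV. teich a ^ E s)"
        using t(1) by (subst prod.remove[of _ t]) auto
      also have "\<dots> \<in> deep k" by (intro deep_mult_right sum_teich_power t(2))
      finally show ?thesis by (rule deep_mult_left)
    qed
    finally show "(\<lambda>x. of_nat p ^ ?V * (\<Prod>i\<in>A. \<Prod>m<N i. Y i m x ^ al i m) * teich (x l) ^ b) \<in> M"
      by (simp add: M_def)
  qed
  then have 1: "(\<Sum>x\<in>affine_n_space n. (\<Prod>i\<in>A. (\<Sum>m<N i. Y i m x) ^ ?E) * teich (x l) ^ b) \<in> deep k"
    by (simp add: M_def)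
  have "(\<Sum>x\<in>affine_n_space n. ((\<Prod>i\<in>A. teich (g i x) ^ Q) - (\<Prod>i\<in>A. (\<Sum>m<N i. Y i m x) ^ ?E)) * teich (x l) ^ b) \<in> deep k"
    by (intro deep_sum deep_mult_right step)
  from deep_add[OF this 1] show ?thesis
    by (simp add: Q_def left_diff_distrib sum_subtractf)
qed

text \<open>The indicator of the zero set is the product of the factors 1 - \<open>?T i x\<close>.
  Expanding them one by one leads to products over subsets of \<open>A\<close>, to which the
  previous lemma applies, since dropping equations only lowers the total degree.\<close>

lemma sum_zeros_teich_power_deep:
  fixes g :: "'i \<Rightarrow> (nat \<Rightarrow> 'a) \<Rightarrow> 'a"
  assumes A: "finite A" and g: "\<And>i. i \<in> A \<Longrightarrow> poly_fun (D i) n (g i)"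
    and n: "(\<Sum>i\<in>A. D i) < n" and l: "l < n" and b: "b < p ^ k - 1"
  shows "(\<Sum>x\<in>{x\<in>affine_n_space n. \<forall>i\<in>A. g i x = 0}. teich (x l) ^ b) \<in> deep k"
proof -
  let ?T = "\<lambda>i x. teich (g i x) ^ (p ^ k - 1)"
  have gen: "(\<Sum>x\<in>affine_n_space n. (\<Prod>i\<in>B. 1 - ?T i x) * (\<Prod>i\<in>C. ?T i x) * teich (x l) ^ b) \<in> deep k"
    if "finite B" "B \<inter> C = {}" "B \<union> C \<subseteq> A" for B C
    using that
  proof (induction B arbitrary: C rule: finite_induct)
    case empty
    have "finite C" using empty A finite_subset by auto
    moreover have "(\<Sum>i\<in>C. D i) \<le> (\<Sum>i\<in>A. D i)" using empty A by (intro sum_mono2) auto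
    ultimately have "(\<Sum>x\<in>affine_n_space n. (\<Prod>i\<in>C. ?T i x) * teich (x l) ^ b) \<in> deep k"
      using empty n by (intro sum_prod_teich_power_deep[where D = D] g l b) auto
    then show ?case by simp
  next
    case (insert j B)
    have fC: "finite C" using insert.prems A finite_subset by auto
    have "(\<Sum>x\<in>affine_n_space n. (\<Prod>i\<in>B. 1 - ?T i x) * (\<Prod>i\<in>C. ?T i x) * teich (x l) ^ b)
        - (\<Sum>x\<in>affine_n_space n. (\<Prod>i\<in>B. 1 - ?T i x) * (\<Prod>i\<in>insert j C. ?T i x) * teich (x l) ^ b) \<in> deep k"
      using insert.prems insert.hyps by (intro deep_diff insert.IH) auto
    moreover have "j \<notin> C" using insert.prems by auto
    ultimately show ?case
      using insert.hyps fC by (simp add: algebra_simps flip: sum_subtractf)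
  qed
  have "(\<Sum>x\<in>affine_n_space n. (\<Prod>i\<in>A. 1 - ?T i x) * teich (x l) ^ b) \<in> deep k"
    using gen[of A "{}"] A by simp
  moreover have "(\<Prod>i\<in>A. 1 - ?T i x) = (if \<forall>i\<in>A. g i x = 0 then 1 else 0)" for x
  proof (cases "\<forall>i\<in>A. g i x = 0")
    case True
    then have "(\<Prod>i\<in>A. 1 - ?T i x) = 1" by (intro prod.neutral) (simp only: teich_power_card_minus_1, simp)
    then show ?thesis using True by simp
  next
    case False
    then have "\<exists>i\<in>A. 1 - ?T i x = 0" by (simp only: teich_power_card_minus_1) auto
    then have "(\<Prod>i\<in>A. 1 - ?T i x) = 0" using A by (intro prod_zero)
    then show ?thesis using False by simp
  qed
  ultimately have "(\<Sum>x\<in>affine_n_space n. if \<forall>i\<in>A. g i x = 0 then teich (x l) ^ b else 0) \<in> deep k"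
    by (simp only: if_distrib[of "\<lambda>c. c * _"] mult_1 mult_zero_left)
  then show ?thesis by (simp add: sum.If_cases Int_def)
qed

text \<open>Fourier inversion over F* applied to the moments of x_l with exponents b < q - 1. It
  yields that w(0) + (q - 1) w(a) is divisible by q, where w counts zeros by the value of
  x_l.\<close>

theorem slice_card_cong:
  fixes g :: "'i \<Rightarrow> (nat \<Rightarrow> 'a) \<Rightarrow> 'a"
  assumes A: "finite A" and g: "\<And>i. i \<in> A \<Longrightarrow> poly_fun (D i) n (g i)"
    and n: "(\<Sum>i\<in>A. D i) < n" and l: "l < n"
  shows "[card {x\<in>affine_n_space n. x l = a \<and> (\<forall>i\<in>A. g i x = 0)}
        = card {x\<in>affine_n_space n. x l = 0 \<and> (\<forall>i\<in>A. g i x = 0)}] (mod p ^ k)"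
proof (cases "a = 0")
  case False
  define Q where "Q = p ^ k - 1"
  have Qpos: "Q > 0" using card_field_ge_2[where 'a='a] card_field by (simp add: Q_def)
  define Z where "Z = {x\<in>affine_n_space n. \<forall>i\<in>A. g i x = 0}"
  define w where "w a = card {x\<in>Z. x l = a}" for a
  have fZ: "finite Z" by (simp add: Z_def)
  have S: "(\<Sum>c\<in>UNIV. of_nat (w c) * teich c ^ b) \<in> deep k" if "b < Q" for b
  proof -
    have "(\<Sum>x\<in>Z. teich (x l) ^ b) \<in> deep k"
      unfolding Z_def using that by (intro sum_zeros_teich_power_deep[OF A g n l]) (auto simp: Q_def)
    also have "(\<Sum>x\<in>Z. teich (x l) ^ b) = (\<Sum>c\<in>UNIV. \<Sum>x\<in>{x\<in>Z. x l = c}. teich (x l) ^ b)"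
      using fZ by (subst sum.group) auto
    also have "\<dots> = (\<Sum>c\<in>UNIV. of_nat (w c) * teich c ^ b)"
      by (intro sum.cong) (auto simp: w_def)
    finally show ?thesis .
  qed
  \<comment> \<open>Orthogonality of the powers up to \<open>deep k\<close>; the value 1 at c = 0 is
    the term 0^0.\<close>
  have geo: "(\<Sum>b<Q. teich (c / a) ^ b) - of_nat (if c = 0 then 1 else if c = a then Q else 0) \<in> deep k" for c
  proof -
    consider "c = 0" | "c = a" | "c \<noteq> 0" "c \<noteq> a" by blast
    then show ?thesis
    proof cases
      case 1
      have "(\<Sum>b<Q. (0::'a unit_ring) ^ b) = 1"
        using Qpos by (simp add: power_0_left sum.delta)
      then show ?thesis using 1 by simp
    next
      case 2
      then show ?thesis using False by simp
    next
      case 3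
      have "(teich (c / a) - 1) * (\<Sum>b<Q. teich (c / a) ^ b) = teich (c / a) ^ Q - 1"
        by (simp add: power_diff_1_eq)
      also have "\<dots> = 0" using 3 False by (simp add: Q_def teich_power_card_minus_Suc_0)
      finally have "(\<Sum>b<Q. teich (c / a) ^ b) \<in> deep k"
        using 3 False by (intro deep_cancel[of "c / a" "\<Sum>b<Q. teich (c / a) ^ b"]) auto
      then show ?thesis using 3 by simp
    qed
  qed
  have "(\<Sum>b<Q. teich (1 / a) ^ b * (\<Sum>c\<in>UNIV. of_nat (w c) * teich c ^ b)) \<in> deep k"
    by (intro deep_sum deep_mult_left S) simp
  also have "(\<Sum>b<Q. teich (1 / a) ^ b * (\<Sum>c\<in>UNIV. of_nat (w c) * teich c ^ b))
      = (\<Sum>c\<in>UNIV. of_nat (w c) * (\<Sum>b<Q. teich (c / a) ^ b))"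
  proof -
    have tc: "teich (c / a) ^ b = teich (1 / a) ^ b * teich c ^ b" for c b
      by (simp flip: power_mult_distrib teich_mult)
    show ?thesis
      unfolding sum_distrib_left by (subst sum.swap, intro sum.cong refl, subst tc) (simp only: mult_ac)
  qed
  finally have 1: "(\<Sum>c\<in>UNIV. of_nat (w c) * (\<Sum>b<Q. teich (c / a) ^ b)) \<in> deep k" .
  have 2: "(\<Sum>c\<in>UNIV. of_nat (w c) * ((\<Sum>b<Q. teich (c / a) ^ b)
      - of_nat (if c = 0 then 1 else if c = a then Q else 0))) \<in> deep k"
    by (intro deep_sum deep_mult_left geo)
  have "of_nat (w 0 + Q * w a) = (\<Sum>c\<in>UNIV. of_nat (w c) * of_nat (if c = 0 then 1 else if c = a then Q else 0) :: 'a unit_ring)"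
  proof -
    have "(\<Sum>c\<in>UNIV. w c * (if c = 0 then 1 else if c = a then Q else 0))
        = (\<Sum>c\<in>UNIV. (if c = 0 then w 0 else 0) + (if c = a then Q * w a else 0))"
      using False by (intro sum.cong) auto
    also have "\<dots> = w 0 + Q * w a" by (simp add: sum.distrib)
    finally show ?thesis by (metis (no_types, lifting) of_nat_mult of_nat_sum sum.cong)
  qed
  also have "\<dots> \<in> deep k"
    using deep_diff[OF 1 2] by (simp add: right_diff_distrib sum_subtractf)
  finally have "of_int (int (w 0 + Q * w a)) \<in> deep k" by simp
  then have "int (p ^ k) dvd int (w 0 + Q * w a)" by (rule of_int_deep)
  then have "p ^ k dvd w 0 + Q * w a" by (simp only: int_dvd_int_iff)
  then have "[w 0 + Q * w a + w a = 0 + w a] (mod p ^ k)"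
    by (intro cong_add) (auto simp: cong_0_iff)
  moreover have "w 0 + Q * w a + w a = w 0 + p ^ k * w a"
  proof -
    have "p ^ k = Suc Q" using Qpos by (simp add: Q_def)
    then show ?thesis by simp
  qed
  ultimately have "[w a = w 0] (mod p ^ k)"
    by (simp add: cong_def)
  moreover have "{x\<in>affine_n_space n. x l = c \<and> (\<forall>i\<in>A. g i x = 0)} = {x\<in>Z. x l = c}" for c
    by (auto simp: Z_def)
  ultimately show ?thesis by (simp add: w_def)
qed simp

end

section \<open>Flats and counting\<close>

definition scl :: "'a::field \<Rightarrow> (nat \<Rightarrow> 'a) \<Rightarrow> nat \<Rightarrow> 'a" where
  "scl c x = (\<lambda>i. c * x i)"

lemma scl_apply [simp]: "scl c x i = c * x i"
  by (simp add: scl_def)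

lemma scl_simps [simp]: "scl 0 x = 0" "scl 1 x = x" "scl c 0 = 0" "scl a (scl b x) = scl (a * b) x"
  by (auto simp: fun_eq_iff)

lemma scl_distribs:
  "scl c (x + y) = scl c x + scl c y" "scl c (x - y) = scl c x - scl c y"
  "scl (a + b) x = scl a x + scl b x" "scl (a - b) x = scl a x - scl b x"
  by (auto simp: fun_eq_iff algebra_simps)

lemma scl_uminus: "scl (- 1) x = - x"
  by (auto simp: fun_eq_iff)

definition lin_sub :: "(nat \<Rightarrow> 'a::field) set \<Rightarrow> bool" where
  "lin_sub P \<longleftrightarrow> 0 \<in> P \<and> (\<forall>x\<in>P. \<forall>y\<in>P. x + y \<in> P) \<and> (\<forall>c. \<forall>x\<in>P. scl c x \<in> P)"

lemma lin_sub_iff_seq_subspace: "lin_sub P \<longleftrightarrow> seq_subspace P"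
  by (auto simp: lin_sub_def seq.subspace_def scl_def)

lemma lin_sub_0: "lin_sub P \<Longrightarrow> 0 \<in> P"
  and lin_sub_add: "lin_sub P \<Longrightarrow> x \<in> P \<Longrightarrow> y \<in> P \<Longrightarrow> x + y \<in> P"
  and lin_sub_scl: "lin_sub P \<Longrightarrow> x \<in> P \<Longrightarrow> scl c x \<in> P"
  by (auto simp: lin_sub_def)

lemma lin_sub_diff:
  assumes "lin_sub P" "x \<in> P" "y \<in> P"
  shows "x - y \<in> P"
  using lin_sub_add[OF assms(1,2) lin_sub_scl[OF assms(1,3), of "- 1"]] by (simp add: scl_uminus)

lemma lin_sub_scl_cancel:
  assumes "lin_sub P" "scl c x \<in> P" "c \<noteq> 0"
  shows "x \<in> P"
  using lin_sub_scl[OF assms(1,2), of "inverse c"] assms(3) by simp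

lemma lin_sub_add_cancel:
  assumes "lin_sub P" "x \<in> P"
  shows "x + y \<in> P \<longleftrightarrow> y \<in> P" "y + x \<in> P \<longleftrightarrow> y \<in> P"
  using lin_sub_diff[OF assms(1), of "x + y" x] lin_sub_add[OF assms(1), of x y] assms
  by (auto simp: add.commute)

lemma lin_sub_affine_n_space: "lin_sub (affine_n_space n)"
  by (auto simp: lin_sub_def affine_n_space_def)

section \<open>Adjoining one direction to a subspace\<close>

definition ext :: "(nat \<Rightarrow> 'a::field) set \<Rightarrow> (nat \<Rightarrow> 'a) \<Rightarrow> (nat \<Rightarrow> 'a) set" where
  "ext P u = (\<lambda>(x, c). x + scl c u) ` (P \<times> UNIV)"

lemma ext_iff: "y \<in> ext P u \<longleftrightarrow> (\<exists>x\<in>P. \<exists>c. y = x + scl c u)"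
  by (auto simp: ext_def)

lemma extI: "x \<in> P \<Longrightarrow> x + scl c u \<in> ext P u"
  by (auto simp: ext_iff)

lemma subset_ext: "P \<subseteq> ext P u"
  using extI[of _ P 0 u] by auto

lemma mem_ext: "lin_sub P \<Longrightarrow> u \<in> ext P u"
  using extI[of 0 P 1 u] lin_sub_0 by auto

lemma lin_sub_ext:
  assumes "lin_sub P"
  shows "lin_sub (ext P u)"
  unfolding lin_sub_def
proof (intro conjI ballI allI)
  show "0 \<in> ext P u" using subset_ext lin_sub_0[OF assms] by blast
next
  fix y z assume "y \<in> ext P u" "z \<in> ext P u"
  then obtain x a x' b where "x \<in> P" "x' \<in> P" "y = x + scl a u" "z = x' + scl b u"
    by (auto simp: ext_iff)
  then show "y + z \<in> ext P u"
    using extI[OF lin_sub_add[OF assms], of x x' "a + b" u] by (simp add: scl_distribs add_ac)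
next
  fix y c assume "y \<in> ext P u"
  then obtain x a where "x \<in> P" "y = x + scl a u" by (auto simp: ext_iff)
  then show "scl c y \<in> ext P u"
    using extI[OF lin_sub_scl[OF assms], of x c "c * a" u] by (simp add: scl_distribs)
qed

lemma ext_subset:
  assumes "lin_sub Q" "P \<subseteq> Q" "u \<in> Q"
  shows "ext P u \<subseteq> Q"
  using assms by (auto simp: ext_iff intro!: lin_sub_add lin_sub_scl)

lemma inj_on_ext:
  assumes P: "lin_sub P" and u: "u \<notin> P"
  shows "inj_on (\<lambda>(x, c). x + scl c u) (P \<times> UNIV)"
proof (rule inj_onI, clarify)
  fix x y a b assume xy: "x \<in> P" "y \<in> P" and eq: "x + scl a u = y + scl b u"
  then have "scl (a - b) u = y - x" by (simp add: scl_distribs algebra_simps)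
  then have "scl (a - b) u \<in> P" using lin_sub_diff[OF P] xy by simp
  then have "a = b" using lin_sub_scl_cancel[OF P, of "a - b" u] u by auto
  then show "x = y \<and> a = b" using eq by simp
qed

lemma card_ext:
  fixes P :: "(nat \<Rightarrow> 'a::{field,finite}) set"
  assumes "lin_sub P" "u \<notin> P"
  shows "card (ext P u) = card P * CARD('a)"
  unfolding ext_def using card_image[OF inj_on_ext[OF assms]] by (simp add: card_cartesian_product)

text \<open>Exchange property: any vector of the extension outside P spans it over P. Hence the
  extensions of P partition the vectors outside P.\<close>

lemma ext_eq:
  assumes P: "lin_sub P" and w: "w \<in> ext P u" "w \<notin> P"
  shows "ext P w = ext P u"
proof -
  obtain x c where x: "x \<in> P" "w = x + scl c u" using w(1) by (auto simp: ext_iff)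
  have c: "c \<noteq> 0" using w(2) x by auto
  have "u = scl (- inverse c) x + scl (inverse c) w"
    using c by (simp add: x(2) fun_eq_iff algebra_simps)
  then have "u \<in> ext P w" using extI[OF lin_sub_scl[OF P x(1)], of "- inverse c" "inverse c" w] by simp
  then show ?thesis
    using w(1) by (intro subset_antisym ext_subset lin_sub_ext P subset_ext)
qed

text \<open>Subspaces of dimension k, built by adjoining vectors one at a time; no basis has to be
  carried along, and every step is an \<open>ext\<close>, to which the counting lemmas
  apply.\<close>

inductive sub_dim :: "nat \<Rightarrow> nat \<Rightarrow> (nat \<Rightarrow> 'a::field) set \<Rightarrow> bool" for n where
  zero: "sub_dim n 0 {0}"
| ext: "sub_dim n k P \<Longrightarrow> u \<in> affine_n_space n \<Longrightarrow> u \<notin> P \<Longrightarrow> sub_dim n (Suc k) (ext P u)"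

lemma sub_dim_lin_sub: "sub_dim n k P \<Longrightarrow> lin_sub P"
  by (induction rule: sub_dim.induct) (auto simp: lin_sub_ext, auto simp: lin_sub_def)

lemma sub_dim_subset: "sub_dim n k P \<Longrightarrow> P \<subseteq> affine_n_space n"
proof (induction rule: sub_dim.induct)
  case zero
  show ?case by (simp add: affine_n_space_def)
next
  case (ext k P u)
  then show ?case by (intro ext_subset lin_sub_affine_n_space)
qed

lemma sub_dim_finite:
  fixes P :: "(nat \<Rightarrow> 'a::{field,finite}) set"
  shows "sub_dim n k P \<Longrightarrow> finite P"
  using sub_dim_subset finite_affine_n_space finite_subset by metis

lemma sub_dim_card:
  fixes P :: "(nat \<Rightarrow> 'a::{field,finite}) set"
  shows "sub_dim n k P \<Longrightarrow> card P = CARD('a) ^ k"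
  by (induction rule: sub_dim.induct) (auto simp: card_ext sub_dim_lin_sub)

lemma sub_dim_le:
  fixes P :: "(nat \<Rightarrow> 'a::{field,finite}) set"
  assumes "sub_dim n k P"
  shows "k \<le> n"
proof -
  have "CARD('a) ^ k \<le> CARD('a) ^ n"
    using card_mono[OF finite_affine_n_space sub_dim_subset[OF assms]]
    by (simp add: sub_dim_card[OF assms] card_affine_n_space)
  then show ?thesis using card_field_ge_2[where 'a='a] by (simp add: power_increasing_iff)
qed

text \<open>A flat v + P is handled as a base point and a direction space, so that parallel flats
  share P and residues can be compared over all v.\<close>

definition cnt :: "(nat \<Rightarrow> 'a) set \<Rightarrow> (nat \<Rightarrow> 'a::field) \<Rightarrow> (nat \<Rightarrow> 'a) set \<Rightarrow> nat" where
  "cnt Z v P = card {x\<in>P. v + x \<in> Z}"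

lemma cnt_shift:
  assumes "lin_sub P" "w \<in> P"
  shows "cnt Z (v + w) P = cnt Z v P"
  unfolding cnt_def
proof (rule bij_betw_same_card[of "\<lambda>x. w + x"], rule bij_betwI[where g = "\<lambda>x. x - w"])
  show "(\<lambda>x. w + x) \<in> {x \<in> P. v + w + x \<in> Z} \<rightarrow> {x \<in> P. v + x \<in> Z}"
    using assms by (auto simp: add.assoc intro: lin_sub_add)
  show "(\<lambda>x. x - w) \<in> {x \<in> P. v + x \<in> Z} \<rightarrow> {x \<in> P. v + w + x \<in> Z}"
    using assms by (auto intro: lin_sub_diff)
qed auto

lemma cnt_ext:
  fixes P :: "(nat \<Rightarrow> 'a::{field,finite}) set"
  assumes "lin_sub P" "finite P" "u \<notin> P"
  shows "cnt Z v (ext P u) = (\<Sum>c\<in>UNIV. cnt Z (v + scl c u) P)"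
proof -
  let ?h = "\<lambda>(x, c). x + scl c u"
  have "{y\<in>ext P u. v + y \<in> Z} = ?h ` (\<Union>c. {x\<in>P. v + scl c u + x \<in> Z} \<times> {c})"
    by (auto simp: ext_def image_iff add_ac)
  moreover have "inj_on ?h (\<Union>c. {x\<in>P. v + scl c u + x \<in> Z} \<times> {c})"
    by (rule inj_on_subset[OF inj_on_ext[OF assms(1,3)]]) auto
  ultimately have "cnt Z v (ext P u) = card (\<Union>c. {x\<in>P. v + scl c u + x \<in> Z} \<times> {c})"
    by (simp add: cnt_def card_image)
  also have "\<dots> = (\<Sum>c\<in>UNIV. card ({x\<in>P. v + scl c u + x \<in> Z} \<times> {c}))"
    using assms(2) by (intro card_UN_disjoint) auto
  finally show ?thesis by (simp add: cnt_def card_cartesian_product)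
qed

section \<open>Counting the points outside a flat\<close>

definition newpts :: "(nat \<Rightarrow> 'a) set \<Rightarrow> (nat \<Rightarrow> 'a::field) \<Rightarrow> (nat \<Rightarrow> 'a) set \<Rightarrow> (nat \<Rightarrow> 'a) \<Rightarrow> (nat \<Rightarrow> 'a) set" where
  "newpts Z v P u = {z\<in>Z. z - v \<in> ext P u \<and> z - v \<notin> P}"

lemma cnt_alt: "cnt Z v P = card {z\<in>Z. z - v \<in> P}"
  unfolding cnt_def
  by (rule bij_betw_same_card[of "\<lambda>x. v + x"], rule bij_betwI[where g = "\<lambda>x. x - v"]) auto

lemma cnt_ext_newpts:
  assumes "finite Z"
  shows "cnt Z v (ext P u) = cnt Z v P + card (newpts Z v P u)"
proof -
  have "{z\<in>Z. z - v \<in> ext P u} = {z\<in>Z. z - v \<in> P} \<union> newpts Z v P u"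
    using subset_ext[of P u] by (auto simp: newpts_def)
  then show ?thesis unfolding cnt_alt
    using assms by (subst card_Un_disjoint[symmetric]) (auto simp: newpts_def)
qed

lemma sum_cnt_translates:
  fixes P :: "(nat \<Rightarrow> 'a::{field,finite}) set"
  assumes "Z \<subseteq> affine_n_space n" "P \<subseteq> affine_n_space n" "finite P"
  shows "(\<Sum>v\<in>affine_n_space n. cnt Z v P) = card Z * card P"
proof -
  let ?V = "affine_n_space n :: (nat \<Rightarrow> 'a) set"
  have "(\<Sum>v\<in>?V. cnt Z v P) = card (SIGMA v:?V. {x\<in>P. v + x \<in> Z})"
    using assms by (subst card_SigmaI) (auto simp: cnt_def)
  also have "\<dots> = card (Z \<times> P)"
  proof (rule bij_betw_same_card[of "\<lambda>(v, x). (v + x, x)"], rule bij_betwI[where g = "\<lambda>(z, x). (z - x, x)"])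
    show "(\<lambda>(z, x). (z - x, x)) \<in> Z \<times> P \<rightarrow> (SIGMA v:?V. {x\<in>P. v + x \<in> Z})"
      using assms lin_sub_diff[OF lin_sub_affine_n_space, of _ n] by auto
  qed auto
  finally show ?thesis by (simp add: card_cartesian_product)
qed

text \<open>Double counting: a point z of Z outside v + P lies in v + \<open>ext P u\<close> exactly
  for u in \<open>ext P (z - v) - P\<close>, a set of q^(k+1) - q^k vectors.\<close>

lemma sum_newpts:
  fixes P :: "(nat \<Rightarrow> 'a::{field,finite}) set"
  assumes Z: "Z \<subseteq> affine_n_space n" and v: "v \<in> affine_n_space n" and P: "sub_dim n k P"
  shows "(\<Sum>u\<in>affine_n_space n - P. card (newpts Z v P u))
      = (card Z - cnt Z v P) * ((CARD('a) - 1) * CARD('a) ^ k)"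
proof -
  let ?V = "affine_n_space n :: (nat \<Rightarrow> 'a) set"
  have fZ: "finite Z" using Z finite_affine_n_space finite_subset by blast
  have lP: "lin_sub P" and fP: "finite P" and sP: "P \<subseteq> ?V"
    using P by (simp_all add: sub_dim_lin_sub sub_dim_finite sub_dim_subset)
  define Z' where "Z' = {z\<in>Z. z - v \<notin> P}"
  have "Z' = Z - {z\<in>Z. z - v \<in> P}" by (auto simp: Z'_def)
  then have cZ': "card Z' = card Z - cnt Z v P"
    using fZ by (simp add: cnt_alt card_Diff_subset)
  have fib: "card {u\<in>?V - P. z - v \<in> ext P u} = (CARD('a) - 1) * CARD('a) ^ k" if z: "z \<in> Z'" for z
  proof -
    let ?y = "z - v"
    have y: "?y \<in> ?V" "?y \<notin> P" using z Z v lin_sub_diff[OF lin_sub_affine_n_space, of z n v] by (auto simp: Z'_def)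
    have "{u\<in>?V - P. ?y \<in> ext P u} = ext P ?y - P"
    proof (intro subset_antisym subsetI)
      fix u assume u: "u \<in> {u\<in>?V - P. ?y \<in> ext P u}"
      then have "ext P ?y = ext P u" using y by (intro ext_eq[OF lP]) auto
      then show "u \<in> ext P ?y - P" using u mem_ext[OF lP, of u] by auto
    next
      fix u assume u: "u \<in> ext P ?y - P"
      then have "ext P u = ext P ?y" by (intro ext_eq[OF lP]) auto
      moreover have "ext P ?y \<subseteq> ?V" by (rule ext_subset[OF lin_sub_affine_n_space sP y(1)])
      ultimately show "u \<in> {u\<in>?V - P. ?y \<in> ext P u}" using u mem_ext[OF lP, of ?y] by auto
    qed
    moreover have "card (ext P ?y - P) = card (ext P ?y) - card P"
      by (rule card_Diff_subset[OF fP subset_ext])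
    ultimately show ?thesis
      using card_ext[OF lP y(2)] sub_dim_card[OF P] by (simp add: algebra_simps)
  qed
  have "(\<Sum>u\<in>?V - P. card (newpts Z v P u)) = card (SIGMA u:?V - P. newpts Z v P u)"
    using fZ by (subst card_SigmaI) (auto simp: newpts_def)
  also have "\<dots> = card (SIGMA z:Z'. {u\<in>?V - P. z - v \<in> ext P u})"
    by (rule bij_betw_same_card[of "\<lambda>(u, z). (z, u)"], rule bij_betwI[where g = "\<lambda>(z, u). (u, z)"])
      (auto simp: newpts_def Z'_def)
  also have "\<dots> = (\<Sum>z\<in>Z'. card {u\<in>?V - P. z - v \<in> ext P u})"
    using fZ by (subst card_SigmaI) (auto simp: Z'_def)
  also have "\<dots> = card Z' * ((CARD('a) - 1) * CARD('a) ^ k)"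
    using fib by simp
  finally show ?thesis by (simp add: cZ')
qed

lemma cnt_le: "finite Z \<Longrightarrow> cnt Z v P \<le> card Z"
  unfolding cnt_alt by (rule card_mono) auto

lemma card_ge_newpts:
  fixes P :: "(nat \<Rightarrow> 'a::{field,finite}) set"
  assumes Z: "Z \<subseteq> affine_n_space n" and v: "v \<in> affine_n_space n" and P: "sub_dim n k P"
    and a: "\<And>u. u \<in> affine_n_space n \<Longrightarrow> u \<notin> P \<Longrightarrow> a \<le> card (newpts Z v P u)"
  shows "a * (CARD('a) ^ (n - k) - 1) \<le> (card Z - cnt Z v P) * (CARD('a) - 1)"
proof -
  let ?q = "CARD('a)"
  have "(\<Sum>u\<in>affine_n_space n - P. a) \<le> (\<Sum>u\<in>affine_n_space n - P. card (newpts Z v P u))"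
    using a by (intro sum_mono) auto
  then have "card (affine_n_space n - P) * a \<le> (card Z - cnt Z v P) * ((?q - 1) * ?q ^ k)"
    unfolding sum_newpts[OF Z v P] by simp
  moreover have "card (affine_n_space n - P) = ?q ^ n - ?q ^ k"
    using sub_dim_finite[OF P] sub_dim_subset[OF P] sub_dim_card[OF P]
    by (simp add: card_Diff_subset card_affine_n_space)
  moreover have "?q ^ n - ?q ^ k = ?q ^ k * (?q ^ (n - k) - 1)"
    using sub_dim_le[OF P] by (simp add: diff_mult_distrib2 flip: power_add)
  ultimately have "?q ^ k * (a * (?q ^ (n - k) - 1)) \<le> ?q ^ k * ((card Z - cnt Z v P) * (?q - 1))"
    by (simp add: mult_ac)
  then show ?thesis using card_field_ge_2[where 'a='a] by simp
qed

text \<open>The number (q^(n-k) - 1)/(q - 1) of extensions is at least its leading term q^(n-k-1);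
  this loss is harmless for the affine bounds.\<close>

lemma card_ge_newpts':
  fixes P :: "(nat \<Rightarrow> 'a::{field,finite}) set"
  assumes Z: "Z \<subseteq> affine_n_space n" and v: "v \<in> affine_n_space n" and P: "sub_dim n k P" and k: "k < n"
    and a: "\<And>u. u \<in> affine_n_space n \<Longrightarrow> u \<notin> P \<Longrightarrow> a \<le> card (newpts Z v P u)"
  shows "cnt Z v P + a * CARD('a) ^ (n - k - 1) \<le> card Z"
proof -
  let ?q = "CARD('a)"
  have q: "?q \<ge> 2" by (rule card_field_ge_2)
  have "(?q - 1) * ?q ^ (n - k - 1) \<le> ?q ^ (n - k) - 1"
  proof -
    have "?q ^ (n - k) = ?q * ?q ^ (n - k - 1)" using k by (simp flip: power_Suc add: Suc_diff_Suc)
    moreover have "?q ^ (n - k - 1) \<ge> 1" using q by simp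
    ultimately show ?thesis unfolding diff_mult_distrib by linarith
  qed
  then have "a * ((?q - 1) * ?q ^ (n - k - 1)) \<le> a * (?q ^ (n - k) - 1)" by (rule mult_left_mono) simp
  also have "\<dots> \<le> (card Z - cnt Z v P) * (?q - 1)" by (rule card_ge_newpts[OF Z v P a])
  finally have "(?q - 1) * (a * ?q ^ (n - k - 1)) \<le> (?q - 1) * (card Z - cnt Z v P)" by (simp add: mult_ac)
  then have "a * ?q ^ (n - k - 1) \<le> card Z - cnt Z v P" using q by simp
  moreover have "cnt Z v P \<le> card Z" by (rule cnt_le) (use Z finite_affine_n_space finite_subset in blast)
  ultimately show ?thesis by simp
qed

section \<open>Residues of flat sections\<close>

text \<open>Everything that the counting arguments use about polynomials: the congruence for
  parallel flats of dimension d.\<close>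

locale warning_set =
  fixes q n d :: nat and Z :: "(nat \<Rightarrow> 'a::{field,finite}) set"
  assumes card_q [simp]: "CARD('a) = q" and Z_subset: "Z \<subseteq> affine_n_space n" and d_less: "d < n"
    and parallel: "\<And>P v v'. sub_dim n d P \<Longrightarrow> v \<in> affine_n_space n \<Longrightarrow> v' \<in> affine_n_space n \<Longrightarrow>
                     [cnt Z v P = cnt Z v' P] (mod q)"
begin

abbreviation V :: "(nat \<Rightarrow> 'a) set" where "V \<equiv> affine_n_space n"
lemma q_ge_2: "q \<ge> 2"
  using card_field_ge_2[where 'a='a] by simp

lemma finite_Z: "finite Z"
  using Z_subset finite_affine_n_space finite_subset by blast

lemma V_closed: "u \<in> V \<Longrightarrow> v \<in> V \<Longrightarrow> u + v \<in> V" "u \<in> V \<Longrightarrow> v \<in> V \<Longrightarrow> u - v \<in> V"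
  "u \<in> V \<Longrightarrow> scl c u \<in> V"
  by (auto simp: affine_n_space_def)

text \<open>A flat of dimension d + 1 splits into q parallel flats of dimension d with congruent
  counts; higher flats split into flats of the dimension below.\<close>

lemma cnt_dvd:
  assumes "sub_dim n k P" "k > d" "v \<in> V"
  shows "q dvd cnt Z v P"
  using assms
proof (induction arbitrary: v rule: sub_dim.induct)
  case (ext k P u)
  have P: "lin_sub P" "finite P" using ext.hyps by (simp_all add: sub_dim_lin_sub sub_dim_finite)
  have c: "cnt Z v (ext P u) = (\<Sum>c\<in>UNIV. cnt Z (v + scl c u) P)"
    using P ext.hyps by (intro cnt_ext)
  have vc: "v + scl a u \<in> V" for a using ext.prems(2) ext.hyps(2) by (intro V_closed)
  show ?case
  proof (cases "k = d")
    case True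
    have "[(\<Sum>c\<in>(UNIV::'a set). cnt Z (v + scl c u) P) = (\<Sum>c\<in>(UNIV::'a set). cnt Z v P)] (mod q)"
      using ext.hyps(1) ext.prems(2) True vc by (intro cong_sum parallel) simp_all
    then show ?thesis by (simp add: c cong_dvd_iff)
  next
    case False
    then show ?thesis unfolding c using ext.prems(1) by (intro dvd_sum ext.IH vc) simp
  qed
qed simp

lemma card_ge_translates:
  assumes P: "sub_dim n k P" and a: "\<And>v. v \<in> V \<Longrightarrow> a \<le> cnt Z v P"
  shows "a * q ^ (n - k) \<le> card Z"
proof -
  have "(\<Sum>v\<in>V. a) \<le> (\<Sum>v\<in>V. cnt Z v P)" using a by (rule sum_mono)
  also have "\<dots> = card Z * q ^ k"
    using sum_cnt_translates[OF Z_subset sub_dim_subset[OF P] sub_dim_finite[OF P]] sub_dim_card[OF P] by simp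
  also have "(\<Sum>v\<in>V. a) = q ^ n * a" by (simp add: card_affine_n_space)
  also have "q ^ n = q ^ (n - k) * q ^ k" using sub_dim_le[OF P] by (simp flip: power_add)
  finally have "q ^ k * (a * q ^ (n - k)) \<le> q ^ k * card Z" by (simp only: mult_ac)
  moreover have "q ^ k > 0" using q_ge_2 by simp
  ultimately show ?thesis by (metis mult_le_cancel1)
qed

lemma newpts_residue:
  "cnt Z v (ext P u) mod q = (cnt Z v P mod q + card (newpts Z v P u)) mod q"
  by (simp add: cnt_ext_newpts[OF finite_Z] mod_add_left_eq)

lemma ext_add_mem:
  assumes "lin_sub P" "x \<in> P"
  shows "ext P (x + u) = ext P u"
proof (cases "u \<in> P")
  case True
  then have "ext P w = P" if "w \<in> P" for w
    using that assms by (intro subset_antisym ext_subset subset_ext) auto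
  then show ?thesis using True assms lin_sub_add by metis
next
  case False
  then show ?thesis
    using assms extI[of x P 1 u] by (intro ext_eq) (auto simp: lin_sub_add_cancel)
qed

text \<open>In a \<open>(d + 1)\<close>-flat the residues of the \<open>q + 1\<close> flats of the pencil add up to 0 modulo \<open>q\<close>; if two of
  them vanish, the others are at most 1 each and too few for a nonzero multiple of \<open>q\<close>.\<close>

lemma zero_directions_lin_sub:
  assumes P: "sub_dim n k P" and d: "d = Suc k" and v: "v \<in> V"
    and res: "\<And>P v. sub_dim n d P \<Longrightarrow> v \<in> V \<Longrightarrow> cnt Z v P mod q \<le> 1"
  shows "lin_sub {u\<in>V. u \<in> P \<or> cnt Z v (ext P u) mod q = 0}" (is "lin_sub ?C")
proof -
  have lP: "lin_sub P" and fP: "finite P" and sP: "P \<subseteq> V"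
    using P by (simp_all add: sub_dim_lin_sub sub_dim_finite sub_dim_subset)
  have dE: "sub_dim n d (ext P u)" if "u \<in> V" "u \<notin> P" for u
    unfolding d using sub_dim.ext[OF P that] .
  have add: "u + u' \<in> ?C" if u: "u \<in> ?C" and u': "u' \<in> ?C" for u u'
  proof -
    have uV: "u \<in> V" "u' \<in> V" "u + u' \<in> V" using u u' by (auto intro: V_closed)
    consider "u \<in> P" | "u' \<in> P" | "u \<notin> P" "u' \<notin> P" "u' \<in> ext P u" | "u \<notin> P" "u' \<notin> P" "u' \<notin> ext P u" by blast
    then show ?thesis
    proof cases
      case 1
      then show ?thesis using u' uV ext_add_mem[OF lP 1, of u'] lin_sub_add_cancel(1)[OF lP 1, of u'] by auto
    next
      case 2
      then show ?thesis using u uV ext_add_mem[OF lP 2, of u] lin_sub_add_cancel(2)[OF lP 2, of u]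
        by (auto simp: add.commute)
    next
      case 3
      have "u + u' \<in> ext P u" using lin_sub_add[OF lin_sub_ext[OF lP] mem_ext[OF lP] 3(3)] .
      then have "u + u' \<in> P \<or> ext P (u + u') = ext P u" using ext_eq[OF lP] by blast
      then show ?thesis using uV u 3 by auto
    next
      case 4
      let ?c = "\<lambda>w. cnt Z w P"
      have lE: "lin_sub (ext P u)" and fE: "finite (ext P u)"
        using lin_sub_ext[OF lP] sub_dim_finite[OF dE[OF uV(1) 4(1)]] by auto
      have ni: "u' + scl c u \<notin> P" for c
      proof
        assume "u' + scl c u \<in> P"
        then have "u' + scl c u \<in> ext P u" using subset_ext by blast
        then show False using 4(3) lin_sub_add_cancel(2)[OF lE lin_sub_scl[OF lE mem_ext[OF lP]]] by blast
      qed
      have D: "cnt Z v (ext (ext P u) u') = (\<Sum>t\<in>UNIV. \<Sum>c\<in>UNIV. ?c (v + scl t u' + scl c u))"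
        unfolding cnt_ext[OF lE fE 4(3)] cnt_ext[OF lP fP 4(1)] ..
      have E: "cnt Z v (ext P u) = (\<Sum>c\<in>UNIV. ?c (v + scl c u))"
        by (rule cnt_ext[OF lP fP 4(1)])
      \<comment> \<open>All q + 1 flats of the pencil contain v + P, so its points are counted q
        times too often; the other points of the large flat are counted once.\<close>
      have S: "(\<Sum>c\<in>UNIV. cnt Z v (ext P (u' + scl c u))) + cnt Z v (ext P u)
          = q * ?c v + cnt Z v (ext (ext P u) u')"
      proof -
        let ?g = "\<lambda>t. \<Sum>c\<in>UNIV. ?c (v + scl t u' + scl (t * c) u)"
        let ?h = "\<lambda>t. \<Sum>c\<in>UNIV. ?c (v + scl t u' + scl c u)"
        have "cnt Z v (ext P (u' + scl c u)) = (\<Sum>t\<in>UNIV. ?c (v + scl t u' + scl (t * c) u))" for c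
          unfolding cnt_ext[OF lP fP ni] by (simp only: scl_distribs scl_simps add.assoc)
        then have "(\<Sum>c\<in>UNIV. cnt Z v (ext P (u' + scl c u))) = sum ?g UNIV"
          by (simp only:) (rule sum.swap)
        also have "\<dots> = ?g 0 + sum ?g (UNIV - {0})" by (rule sum.remove) simp_all
        also have "?g 0 = q * ?c v" by simp
        also have "sum ?g (UNIV - {0}) = sum ?h (UNIV - {0})"
        proof (rule sum.cong)
          fix t :: 'a assume "t \<in> UNIV - {0}"
          then have "t \<noteq> 0" by simp
          then show "?g t = ?h t" by (rule sum_mult_unit[of t "\<lambda>c. ?c (v + scl t u' + scl c u)"])
        qed simp
        finally have "(\<Sum>c\<in>UNIV. cnt Z v (ext P (u' + scl c u))) = q * ?c v + sum ?h (UNIV - {0})" .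
        moreover have "cnt Z v (ext (ext P u) u') = ?h 0 + sum ?h (UNIV - {0})"
          unfolding D by (rule sum.remove) simp_all
        moreover have "?h 0 = cnt Z v (ext P u)" unfolding E by simp
        ultimately show ?thesis by linarith
      qed
      have "q dvd cnt Z v (ext (ext P u) u')"
        by (rule cnt_dvd[OF sub_dim.ext[OF dE[OF uV(1) 4(1)] uV(2) 4(3)] _ v]) simp
      then have "q dvd (\<Sum>c\<in>UNIV. cnt Z v (ext P (u' + scl c u))) + cnt Z v (ext P u)"
        unfolding S by simp
      moreover have "q dvd cnt Z v (ext P u)" using u 4 by (auto simp: dvd_eq_mod_eq_0)
      ultimately have dS: "q dvd (\<Sum>c\<in>UNIV. cnt Z v (ext P (u' + scl c u)))" by (simp add: dvd_add_left_iff)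
      let ?r = "\<lambda>c. cnt Z v (ext P (u' + scl c u)) mod q"
      have "q dvd (\<Sum>c\<in>UNIV. ?r c)" using dS by (simp add: dvd_eq_mod_eq_0 mod_sum_eq)
      moreover have "(\<Sum>c\<in>UNIV. ?r c) < q"
      proof -
        have "?r c \<le> 1" for c using uV ni by (intro res dE v) (auto intro: V_closed)
        then have "(\<Sum>c\<in>UNIV - {0}. ?r c) \<le> (\<Sum>c\<in>UNIV - {0::'a}. 1)" by (rule sum_mono)
        moreover have "?r 0 = 0" using u' 4 by simp
        moreover have "(\<Sum>c\<in>UNIV. ?r c) = ?r 0 + (\<Sum>c\<in>UNIV - {0}. ?r c)" by (rule sum.remove) simp_all
        ultimately have "(\<Sum>c\<in>UNIV. ?r c) \<le> q - 1" by (simp add: card_Diff_singleton)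
        then show ?thesis using q_ge_2 by simp
      qed
      ultimately have "(\<Sum>c\<in>UNIV. ?r c) = 0" using dvd_imp_le[of q "\<Sum>c\<in>UNIV. ?r c"] by linarith
      then have "?r c = 0" for c by (subst (asm) sum_eq_0_iff) auto
      from this[of 1] have "cnt Z v (ext P (u' + u)) mod q = 0" by simp
      then show ?thesis using uV by (simp add: add.commute)
    qed
  qed
  have scl: "scl c u \<in> ?C" if u: "u \<in> ?C" for c u
  proof (cases "c = 0 \<or> u \<in> P")
    case True
    then show ?thesis using lin_sub_0[OF lP] lin_sub_scl[OF lP] sP by auto
  next
    case False
    then have "scl c u \<in> ext P u" "scl c u \<notin> P"
      using extI[OF lin_sub_0[OF lP], of c u] lin_sub_scl_cancel[OF lP, of c u] by auto
    moreover from this have "ext P (scl c u) = ext P u" by (rule ext_eq[OF lP])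
    ultimately show ?thesis using u False by (auto intro: V_closed)
  qed
  show ?thesis
    unfolding lin_sub_def
  proof (intro conjI ballI allI)
    have "0 \<in> V" by (rule lin_sub_0[OF lin_sub_affine_n_space])
    then show "0 \<in> ?C" using lin_sub_0[OF lP] by simp
  qed (rule add scl; assumption)+
qed

text \<open>A residue at least 2 forces new points into the extensions, because these already have
  residue 0 or 1; enough new points contradict the smallness of Z. The local facts are ordered by
  how far the dimension lies below d.\<close>

lemma residues_le_1:
  assumes q3: "q \<ge> 3" and small: "card Z < 2 * q ^ (n - d)"
  shows "sub_dim n k P \<Longrightarrow> v \<in> V \<Longrightarrow> cnt Z v P mod q \<le> 1"
proof -
  have top: "cnt Z v P mod q \<le> 1" if P: "sub_dim n d P" and v: "v \<in> V" for P v
  proof (rule ccontr)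
    assume neg: "\<not> ?thesis"
    have "2 \<le> cnt Z v' P" if "v' \<in> V" for v'
    proof -
      have "cnt Z v' P mod q = cnt Z v P mod q" using parallel[OF P that v] by (simp add: cong_def)
      then have "2 \<le> cnt Z v' P mod q" using neg by simp
      also have "\<dots> \<le> cnt Z v' P" by (rule mod_less_eq_dividend)
      finally show ?thesis .
    qed
    then show False using card_ge_translates[OF P, of 2] small by simp
  qed
  have above: "cnt Z v P mod q \<le> 1" if "sub_dim n k P" "k > d" "v \<in> V" for k P v
    using cnt_dvd[OF that] by simp
  have few: False
    if P: "sub_dim n k P" and k: "Suc k = d" and v: "v \<in> V"
      and two: "\<And>u. u \<in> V \<Longrightarrow> u \<notin> P \<Longrightarrow> 2 \<le> card (newpts Z v P u)" for k P v
  proof -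
    have "k < n" using k d_less by simp
    from card_ge_newpts'[OF Z_subset v P this, of 2] two
    have "cnt Z v P + 2 * q ^ (n - k - 1) \<le> card Z" unfolding card_q by blast
    moreover have "n - k - 1 = n - d" using k by simp
    ultimately show False using small by simp
  qed
  have next_to_top: "cnt Z v P mod q \<le> 1" if P: "sub_dim n k P" and k: "Suc k = d" and v: "v \<in> V" for k P v
  proof (rule ccontr)
    assume neg: "\<not> ?thesis"
    have lP: "lin_sub P" and fP: "finite P" and sP: "P \<subseteq> V"
      using P by (simp_all add: sub_dim_lin_sub sub_dim_finite sub_dim_subset)
    have dE: "sub_dim n d (ext P u)" if "u \<in> V" "u \<notin> P" for u
      using sub_dim.ext[OF P that] k by simp
    have lt: "cnt Z w P mod q < q" for w using q_ge_2 by simp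
    \<comment> \<open>A residue from 2 to q - 2 cannot reach 0 or 1 modulo q with fewer than two new
      points.\<close>
    have mid: "cnt Z w P mod q \<le> 1 \<or> cnt Z w P mod q = q - 1" if w: "w \<in> V" for w
    proof (rule ccontr)
      assume "\<not> ?thesis"
      with lt[of w] have a: "cnt Z w P mod q \<ge> 2" "cnt Z w P mod q + 2 \<le> q" by linarith+
      have "2 \<le> card (newpts Z w P u)" if u: "u \<in> V" "u \<notin> P" for u
      proof (rule ccontr)
        assume "\<not> ?thesis"
        then have lt2: "card (newpts Z w P u) < 2" by simp
        then have "cnt Z w (ext P u) mod q = cnt Z w P mod q + card (newpts Z w P u)"
          using a by (subst newpts_residue) (intro mod_less, linarith)
        then show False using top[OF dE[OF u] w] a by linarith
      qed
      then show False by (rule few[OF P k w])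
    qed
    have a: "cnt Z v P mod q = q - 1" using mid[OF v] neg by simp
    \<comment> \<open>From residue q - 1 a single new point can lead to residue 0. \<open>C\<close>
      collects the directions where residue 0 occurs, together with P.\<close>
    define C where "C = {u\<in>V. u \<in> P \<or> cnt Z v (ext P u) mod q = 0}"
    have lC: "lin_sub C" unfolding C_def by (rule zero_directions_lin_sub[OF P k[symmetric] v top])
    show False
    proof (cases "C = V")
      case True
      \<comment> \<open>Residues of flats of dimension d do not depend on the base point, so residue
        0 passes from v to every w.\<close>
      have zero: "cnt Z w (ext P u) mod q = 0" if "u \<in> V" "u \<notin> P" "w \<in> V" for u w
      proof -
        have "u \<in> C" using True that(1) by simp
        then show ?thesis
          using that parallel[OF dE[OF that(1,2)] that(3) v] by (simp add: C_def cong_def)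
      qed
      \<comment> \<open>From residue 1 to residue 0 it takes at least q - 1 >= 2 new points in every
        direction.\<close>
      have no1: "cnt Z w P mod q = 0 \<or> cnt Z w P mod q = q - 1" if w: "w \<in> V" for w
      proof (rule ccontr)
        assume neg: "\<not> ?thesis"
        then have b: "cnt Z w P mod q = 1" using mid[OF w] by linarith
        have "2 \<le> card (newpts Z w P u)" if u: "u \<in> V" "u \<notin> P" for u
        proof (rule ccontr)
          assume "\<not> ?thesis"
          then have "card (newpts Z w P u) < 2" by simp
          then have "cnt Z w (ext P u) mod q = 1 + card (newpts Z w P u)"
            unfolding newpts_residue b using q3 by (intro mod_less) linarith
          then show False using zero[OF u w] by simp
        qed
        then show False by (rule few[OF P k w])
      qed
      \<comment> \<open>Among q parallel translates with residues 0 or -1 and total residue 0, the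
        number of those with -1 is divisible by q; it is positive, so it is q.\<close>
      have all: "cnt Z w P mod q = q - 1" if w: "w \<in> V" for w
      proof (cases "w - v \<in> P")
        case True
        then show ?thesis using cnt_shift[OF lP True, of Z v] a by simp
      next
        case False
        have u: "w - v \<in> V" using v w by (intro V_closed)
        let ?r = "\<lambda>c. cnt Z (v + scl c (w - v)) P mod q"
        define Y where "Y = {c. ?r c = q - 1}"
        have r: "?r c = (if c \<in> Y then q - 1 else 0)" for c
          using no1[OF V_closed(1)[OF v V_closed(3)[OF u]], of c] by (auto simp: Y_def)
        have "(\<Sum>c\<in>UNIV. ?r c) = (\<Sum>c\<in>UNIV. if c \<in> Y then q - 1 else 0)" by (intro sum.cong r refl)
        also have "\<dots> = card Y * (q - 1)" by (simp add: sum.If_cases)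
        finally have sr: "(\<Sum>c\<in>UNIV. ?r c) = card Y * (q - 1)" .
        have "(\<Sum>c\<in>UNIV. cnt Z (v + scl c (w - v)) P) mod q = 0"
          using zero[OF u False v] unfolding cnt_ext[OF lP fP False] .
        then have "(\<Sum>c\<in>UNIV. ?r c) mod q = 0" by (simp only: mod_sum_eq)
        then have "q dvd card Y * (q - 1)" unfolding sr by (rule mod_0_imp_dvd)
        moreover have "coprime q (q - 1)" using q_ge_2 by (intro coprime_diff_one_right_nat) simp
        ultimately have "q dvd card Y" by (simp add: coprime_dvd_mult_left_iff)
        moreover have "0 \<in> Y" using a by (simp add: Y_def)
        then have "card Y > 0" by (auto simp: card_gt_0_iff)
        moreover have "card Y \<le> CARD('a)" by (intro card_mono) auto
        ultimately have "card Y = CARD('a)" using dvd_imp_le[of q "card Y"] by simp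
        then have "Y = UNIV" by (intro card_subset_eq) auto
        then have "?r 1 = q - 1" using r[of 1] by simp
        then show ?thesis by simp
      qed
      have "2 \<le> cnt Z w P" if "w \<in> V" for w
        using all[OF that] mod_less_eq_dividend[of "cnt Z w P" q] q3 by linarith
      then have "2 * q ^ (n - k) \<le> card Z" by (rule card_ge_translates[OF P])
      moreover have "q ^ (n - d) \<le> q ^ (n - k)" using k q_ge_2 by (intro power_increasing) auto
      ultimately show False using small by linarith
    next
      case False
      \<comment> \<open>A proper subspace \<open>C\<close> misses at least q^n - q^(n-1) vectors,
        and each of them leads from residue -1 to residue 1, which takes two new points. The average
        over these directions alone is large enough.\<close>
      have CV: "C \<subseteq> V" by (auto simp: C_def)
      with False obtain u1 where u1: "u1 \<in> V" "u1 \<notin> C" by blast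
      have fC: "finite C" using CV finite_affine_n_space finite_subset by blast
      have "card C * q \<le> q ^ n"
      proof -
        have "ext C u1 \<subseteq> V" using u1 CV by (intro ext_subset lin_sub_affine_n_space)
        from card_mono[OF finite_affine_n_space this] show ?thesis
          by (simp add: card_ext[OF lC u1(2)] card_affine_n_space)
      qed
      moreover have "q ^ n = q ^ (n - 1) * q" using d_less by (simp flip: power_Suc2)
      ultimately have cC: "card C \<le> q ^ (n - 1)" using q_ge_2 by simp
      have cD: "card (V - C) = q ^ n - card C"
        using card_Diff_subset[OF fC CV] by (simp add: card_affine_n_space)
      have two: "2 \<le> card (newpts Z v P u)" if u: "u \<in> V - C" for u
      proof (rule ccontr)
        assume "\<not> ?thesis"
        then have c: "card (newpts Z v P u) = 0 \<or> card (newpts Z v P u) = 1" by linarith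
        have "cnt Z v (ext P u) mod q = 1"
          using top[OF dE v, of u] u by (auto simp: C_def)
        then have "(q - 1 + card (newpts Z v P u)) mod q = 1"
          using newpts_residue[of v P u] a by simp
        then show False using c q3 by auto
      qed
      have "(q ^ n - card C) * 2 = (\<Sum>u\<in>V - C. 2)" using cD by simp
      also have "\<dots> \<le> (\<Sum>u\<in>V - C. card (newpts Z v P u))" using two by (rule sum_mono)
      also have "\<dots> \<le> (\<Sum>u\<in>V - P. card (newpts Z v P u))"
        by (intro sum_mono2) (auto simp: C_def)
      also have "\<dots> = (card Z - cnt Z v P) * ((q - 1) * q ^ k)" using sum_newpts[OF Z_subset v P] by simp
      also have "\<dots> \<le> card Z * ((q - 1) * q ^ k)" by simp
      finally have "(q ^ n - card C) * 2 \<le> card Z * ((q - 1) * q ^ k)" .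
      moreover have "(q - 1) * q ^ (n - 1) \<le> q ^ n - card C"
        using cC \<open>q ^ n = q ^ (n - 1) * q\<close> unfolding diff_mult_distrib by (simp add: mult.commute)
      ultimately have le: "((q - 1) * q ^ (n - 1)) * 2 \<le> card Z * ((q - 1) * q ^ k)"
        by (meson le_trans mult_le_mono1)
      have "n - 1 = (n - d) + k" using k d_less by linarith
      then have "q ^ (n - 1) = q ^ (n - d) * q ^ k" by (simp only: power_add)
      with le have "((q - 1) * q ^ k) * (2 * q ^ (n - d)) \<le> ((q - 1) * q ^ k) * card Z"
        by (simp only: mult_ac)
      moreover have "(q - 1) * q ^ k > 0" using q_ge_2 by simp
      ultimately have "2 * q ^ (n - d) \<le> card Z" by (metis mult_le_cancel1)
      then show False using small by simp
    qed
  qed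
  have below: "\<forall>P v. sub_dim n k P \<longrightarrow> v \<in> V \<longrightarrow> cnt Z v P mod q \<le> 1" if "k < d" for k
    using that
  proof (induction "d - k" arbitrary: k rule: less_induct)
    case less
    show ?case
    proof (cases "Suc k = d")
      case True
      then show ?thesis using next_to_top by blast
    next
      case False
      then have k: "Suc k < d" using less.prems by simp
      show ?thesis
      proof (intro allI impI, rule ccontr)
        fix P v assume P: "sub_dim n k P" and v: "v \<in> V" and neg: "\<not> cnt Z v P mod q \<le> 1"
        have "1 \<le> card (newpts Z v P u)" if u: "u \<in> V" "u \<notin> P" for u
        proof (rule ccontr)
          assume "\<not> ?thesis"
          then have "card (newpts Z v P u) = 0" by linarith
          then have "cnt Z v (ext P u) mod q = cnt Z v P mod q" unfolding newpts_residue by simp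
          moreover have "d - Suc k < d - k" using k by simp
          then have "cnt Z v (ext P u) mod q \<le> 1"
            using less.hyps[of "Suc k"] k sub_dim.ext[OF P u] v by blast
          ultimately show False using neg by simp
        qed
        moreover have "k < n" using k d_less by simp
        ultimately have "cnt Z v P + 1 * q ^ (n - k - 1) \<le> card Z"
          using card_ge_newpts'[OF Z_subset v P, of 1] unfolding card_q by blast
        then have "q ^ (n - k - 1) \<le> card Z" by simp
        \<comment> \<open>Since k + 1 < d, there is a spare factor q >= 2, and one new point per
          extension suffices.\<close>
        moreover have "q * q ^ (n - d) \<le> q ^ (n - k - 1)"
        proof -
          have "Suc (n - d) \<le> n - k - 1" using k d_less by linarith
          then have "q ^ Suc (n - d) \<le> q ^ (n - k - 1)" using q_ge_2 by (intro power_increasing) auto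
          then show ?thesis by simp
        qed
        moreover have "2 * q ^ (n - d) \<le> q * q ^ (n - d)" using q_ge_2 by simp
        ultimately show False using small by linarith
      qed
    qed
  qed
  show "sub_dim n k P \<Longrightarrow> v \<in> V \<Longrightarrow> cnt Z v P mod q \<le> 1"
    using top above below by (cases k d rule: linorder_cases) blast+
qed

end

section \<open>Zero sets that are not affine\<close>

lemma lin_sub_translate_imp_affine:
  fixes Z :: "(nat \<Rightarrow> 'a::field) set"
  assumes Z: "Z \<subseteq> affine_n_space n" and z: "z \<in> Z" and W: "lin_sub ((\<lambda>x. x - z) ` Z)"
  shows "is_affine_space n Z"
proof -
  have "(\<lambda>x. x - z) ` Z \<subseteq> affine_n_space n"
    using Z z by (auto intro!: lin_sub_diff[OF lin_sub_affine_n_space])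
  moreover have "Z = (\<lambda>w. z + w) ` (\<lambda>x. x - z) ` Z" by (auto simp: image_image)
  moreover have "z \<in> affine_n_space n" using Z z by blast
  ultimately show ?thesis
    using W unfolding is_affine_space_def lin_sub_iff_seq_subspace[symmetric] by blast
qed

lemma exists_neq_0_1:
  assumes "CARD('a::{field,finite}) \<ge> 3"
  shows "\<exists>c::'a. c \<noteq> 0 \<and> c \<noteq> 1"
proof (rule ccontr)
  assume "\<not> ?thesis"
  then have "(UNIV :: 'a set) \<subseteq> {0, 1}" by auto
  then have "CARD('a) \<le> card {0, 1 :: 'a}" by (intro card_mono) auto
  then show False using assms by simp
qed

lemma card_2_add_self:
  assumes "CARD('a::{field,finite}) = 2"
  shows "x + x = (0 :: nat \<Rightarrow> 'a)"
proof -
  have "(1::'a) + 1 = 0" using of_nat_card_field[where 'a='a] assms by simp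
  then show ?thesis by (auto simp: fun_eq_iff simp flip: mult_2)
qed

lemma card_2_cases:
  assumes "CARD('a::{field,finite}) = 2"
  shows "c = 0 \<or> c = (1::'a)"
proof -
  have "{0, 1} = (UNIV :: 'a set)" using assms by (intro card_subset_eq) auto
  then show ?thesis by auto
qed

text \<open>The point z + (w + w') lies on the line through z + w / l and z + w' / (1 - l), with
  weights l and 1 - l; this is where a scalar besides 0 and 1 enters.\<close>

lemma line_closed_imp_affine:
  fixes Z :: "(nat \<Rightarrow> 'a::field) set"
  assumes Z: "Z \<subseteq> affine_n_space n" and z: "z \<in> Z" and l: "l \<noteq> 0" "l \<noteq> (1::'a)"
    and lines: "\<And>x y c. x \<in> Z \<Longrightarrow> y \<in> Z \<Longrightarrow> x + scl c (y - x) \<in> Z"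
  shows "is_affine_space n Z"
proof -
  define W where "W = (\<lambda>x. x - z) ` Z"
  have W_iff: "w \<in> W \<longleftrightarrow> z + w \<in> Z" for w
    by (auto simp: W_def image_iff intro: bexI[of _ "z + w"])
  have scl: "scl c w \<in> W" if "w \<in> W" for c w
    using lines[OF z, of "z + w" c] that by (simp add: W_iff)
  have add: "w + w' \<in> W" if w: "w \<in> W" "w' \<in> W" for w w'
  proof -
    have "z + scl (1 / l) w \<in> Z" "z + scl (1 / (1 - l)) w' \<in> Z"
      using scl[OF w(1)] scl[OF w(2)] by (simp_all add: W_iff)
    from lines[OF this, of "1 - l"] have "z + scl (1 / l) w + scl (1 - l) (z + scl (1 / (1 - l)) w' - (z + scl (1 / l) w)) \<in> Z" .
    moreover have "z + scl (1 / l) w + scl (1 - l) (z + scl (1 / (1 - l)) w' - (z + scl (1 / l) w)) = z + (w + w')"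
      using l by (auto simp: fun_eq_iff field_simps)
    ultimately show ?thesis unfolding W_iff by metis
  qed
  have "lin_sub W"
    using add scl z W_iff[of 0] by (auto simp: lin_sub_def)
  then show ?thesis unfolding W_def by (rule lin_sub_translate_imp_affine[OF Z z])
qed

text \<open>Lines over the field of two elements have only two points, so closure under sums of
  three points, the basic affine combinations there, replaces closure under lines.\<close>

lemma triple_closed_imp_affine:
  fixes Z :: "(nat \<Rightarrow> 'a::{field,finite}) set"
  assumes Z: "Z \<subseteq> affine_n_space n" and z: "z \<in> Z" and q: "CARD('a) = 2"
    and triples: "\<And>x y w. x \<in> Z \<Longrightarrow> y \<in> Z \<Longrightarrow> w \<in> Z \<Longrightarrow> x + y + w \<in> Z"
  shows "is_affine_space n Z"
proof -
  note dbl = card_2_add_self[OF q]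
  note cases = card_2_cases[OF q]
  define W where "W = (\<lambda>x. x - z) ` Z"
  have W_iff: "w \<in> W \<longleftrightarrow> z + w \<in> Z" for w
    by (auto simp: W_def image_iff intro: bexI[of _ "z + w"])
  have add: "w + w' \<in> W" if w: "w \<in> W" "w' \<in> W" for w w'
  proof -
    have "(z + w) + (z + w') + z \<in> Z" using w z by (intro triples) (auto simp: W_iff)
    moreover have "(z + w) + (z + w') + z = (z + z) + (z + (w + w'))" by (simp only: add_ac)
    ultimately show ?thesis unfolding W_iff dbl add_0 by metis
  qed
  have "lin_sub W"
    unfolding lin_sub_def
  proof (intro conjI ballI allI)
    show "0 \<in> W" using z by (simp add: W_iff)
    then show "scl c x \<in> W" if "x \<in> W" for c x using cases[of c] that by auto
  qed (rule add)
  then show ?thesis unfolding W_def by (rule lin_sub_translate_imp_affine[OF Z z])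
qed

text \<open>The units act freely on nonzero vectors, so every orbit has q - 1 elements; the
  induction removes one orbit.\<close>

lemma dvd_card_scl_closed:
  fixes S :: "(nat \<Rightarrow> 'a::{field,finite}) set"
  assumes "finite S" "0 \<notin> S" and "\<And>c x. x \<in> S \<Longrightarrow> c \<noteq> 0 \<Longrightarrow> scl c x \<in> S"
  shows "CARD('a) - 1 dvd card S"
  using assms
proof (induction "card S" arbitrary: S rule: less_induct)
  case less
  show ?case
  proof (cases "S = {}")
    case False
    then obtain x where x: "x \<in> S" by blast
    then have "x \<noteq> 0" using less.prems by auto
    then obtain i where i: "x i \<noteq> 0" by (auto simp: fun_eq_iff)
    define Orb where "Orb = (\<lambda>c. scl c x) ` (UNIV - {0})"
    have inj: "inj_on (\<lambda>c. scl c x) (UNIV - {0})"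
    proof (rule inj_onI)
      fix a b assume "scl a x = scl b x"
      from fun_cong[OF this, of i] show "a = b" using i by simp
    qed
    have cOrb: "card Orb = CARD('a) - 1" unfolding Orb_def by (simp add: card_image[OF inj] card_Diff_singleton)
    have OrbS: "Orb \<subseteq> S" using less.prems(3)[OF x] by (auto simp: Orb_def)
    have "x \<in> Orb" by (auto simp: Orb_def image_iff intro!: bexI[of _ 1])
    then have lt: "card (S - Orb) < card S" using less.prems(1) x by (intro psubset_card_mono) auto
    have "CARD('a) - 1 dvd card (S - Orb)"
    proof (rule less.hyps[OF lt])
      fix c :: 'a and y assume y: "y \<in> S - Orb" and c: "c \<noteq> 0"
      have "scl c y \<notin> Orb"
      proof
        assume "scl c y \<in> Orb"
        then obtain b where b: "b \<noteq> 0" "scl c y = scl b x" by (auto simp: Orb_def)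
        from b(2) have "scl (inverse c) (scl c y) = scl (inverse c) (scl b x)" by simp
        then have "y = scl (inverse c * b) x" using c by simp
        then have "y \<in> Orb" using c b by (auto simp: Orb_def)
        then show False using y by simp
      qed
      then show "scl c y \<in> S - Orb" using less.prems(3) y c by auto
    qed (use less.prems in auto)
    moreover have "card S = card Orb + card (S - Orb)"
      using OrbS less.prems(1) by (metis card_Diff_subset card_mono finite_subset le_add_diff_inverse)
    ultimately show ?thesis unfolding cOrb by (metis dvd_add dvd_refl)
  qed simp
qed

context warning_set
begin

theorem card_ge_2_mult:
  assumes q3: "q \<ge> 3" and "Z \<noteq> {}" and na: "\<not> is_affine_space n Z"
  shows "2 * q ^ (n - d) \<le> card Z"
proof (rule ccontr)
  assume "\<not> ?thesis"
  then have small: "card Z < 2 * q ^ (n - d)" by simp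
  have "CARD('a) \<ge> 3" using q3 by simp
  then obtain l :: 'a where l: "l \<noteq> 0" "l \<noteq> 1" using exists_neq_0_1 by blast
  obtain z where z: "z \<in> Z" using assms(2) by blast
  have "x + scl c (y - x) \<in> Z" if x: "x \<in> Z" and y: "y \<in> Z" for x y c
  proof (cases "x = y")
    case False
    define P where "P = ext {0} (y - x)"
    have xV: "x \<in> V" "y - x \<in> V" using x y Z_subset by (auto intro: V_closed)
    have P: "sub_dim n 1 P"
      using sub_dim.ext[OF sub_dim.zero xV(2)] False by (simp add: P_def)
    have fP: "finite P" by (rule sub_dim_finite[OF P])
    have mem: "0 \<in> P" "scl c (y - x) \<in> P" for c
      using extI[of 0 "{0}" 0 "y - x"] extI[of 0 "{0}" c "y - x"] by (auto simp: P_def)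
    have "card {0, y - x} \<le> cnt Z x P"
      unfolding cnt_def using fP mem(1) mem(2)[of 1] x y by (intro card_mono) auto
    then have "2 \<le> cnt Z x P" using False by simp
    moreover have "cnt Z x P \<le> q"
      using card_mono[OF fP, of "{w \<in> P. x + w \<in> Z}"] sub_dim_card[OF P] by (simp add: cnt_def)
    moreover have "cnt Z x P mod q \<le> 1" by (rule residues_le_1[OF q3 small P xV(1)])
    \<comment> \<open>Between 2 and q, only q itself has residue 0 or 1.\<close>
    ultimately have "cnt Z x P = q" by (metis le_neq_implies_less mod_less not_less_eq_eq numeral_2_eq_2 One_nat_def le_trans)
    then have "{w \<in> P. x + w \<in> Z} = P"
      using fP sub_dim_card[OF P] by (intro card_subset_eq) (auto simp: cnt_def)
    then show ?thesis using mem(2) by blast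
  qed (use x in simp)
  then have "is_affine_space n Z"
    by (rule line_closed_imp_affine[OF Z_subset z l])
  then show False using na by simp
qed

text \<open>Residues modulo 2 do not restrict lines. The obstruction tracked instead is a flat with
  an odd number, at least three, of points of Z; it cannot occur above dimension d.\<close>

theorem card_ge_add_2:
  assumes q2: "q = 2" and "Z \<noteq> {}" and na: "\<not> is_affine_space n Z"
  shows "2 ^ (n - d) + 2 \<le> card Z"
proof (rule ccontr)
  assume "\<not> ?thesis"
  then have small: "card Z < 2 ^ (n - d) + 2" by simp
  obtain z where z: "z \<in> Z" using assms(2) by blast
  have "\<exists>x\<in>Z. \<exists>y\<in>Z. \<exists>w\<in>Z. x + y + w \<notin> Z"
    using triple_closed_imp_affine[OF Z_subset z] na q2 by auto
  then obtain x y w where xyw: "x \<in> Z" "y \<in> Z" "w \<in> Z" "x + y + w \<notin> Z" by blast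
  note dbl = card_2_add_self[OF card_q[unfolded q2]]
  have minus: "u - v = u + v" for u v :: "nat \<Rightarrow> 'a"
    using dbl[of v] by (metis add_diff_cancel_right' add.assoc add_0_right)
  note cases = card_2_cases[OF card_q[unfolded q2]]
  have ne: "x \<noteq> y" "x \<noteq> w" "y \<noteq> w"
    using xyw dbl by (auto simp: add.assoc)
  define bad where "bad k \<longleftrightarrow> (\<exists>P v. sub_dim n k P \<and> v \<in> V \<and> odd (cnt Z v P) \<and> cnt Z v P \<ge> 3)" for k
  have xV: "x \<in> V" "y \<in> V" "w \<in> V" using xyw Z_subset by auto
  have bad2: "bad 2"
  proof -
    let ?u = "x + y" and ?v = "x + w"
    have mem: "a \<in> ext {0} ?u \<longleftrightarrow> a = 0 \<or> a = ?u" for a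
    proof
      assume "a \<in> ext {0} ?u"
      then obtain c where "a = scl c ?u" by (auto simp: ext_iff)
      then show "a = 0 \<or> a = ?u" using cases[of c] by auto
    next
      show "a = 0 \<or> a = ?u \<Longrightarrow> a \<in> ext {0} ?u"
        using extI[of 0 "{0}" 0 ?u] extI[of 0 "{0}" 1 ?u] by auto
    qed
    have mem2: "a \<in> ext (ext {0} ?u) ?v \<longleftrightarrow> a = 0 \<or> a = ?u \<or> a = ?v \<or> a = ?u + ?v" for a
    proof
      assume "a \<in> ext (ext {0} ?u) ?v"
      then obtain b c where "b \<in> ext {0} ?u" "a = b + scl c ?v" by (auto simp: ext_iff)
      then show "a = 0 \<or> a = ?u \<or> a = ?v \<or> a = ?u + ?v" using cases[of c] mem[of b] by auto
    next
      show "a = 0 \<or> a = ?u \<or> a = ?v \<or> a = ?u + ?v \<Longrightarrow> a \<in> ext (ext {0} ?u) ?v"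
        using extI[of 0 "ext {0} ?u" 0 ?v] extI[of 0 "ext {0} ?u" 1 ?v]
          extI[of ?u "ext {0} ?u" 0 ?v] extI[of ?u "ext {0} ?u" 1 ?v] mem by auto
    qed
    have "?u \<noteq> 0" "?v \<noteq> 0" using ne(1,2) by (metis minus right_minus_eq)+
    then have u0: "?u \<noteq> 0" "?v \<noteq> 0" "?u \<noteq> ?v" using ne(3) by simp_all
    have "sub_dim n (Suc 0) (ext {0} ?u)"
      using sub_dim.ext[OF sub_dim.zero V_closed(1)[OF xV(1,2)]] u0(1) by simp
    from sub_dim.ext[OF this V_closed(1)[OF xV(1,3)]] have sd: "sub_dim n 2 (ext (ext {0} ?u) ?v)"
      unfolding numeral_2_eq_2 using u0 mem by metis
    have cancel: "b + (b + a) = a" for a b :: "nat \<Rightarrow> 'a"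
      by (simp add: dbl flip: add.assoc)
    have s: "x + ?u = y" "x + ?v = w" by (simp_all only: cancel)
    have "x + (?u + ?v) = x + (x + (x + y + w))" by (simp only: add_ac)
    then have s3: "x + (?u + ?v) = x + y + w" by (simp only: cancel)
    have "{a \<in> ext (ext {0} ?u) ?v. x + a \<in> Z} = {0, ?u, ?v}"
    proof (intro set_eqI iffI)
      fix a assume "a \<in> {a \<in> ext (ext {0} ?u) ?v. x + a \<in> Z}"
      then have "a = 0 \<or> a = ?u \<or> a = ?v \<or> a = ?u + ?v" "x + a \<in> Z" unfolding mem2 by blast+
      moreover from this(2) have "a \<noteq> ?u + ?v" using s3 xyw(4) by metis
      ultimately show "a \<in> {0, ?u, ?v}" by blast
    next
      fix a assume a: "a \<in> {0, ?u, ?v}"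
      then have "x + a = x \<or> x + a = y \<or> x + a = w" using s by auto
      then have "x + a \<in> Z" using xyw(1-3) by metis
      moreover have "a = 0 \<or> a = ?u \<or> a = ?v \<or> a = ?u + ?v" using a by blast
      ultimately show "a \<in> {a \<in> ext (ext {0} ?u) ?v. x + a \<in> Z}" unfolding mem2 by blast
    qed
    moreover have "card {0, ?u, ?v} = 3" using u0 by simp
    ultimately have "cnt Z x (ext (ext {0} ?u) ?v) = 3" unfolding cnt_def by simp
    then show ?thesis unfolding bad_def using sd xV by (intro exI[of _ "ext (ext {0} ?u) ?v"] exI[of _ x]) simp
  qed
  have bad_le: "k \<le> d" if "bad k" for k
    using that cnt_dvd q2 unfolding bad_def by (metis not_le)
  \<comment> \<open>In the maximal bad dimension, either k = d and all parallel flats have an odd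
    count, or every extension gains a point, since otherwise it would itself be bad.\<close>
  define k where "k = (GREATEST k. bad k)"
  have k: "bad k" unfolding k_def using bad2 bad_le by (rule GreatestI_nat)
  have max: "\<not> bad (Suc k)"
    using Greatest_le_nat[of bad "Suc k" d] bad_le unfolding k_def by fastforce
  obtain P v where P: "sub_dim n k P" and v: "v \<in> V" and c: "odd (cnt Z v P)" "cnt Z v P \<ge> 3"
    using k by (auto simp: bad_def)
  show False
  proof (cases "k = d")
    case True
    have one: "1 \<le> cnt Z w P" if "w \<in> V" for w
    proof -
      have "odd (cnt Z w P)"
        using parallel[of P w v] P True that v c(1) q2 by (simp add: cong_def odd_iff_mod_2_eq_one)
      then show ?thesis by (cases "cnt Z w P") auto
    qed
    let ?S = "(\<lambda>x. v + x) ` P"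
    have SV: "?S \<subseteq> V" using v sub_dim_subset[OF P] by (auto intro: V_closed)
    have cS: "card ?S = 2 ^ d" using sub_dim_card[OF P] q2 True by (subst card_image) auto
    \<comment> \<open>Each flat is counted once for each of its 2^d base points. All translates
      contribute at least 1, the one through v at least 3, whence the summand 2 in the
      bound.\<close>
    have "(\<Sum>w\<in>V. 1 + (if w \<in> ?S then 2 else 0)) \<le> (\<Sum>w\<in>V. cnt Z w P)"
    proof (rule sum_mono)
      fix w assume "w \<in> V"
      then show "1 + (if w \<in> ?S then 2 else 0) \<le> cnt Z w P"
        using one[of w] c cnt_shift[OF sub_dim_lin_sub[OF P], of _ Z v] by auto
    qed
    also have "\<dots> = card Z * 2 ^ d"
      using sum_cnt_translates[OF Z_subset sub_dim_subset[OF P] sub_dim_finite[OF P]] sub_dim_card[OF P] q2 True by simp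
    also have "(\<Sum>w\<in>V. 1 + (if w \<in> ?S then 2 else (0::nat))) = 2 ^ n + 2 * 2 ^ d"
    proof -
      have "V \<inter> {w. w \<in> ?S} = ?S" using SV by blast
      then show ?thesis unfolding sum.distrib using cS by (simp add: sum.If_cases card_affine_n_space q2)
    qed
    also have "(2::nat) ^ n = 2 ^ (n - d) * 2 ^ d" using d_less by (simp flip: power_add)
    finally have "(2 ^ (n - d) + 2) * 2 ^ d \<le> card Z * 2 ^ d" by (simp only: distrib_right)
    then have "2 ^ (n - d) + 2 \<le> card Z" unfolding mult_le_cancel2 by simp
    then show False using small by simp
  next
    case False
    then have kd: "k < d" using bad_le[OF k] by simp
    have "1 \<le> card (newpts Z v P u)" if u: "u \<in> V" "u \<notin> P" for u
    proof (rule ccontr)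
      assume "\<not> ?thesis"
      then have "cnt Z v (ext P u) = cnt Z v P" by (simp add: cnt_ext_newpts[OF finite_Z])
      then have "bad (Suc k)" unfolding bad_def using sub_dim.ext[OF P u] v c by (intro exI[of _ "ext P u"] exI[of _ v]) simp
      then show False using max by simp
    qed
    moreover have "k < n" using kd d_less by simp
    ultimately have "cnt Z v P + 1 * q ^ (n - k - 1) \<le> card Z"
      using card_ge_newpts'[OF Z_subset v P, of 1] unfolding card_q by blast
    moreover have "(2::nat) ^ (n - d) \<le> 2 ^ (n - k - 1)" using kd by (intro power_increasing) auto
    ultimately show False using small c(2) unfolding q2 mult_1 by linarith
  qed
qed

end

section \<open>Cones\<close>

context warning_set
begin

lemma dvd_card_newpts_cone:
  assumes cone: "\<forall>c. \<forall>x\<in>Z. scl c x \<in> Z" and P: "lin_sub P"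
  shows "q - 1 dvd card (newpts Z 0 P u)"
proof -
  have "CARD('a) - 1 dvd card (newpts Z 0 P u)"
  proof (rule dvd_card_scl_closed)
    show "finite (newpts Z 0 P u)" using finite_Z by (simp add: newpts_def)
    show "0 \<notin> newpts Z 0 P u" using lin_sub_0[OF P] by (simp add: newpts_def)
    show "scl c x \<in> newpts Z 0 P u" if "x \<in> newpts Z 0 P u" "c \<noteq> 0" for c x
      using that cone lin_sub_scl[OF lin_sub_ext[OF P]] lin_sub_scl_cancel[OF P, of c x]
      by (auto simp: newpts_def)
  qed
  then show ?thesis by simp
qed

text \<open>Since q - 1 is -1 modulo q, the premise says that m is 1 modulo q. Subtracting 1 is safe
  from truncation because m >= 1.\<close>

lemma cone_residue:
  assumes "q dvd 1 + (q - 1) * m" "m \<ge> 1"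
  shows "q dvd m - 1"
proof -
  have "1 + (q - 1) * m + (m - 1) = q * m"
    using assms(2) q_ge_2 by (simp add: diff_mult_distrib)
  then show ?thesis using assms(1) by (metis dvd_add_right_iff dvd_triv_left)
qed

text \<open>A count 1 + (q - 1) b stands for the origin and b projective points. The alternatives:
  the extension of the plane gets stuck below dimension d; all extensions to dimension d + 1 have at
  least 2 q + 1 projective points; one of them has exactly q + 1.\<close>

theorem cone_bound:
  assumes cone: "\<And>c x. x \<in> Z \<Longrightarrow> scl c x \<in> Z"
    and ne: "\<exists>x\<in>Z. \<exists>y\<in>Z. x + y \<notin> Z"
  shows "\<exists>b. 2 \<le> b \<and> b \<le> q \<and>
    (q ^ (n - d + 1) + (q - 1) * b \<le> card Z \<or>
     1 + (q - 1) * b + (2 * q + 1 - b) * (q ^ (n - d) - 1) \<le> card Z \<or>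
     2 * b \<le> q + 2 \<and> 1 + (q - 1) * b + (q + 1 - b) * (q ^ (n - d) - 1) \<le> card Z)"
proof -
  obtain x0 y0 where xy: "x0 \<in> Z" "y0 \<in> Z" "x0 + y0 \<notin> Z" using ne by blast
  have zero: "0 \<in> Z" using cone[OF xy(1), of 0] by simp
  have V0: "0 \<in> V" using zero Z_subset by blast
  have Q: "q - 1 > 0" using q_ge_2 by simp
  have cone': "\<forall>c. \<forall>x\<in>Z. scl c x \<in> Z" using cone by blast
  define pl where "pl u v = ext (ext {0} u) v" for u v :: "nat \<Rightarrow> 'a"
  define good where "good b \<longleftrightarrow> (\<exists>u v. u \<in> Z \<and> v \<in> Z \<and> u \<noteq> 0 \<and> v \<notin> ext {0} u \<and>
      cnt Z 0 (pl u v) = 1 + (q - 1) * b)" for b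
  have lin0: "lin_sub {0 :: nat \<Rightarrow> 'a}" by (auto simp: lin_sub_def)
  have line_iff: "w \<in> ext {0} u \<longleftrightarrow> (\<exists>c. w = scl c u)" for w u by (auto simp: ext_iff)
  have dimp: "sub_dim n 1 (ext {0} u)" "sub_dim n 2 (pl u v)"
    if "u \<in> Z" "v \<in> Z" "u \<noteq> 0" "v \<notin> ext {0} u" for u v
  proof -
    have uv: "u \<in> V" "v \<in> V" using that Z_subset by auto
    show 1: "sub_dim n 1 (ext {0} u)" using sub_dim.ext[OF sub_dim.zero uv(1)] that(3) by simp
    show "sub_dim n 2 (pl u v)"
      using sub_dim.ext[OF 1 uv(2) that(4)] by (simp add: pl_def numeral_2_eq_2)
  qed
  have goodI: "\<exists>b\<ge>2. good b \<and> cnt Z 0 (pl u v) = 1 + (q - 1) * b"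
    if uv: "u \<in> Z" "v \<in> Z" "u \<noteq> 0" "v \<notin> ext {0} u" for u v
  proof -
    have fE: "finite (ext {0} u)" "card (ext {0} u) = q"
      using sub_dim_finite[OF dimp(1)[OF uv]] sub_dim_card[OF dimp(1)[OF uv]] by simp_all
    have EZ: "ext {0} u \<subseteq> Z" using cone uv(1) by (auto simp: line_iff)
    have "{z\<in>Z. z - 0 \<in> ext {0} u} = ext {0} u" using EZ by auto
    then have cE: "cnt Z 0 (ext {0} u) = q" using fE by (simp add: cnt_alt)
    obtain m where m: "card (newpts Z 0 (ext {0} u) v) = (q - 1) * m"
      using dvd_card_newpts_cone[OF cone' lin_sub_ext[OF lin0]] by (metis dvdE)
    have "v \<in> newpts Z 0 (ext {0} u) v"
      using uv mem_ext[OF lin_sub_ext[OF lin0]] by (simp add: newpts_def)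
    then have "card (newpts Z 0 (ext {0} u) v) > 0"
      using finite_Z by (auto simp: card_gt_0_iff newpts_def)
    then have "m \<ge> 1" using m by (cases m) auto
    have "cnt Z 0 (pl u v) = q + (q - 1) * m"
      unfolding pl_def cnt_ext_newpts[OF finite_Z, of 0 "ext {0} u" v] m cE ..
    also have "\<dots> = 1 + (q - 1) * (m + 1)" using Q by simp
    finally show ?thesis using \<open>m \<ge> 1\<close> uv unfolding good_def by (intro exI[of _ "m + 1"]) auto
  qed
  \<comment> \<open>The plane of x0 and y0 contains x0 + y0, which is not in Z, so it has fewer than
    the q + 1 projective points of a full plane.\<close>
  have "\<exists>b. good b \<and> b \<le> q"
  proof -
    have u0: "x0 \<noteq> 0" using xy by auto
    have v0: "y0 \<notin> ext {0} x0"
    proof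
      assume "y0 \<in> ext {0} x0"
      then obtain c where "y0 = scl c x0" by (auto simp: line_iff)
      then have "x0 + y0 = scl (1 + c) x0" by (simp add: scl_distribs)
      then show False using cone[OF xy(1)] xy(3) by simp
    qed
    obtain b where b: "good b" "cnt Z 0 (pl x0 y0) = 1 + (q - 1) * b" using goodI[OF xy(1,2) u0 v0] by blast
    have P: "sub_dim n 2 (pl x0 y0)" by (rule dimp[OF xy(1,2) u0 v0])
    have "x0 + y0 \<in> pl x0 y0" unfolding pl_def
      by (intro lin_sub_add lin_sub_ext lin0 mem_ext subsetD[OF subset_ext] )
    then have "card {w \<in> pl x0 y0. 0 + w \<in> Z} < card (pl x0 y0)"
      using xy by (intro psubset_card_mono sub_dim_finite[OF P]) auto
    then have "1 + (q - 1) * b < q ^ 2" using b sub_dim_card[OF P] by (simp add: cnt_def)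
    also have "q ^ 2 = 1 + (q - 1) * (q + 1)"
      using q_ge_2 by (simp add: power2_eq_square algebra_simps diff_mult_distrib)
    finally have "(q - 1) * b < (q - 1) * (q + 1)" by linarith
    then have "b < q + 1" by (simp only: mult_less_cancel1)
    then show ?thesis using b(1) by (intro exI[of _ b]) simp
  qed
  then obtain b0 where b0: "good b0" "b0 \<le> q" by blast
  define b where "b = (LEAST b. good b)"
  have gb: "good b" unfolding b_def by (rule LeastI[of good, OF b0(1)])
  have min: "b \<le> b'" if "good b'" for b' unfolding b_def by (rule Least_le[of good, OF that])
  have bq: "b \<le> q" using min[OF b0(1)] b0(2) by simp
  obtain u v where uv: "u \<in> Z" "v \<in> Z" "u \<noteq> 0" "v \<notin> ext {0} u" "cnt Z 0 (pl u v) = 1 + (q - 1) * b"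
    using gb by (auto simp: good_def)
  have b2: "2 \<le> b"
    using goodI[OF uv(1-4)] uv(5) Q by auto
  have dP: "sub_dim n 2 (pl u v)" by (rule dimp[OF uv(1-4)])
  \<comment> \<open>If d < 2, planes would have dimension above d, which makes b congruent to 1
    modulo q; this is impossible for 2 <= b <= q.\<close>
  have d2: "2 \<le> d"
  proof (rule ccontr)
    assume "\<not> ?thesis"
    then have "q dvd 1 + (q - 1) * b" using cnt_dvd[OF dP _ V0] uv(5) by simp
    then have "q dvd b - 1" using b2 by (intro cone_residue) auto
    then show False using b2 bq by (auto dest: dvd_imp_le)
  qed
  show ?thesis
  proof (cases "q ^ (n - d + 1) + (q - 1) * b \<le> card Z")
    case True
    then show ?thesis using b2 bq by blast
  next
    case small: False
    have cnt_eq: "cnt Z 0 P = 1 + (q - 1) * b" if "pl u v \<subseteq> P" "Z \<inter> P \<subseteq> pl u v" for P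
    proof -
      have "{z\<in>Z. z - 0 \<in> P} = {z\<in>Z. z - 0 \<in> pl u v}" using that by auto
      then show ?thesis using uv(5) by (simp only: cnt_alt)
    qed
    have "\<exists>P. sub_dim n j P \<and> pl u v \<subseteq> P \<and> Z \<inter> P \<subseteq> pl u v" if "2 \<le> j" "j \<le> d" for j
      using that
    proof (induction j rule: dec_induct)
      case base
      then show ?case using dP by blast
    next
      case (step j)
      then obtain P where P: "sub_dim n j P" "pl u v \<subseteq> P" "Z \<inter> P \<subseteq> pl u v" by auto
      \<comment> \<open>Otherwise every extension gains a whole projective point, that is q - 1
        vectors, and counting gives the first alternative.\<close>
      have "\<exists>w\<in>V. w \<notin> P \<and> newpts Z 0 P w = {}"
      proof (rule ccontr)
        assume none: "\<not> ?thesis"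
        have "q - 1 \<le> card (newpts Z 0 P w)" if "w \<in> V" "w \<notin> P" for w
        proof -
          have "newpts Z 0 P w \<noteq> {}" using none that by blast
          moreover have "finite (newpts Z 0 P w)" using finite_Z by (simp add: newpts_def)
          ultimately have "card (newpts Z 0 P w) > 0" by (simp add: card_gt_0_iff)
          then show ?thesis
            using dvd_card_newpts_cone[OF cone' sub_dim_lin_sub[OF P(1)]] by (intro dvd_imp_le)
        qed
        then have "(q - 1) * (q ^ (n - j) - 1) \<le> (card Z - cnt Z 0 P) * (q - 1)"
          using card_ge_newpts[OF Z_subset V0 P(1), of "q - 1"] unfolding card_q by blast
        then have "(q - 1) * (q ^ (n - j) - 1) \<le> (q - 1) * (card Z - cnt Z 0 P)"
          by (simp only: mult.commute)
        then have "q ^ (n - j) - 1 \<le> card Z - cnt Z 0 P" using Q by (metis mult_le_cancel1)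
        moreover have "q ^ (n - d + 1) \<le> q ^ (n - j)"
          using step d_less q_ge_2 by (intro power_increasing) auto
        moreover have "q ^ (n - d + 1) \<ge> 1" using q_ge_2 by simp
        moreover have "cnt Z 0 P \<le> card Z" by (rule cnt_le[OF finite_Z])
        ultimately show False using cnt_eq[OF P(2,3)] small by linarith
      qed
      then obtain w where w: "w \<in> V" "w \<notin> P" "newpts Z 0 P w = {}" by blast
      have "Z \<inter> ext P w \<subseteq> pl u v" using w(3) P(3) by (auto simp: newpts_def)
      then show ?case
        using sub_dim.ext[OF P(1) w(1,2)] P(2) subset_ext[of P w] by blast
    qed
    from this[OF d2 le_refl] obtain W where W: "sub_dim n d W" "pl u v \<subseteq> W" "Z \<inter> W \<subseteq> pl u v" by blast
    have cW: "cnt Z 0 W = 1 + (q - 1) * b" by (rule cnt_eq[OF W(2,3)])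
    have lW: "lin_sub W" by (rule sub_dim_lin_sub[OF W(1)])
    have new: "\<exists>x. card (newpts Z 0 W w) = (q - 1) * x \<and> (b + x = q + 1 \<or> b + x \<ge> 2 * q + 1)"
      if w: "w \<in> V" "w \<notin> W" for w
    proof -
      obtain x where x: "card (newpts Z 0 W w) = (q - 1) * x"
        using dvd_card_newpts_cone[OF cone' lW] by (metis dvdE)
      have "q dvd cnt Z 0 (ext W w)" by (rule cnt_dvd[OF sub_dim.ext[OF W(1) w] _ V0]) simp
      also have "cnt Z 0 (ext W w) = 1 + (q - 1) * (b + x)"
        unfolding cnt_ext_newpts[OF finite_Z] cW x by (simp only: distrib_left add.assoc)
      finally have "q dvd (b + x) - 1" using b2 by (intro cone_residue) auto
      then obtain m where m: "b + x - 1 = q * m" by auto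
      then have "m \<noteq> 0" using b2 by (cases m) auto
      then have "m = 1 \<or> m \<ge> 2" by linarith
      then have "b + x - 1 = q \<or> b + x - 1 \<ge> q * 2" unfolding m by (auto intro: mult_left_mono)
      then show ?thesis using x b2 by (intro exI[of _ x]) linarith
    qed
    have final: "1 + (q - 1) * b + a * (q ^ (n - d) - 1) \<le> card Z"
      if a: "\<And>w. w \<in> V \<Longrightarrow> w \<notin> W \<Longrightarrow> (q - 1) * a \<le> card (newpts Z 0 W w)" for a
    proof -
      have "((q - 1) * a) * (q ^ (n - d) - 1) \<le> (card Z - cnt Z 0 W) * (q - 1)"
        using card_ge_newpts[OF Z_subset V0 W(1), of "(q - 1) * a"] a unfolding card_q by blast
      then have "(q - 1) * (a * (q ^ (n - d) - 1)) \<le> (q - 1) * (card Z - cnt Z 0 W)"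
        by (simp only: mult_ac)
      then have "a * (q ^ (n - d) - 1) \<le> card Z - cnt Z 0 W" using Q by (metis mult_le_cancel1)
      moreover have "cnt Z 0 W \<le> card Z" by (rule cnt_le[OF finite_Z])
      ultimately show ?thesis using cW by linarith
    qed
    show ?thesis
    proof (cases "\<exists>w\<in>V. w \<notin> W \<and> card (newpts Z 0 W w) = (q - 1) * (q + 1 - b)")
      case True
      then obtain w where w: "w \<in> V" "w \<notin> W" "card (newpts Z 0 W w) = (q - 1) * (q + 1 - b)" by blast
      have "q + 1 - b > 0" using bq by simp
      then have "card (newpts Z 0 W w) > 0" using w(3) Q by simp
      then obtain z where z: "z \<in> Z" "z \<in> ext W w" "z \<notin> W"
        by (auto simp: card_gt_0_iff newpts_def)
      have uW: "u \<in> W" using W(2) subset_ext[of "ext {0} u" v] mem_ext[OF lin0, of u] by (auto simp: pl_def)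
      have EW: "ext {0} u \<subseteq> W" using uW lin_sub_0[OF lW] by (intro ext_subset[OF lW]) auto
      then have zE: "z \<notin> ext {0} u" using z(3) by blast
      obtain b' where b': "good b'" "cnt Z 0 (pl u z) = 1 + (q - 1) * b'"
        using goodI[OF uv(1) z(1) uv(3) zE] by blast
      \<comment> \<open>As z is outside W, the plane of u and z meets W only in the line of u. It
        thus has at most 1 + (q + 1 - b) projective points, and minimality of b yields 2 b <= q +
        2.\<close>
      have sub: "{y\<in>Z. y - 0 \<in> pl u z} \<subseteq> ext {0} u \<union> newpts Z 0 W w"
      proof
        fix y assume "y \<in> {y\<in>Z. y - 0 \<in> pl u z}"
        then have y: "y \<in> Z" "y \<in> pl u z" by auto
        then obtain a c where a: "a \<in> ext {0} u" "y = a + scl c z" by (auto simp: pl_def ext_iff[of _ "ext {0} u"])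
        have lE: "lin_sub (ext W w)" by (rule lin_sub_ext[OF lW])
        have aW: "a \<in> W" "a \<in> ext W w" using a(1) EW subset_ext[of W w] by auto
        show "y \<in> ext {0} u \<union> newpts Z 0 W w"
        proof (cases "c = 0")
          case True
          then show ?thesis using a by simp
        next
          case False
          then have "y \<notin> W"
            unfolding a(2) lin_sub_add_cancel(1)[OF lW aW(1)] using z(3) lin_sub_scl_cancel[OF lW] by blast
          moreover have "y \<in> ext W w"
            unfolding a(2) by (intro lin_sub_add[OF lE aW(2)] lin_sub_scl[OF lE z(2)])
          ultimately show ?thesis using y(1) by (simp add: newpts_def)
        qed
      qed
      have fin: "finite (ext {0} u)" "card (ext {0} u) = q"
        using sub_dim_finite[OF dimp(1)[OF uv(1-4)]] sub_dim_card[OF dimp(1)[OF uv(1-4)]] by simp_all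
      have "cnt Z 0 (pl u z) \<le> card (ext {0} u \<union> newpts Z 0 W w)"
        unfolding cnt_alt using fin finite_Z by (intro card_mono sub) (auto simp: newpts_def)
      also have "\<dots> \<le> q + (q - 1) * (q + 1 - b)" using card_Un_le[of "ext {0} u" "newpts Z 0 W w"] fin w(3) by simp
      also have "\<dots> = 1 + (q - 1) * (1 + (q + 1 - b))" using Q by simp
      finally have "(q - 1) * b' \<le> (q - 1) * (1 + (q + 1 - b))" unfolding b'(2) by linarith
      then have "b' \<le> 1 + (q + 1 - b)" using Q by (simp only: mult_le_cancel1)
      then have "2 * b \<le> q + 2" using min[OF b'(1)] bq by linarith
      moreover have "1 + (q - 1) * b + (q + 1 - b) * (q ^ (n - d) - 1) \<le> card Z"
      proof (rule final)
        fix w assume "w \<in> V" "w \<notin> W"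
        then obtain x where x: "card (newpts Z 0 W w) = (q - 1) * x" "b + x = q + 1 \<or> b + x \<ge> 2 * q + 1"
          using new by blast
        then have "q + 1 - b \<le> x" by linarith
        then show "(q - 1) * (q + 1 - b) \<le> card (newpts Z 0 W w)" unfolding x(1) by (rule mult_le_mono2)
      qed
      ultimately show ?thesis using b2 bq by blast
    next
      case False
      have "1 + (q - 1) * b + (2 * q + 1 - b) * (q ^ (n - d) - 1) \<le> card Z"
      proof (rule final)
        fix w assume w: "w \<in> V" "w \<notin> W"
        then obtain x where x: "card (newpts Z 0 W w) = (q - 1) * x" "b + x = q + 1 \<or> b + x \<ge> 2 * q + 1"
          using new by blast
        moreover have "x \<noteq> q + 1 - b" using False w x(1) by blast
        ultimately have "2 * q + 1 - b \<le> x" by linarith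
        then show "(q - 1) * (2 * q + 1 - b) \<le> card (newpts Z 0 W w)" unfolding x(1) by (rule mult_le_mono2)
      qed
      then show ?thesis using b2 bq by blast
    qed
  qed
qed

end

section \<open>Zero sets of polynomial systems\<close>

text \<open>A generative description, with D an upper bound for the degree: substituting affine
  forms is an induction over these rules, and the explicit list of terms is produced only
  once.\<close>

inductive poly_fun_gen :: "nat \<Rightarrow> nat \<Rightarrow> ((nat \<Rightarrow> 'a) \<Rightarrow> 'a::comm_ring_1) \<Rightarrow> bool" for n where
  const: "poly_fun_gen n D (\<lambda>_. c)"
| var: "t < n \<Longrightarrow> poly_fun_gen n D g \<Longrightarrow> poly_fun_gen n (Suc D) (\<lambda>x. x t * g x)"
| add: "poly_fun_gen n D g \<Longrightarrow> poly_fun_gen n D h \<Longrightarrow> poly_fun_gen n D (\<lambda>x. g x + h x)"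

lemma poly_fun_gen_poly_fun: "poly_fun_gen n D g \<Longrightarrow> poly_fun D n g"
proof (induction rule: poly_fun_gen.induct)
  case (const D c)
  show ?case
    unfolding poly_fun_def
    by (rule exI[of _ 1], rule exI[of _ "\<lambda>_. c"], rule exI[of _ "\<lambda>_ _. 0"]) simp
next
  case (var t D g)
  then obtain N :: nat and c e where e: "\<And>m. m < N \<Longrightarrow> (\<Sum>s<n. e m s) \<le> D"
    and g: "\<And>x. g x = (\<Sum>m<N. c m * (\<Prod>s<n. x s ^ e m s))"
    unfolding poly_fun_def by blast
  let ?e = "\<lambda>m s. e m s + (if s = t then 1 else 0)"
  have "(\<Sum>s<n. ?e m s) = (\<Sum>s<n. e m s) + 1" for m
    using var.hyps(1) by (simp add: sum.distrib)
  moreover have "x t * g x = (\<Sum>m<N. c m * (\<Prod>s<n. x s ^ ?e m s))" for x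
  proof -
    have "(\<Prod>s<n. x s ^ (if s = t then 1 else 0)) = (\<Prod>s<n. if s = t then x t else 1)"
      by (intro prod.cong) auto
    then have "(\<Prod>s<n. x s ^ ?e m s) = x t * (\<Prod>s<n. x s ^ e m s)" for m
      using var.hyps(1) by (simp add: power_add prod.distrib)
    then show ?thesis by (simp add: g sum_distrib_left mult_ac)
  qed
  ultimately show ?case
    unfolding poly_fun_def using e by (intro exI[of _ N] exI[of _ c] exI[of _ ?e]) simp
next
  case (add D g h)
  then obtain N :: nat and c e and N' :: nat and c' e' where e: "\<And>m. m < N \<Longrightarrow> (\<Sum>s<n. e m s) \<le> D"
    and g: "\<And>x. g x = (\<Sum>m<N. c m * (\<Prod>s<n. x s ^ e m s))"
    and e': "\<And>m. m < N' \<Longrightarrow> (\<Sum>s<n. e' m s) \<le> D"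
    and h: "\<And>x. h x = (\<Sum>m<N'. c' m * (\<Prod>s<n. x s ^ e' m s))"
    unfolding poly_fun_def by blast
  let ?c = "\<lambda>m. if m < N then c m else c' (m - N)" and ?e = "\<lambda>m. if m < N then e m else e' (m - N)"
  have split: "(\<Sum>m<N + N'. F m) = (\<Sum>m<N. F m) + (\<Sum>m<N'. F (N + m))" for F :: "nat \<Rightarrow> 'a"
    by (induction N') (simp_all add: add_ac)
  have "g x + h x = (\<Sum>m<N + N'. ?c m * (\<Prod>s<n. x s ^ ?e m s))" for x
    unfolding split by (simp add: g h)
  moreover have "(\<Sum>s<n. ?e m s) \<le> D" if "m < N + N'" for m
    using e[of m] e'[of "m - N"] that by (cases "m < N") auto
  ultimately show ?case
    unfolding poly_fun_def by (intro exI[of _ "N + N'"] exI[of _ ?c] exI[of _ ?e]) simp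
qed

lemma poly_fun_gen_mono: "poly_fun_gen n D g \<Longrightarrow> D \<le> D' \<Longrightarrow> poly_fun_gen n D' g"
proof (induction arbitrary: D' rule: poly_fun_gen.induct)
  case (var t D g)
  then obtain D'' where "D' = Suc D''" "D \<le> D''" by (cases D') auto
  then show ?case using var by (auto intro: poly_fun_gen.var)
qed (auto intro: poly_fun_gen.intros)

lemma poly_fun_gen_cmult: "poly_fun_gen n D g \<Longrightarrow> poly_fun_gen n D (\<lambda>x. c * g x)"
proof (induction rule: poly_fun_gen.induct)
  case (var t D g)
  then have "poly_fun_gen n (Suc D) (\<lambda>x. x t * (c * g x))" by (intro poly_fun_gen.var)
  then show ?case by (simp add: mult.left_commute)
next
  case (add D g h)
  then have "poly_fun_gen n D (\<lambda>x. c * g x + c * h x)" by (intro poly_fun_gen.add)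
  then show ?case by (simp add: distrib_left)
qed (rule poly_fun_gen.const)

lemma poly_fun_gen_sum:
  "(\<And>i. i \<in> S \<Longrightarrow> poly_fun_gen n D (g i)) \<Longrightarrow> poly_fun_gen n D (\<lambda>x. \<Sum>i\<in>S. g i x)"
proof (induction S rule: infinite_finite_induct)
  case (insert i S)
  then have "poly_fun_gen n D (\<lambda>x. g i x + (\<Sum>i\<in>S. g i x))" by (intro poly_fun_gen.add) auto
  then show ?case using insert.hyps by simp
qed (simp_all add: poly_fun_gen.const)

lemma poly_fun_gen_linear:
  assumes g: "poly_fun_gen n D g"
  shows "poly_fun_gen n (Suc D) (\<lambda>x. (a + (\<Sum>j<n. x j * b j)) * g x)"
proof -
  have "poly_fun_gen n (Suc D) (\<lambda>x. a * g x + (\<Sum>j\<in>{..<n}. b j * (x j * g x)))"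
    using g by (intro poly_fun_gen.add poly_fun_gen_sum poly_fun_gen_cmult poly_fun_gen.var)
      (auto intro: poly_fun_gen_mono)
  moreover have "a * g x + (\<Sum>j\<in>{..<n}. b j * (x j * g x)) = (a + (\<Sum>j<n. x j * b j)) * g x" for x
    unfolding distrib_right sum_distrib_right
    by (intro arg_cong2[where f = "(+)"] sum.cong refl) (simp_all only: mult_ac)
  ultimately show ?thesis by simp
qed

lemma poly_fun_gen_linear_power:
  assumes g: "poly_fun_gen n D g"
  shows "poly_fun_gen n (e + D) (\<lambda>x. (a + (\<Sum>j<n. x j * b j)) ^ e * g x)"
proof (induction e)
  case (Suc e)
  from poly_fun_gen_linear[OF Suc, of a b] show ?case by (simp add: mult.assoc)
qed (use g in simp)

lemma poly_fun_gen_linear_monom: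
  "poly_fun_gen n (\<Sum>i\<in>S. e i) (\<lambda>x. \<Prod>i\<in>S. (a i + (\<Sum>j<n. x j * b j i)) ^ e i)"
proof (induction S rule: infinite_finite_induct)
  case (insert i S)
  from poly_fun_gen_linear_power[OF insert.IH, of "e i" "a i" "\<lambda>j. b j i"]
  show ?case using insert.hyps by simp
qed (simp_all add: poly_fun_gen.const)

lemma monom_degree_le_total_degree: "m \<in> Poly_Mapping.keys f \<Longrightarrow> monom_degree m \<le> total_degree f"
  unfolding total_degree_def by (intro Max_ge) auto

text \<open>An affine substitution does not raise the degree: each variable of a monomial becomes an
  affine form and costs one step of \<open>poly_fun_gen\<close>.\<close>

lemma poly_fun_eval_affine:
  "poly_fun (total_degree f) n (\<lambda>t. eval_mvpoly f (\<lambda>i. a i + (\<Sum>j<n. t j * b j i)))"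
  unfolding eval_mvpoly_def
  using monom_degree_le_total_degree[of _ f]
  by (intro poly_fun_gen_poly_fun poly_fun_gen_sum poly_fun_gen_cmult poly_fun_gen_mono[OF poly_fun_gen_linear_monom])
    (auto simp: monom_degree_def)

lemma sub_dim_parametrization:
  fixes P :: "(nat \<Rightarrow> 'a::{field,finite}) set"
  assumes "sub_dim n k P"
  shows "\<exists>us. bij_betw (\<lambda>t i. \<Sum>j<k. t j * us j i) (affine_n_space k) P"
proof -
  have "\<exists>us. (\<lambda>t i. \<Sum>j<k. t j * us j i) ` affine_n_space k = P"
    using assms
  proof (induction rule: sub_dim.induct)
    case zero
    show ?case by (auto simp: affine_n_space_0 zero_fun_def)
  next
    case (ext k P u)
    then obtain us where us: "(\<lambda>t i. \<Sum>j<k. t j * us j i) ` affine_n_space k = P" by blast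
    let ?us = "us(k := u)"
    have "(\<lambda>i. \<Sum>j<Suc k. (t(k := c)) j * ?us j i) = (\<lambda>i. \<Sum>j<k. t j * us j i) + scl c u" for t c
      by (auto simp: fun_eq_iff intro!: sum.cong)
    then have "(\<lambda>t i. \<Sum>j<Suc k. t j * ?us j i) ` affine_n_space (Suc k)
        = (\<lambda>(t, c). (\<lambda>i. \<Sum>j<k. t j * us j i) + scl c u) ` (affine_n_space k \<times> UNIV)"
      unfolding affine_n_space_Suc image_image by (intro image_cong refl) (simp only: case_prod_unfold)
    also have "\<dots> = (\<lambda>(x, c). x + scl c u) ` (((\<lambda>t i. \<Sum>j<k. t j * us j i) ` affine_n_space k) \<times> UNIV)"
      by force
    also have "\<dots> = ext P u" unfolding us ext_def ..
    finally show ?case by blast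
  qed
  then obtain us where us: "(\<lambda>t i. \<Sum>j<k. t j * us j i) ` affine_n_space k = P" by blast
  then have "inj_on (\<lambda>t i. \<Sum>j<k. t j * us j i) (affine_n_space k)"
    using sub_dim_card[OF assms] by (intro eq_card_imp_inj_on) (simp_all add: card_affine_n_space)
  then show ?thesis using us by (auto simp: bij_betw_def)
qed

context finite_field_card
begin

text \<open>Coordinates 0, ..., d - 1 parametrize P and an additional coordinate moves along v' - v,
  giving d + 1 variables for total degree at most d. The slices at 0 and 1 are the two flats. Only
  single slices need an injective parametrization, so v' - v may lie in P.\<close>

lemma common_zeros_parallel:
  fixes f :: "nat \<Rightarrow> 'a mvpoly"
  assumes P: "sub_dim n (system_degree r f) P" and v: "v \<in> affine_n_space n" and v': "v' \<in> affine_n_space n"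
  shows "[cnt (common_zeros n r f) v P = cnt (common_zeros n r f) v' P] (mod p ^ k)"
proof -
  let ?d = "system_degree r f" and ?Z = "common_zeros n r f"
  obtain us where us: "bij_betw (\<lambda>t i. \<Sum>j<?d. t j * us j i) (affine_n_space ?d) P"
    using sub_dim_parametrization[OF P] by blast
  define L where "L t = (\<lambda>i. \<Sum>j<?d. t j * us j i)" for t :: "nat \<Rightarrow> 'a"
  define us' where "us' = us(?d := v' - v)"
  define g where "g i t = eval_mvpoly (f i) (\<lambda>m. v m + (\<Sum>j<Suc ?d. t j * us' j m))" for i and t :: "nat \<Rightarrow> 'a"
  have pg: "poly_fun (total_degree (f i)) (Suc ?d) (g i)" for i
    unfolding g_def by (rule poly_fun_eval_affine)
  have gL: "g i (t(?d := c)) = eval_mvpoly (f i) (v + scl c (v' - v) + L t)" for i t c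
  proof -
    have "(\<lambda>m. v m + (\<Sum>j<Suc ?d. (t(?d := c)) j * us' j m)) = v + scl c (v' - v) + L t"
      by (auto simp: fun_eq_iff L_def us'_def intro!: sum.cong)
    then show ?thesis by (simp add: g_def)
  qed
  have LP: "L ` affine_n_space ?d = P" "inj_on L (affine_n_space ?d)"
    using us unfolding bij_betw_def L_def by auto
  have slice: "card {t \<in> affine_n_space (Suc ?d). t ?d = c \<and> (\<forall>i\<in>{..<r}. g i t = 0)}
      = cnt ?Z (v + scl c (v' - v)) P" for c
  proof -
    let ?T = "{t \<in> affine_n_space ?d. v + scl c (v' - v) + L t \<in> ?Z}"
    have in_V: "v + scl c (v' - v) + L t \<in> affine_n_space n" if "t \<in> affine_n_space ?d" for t
    proof -
      have "L t \<in> affine_n_space n" using that LP(1) sub_dim_subset[OF P] by blast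
      then show ?thesis using v v' by (auto simp: affine_n_space_def)
    qed
    have "{t \<in> affine_n_space (Suc ?d). t ?d = c \<and> (\<forall>i\<in>{..<r}. g i t = 0)} = (\<lambda>t. t(?d := c)) ` ?T"
      using in_V by (auto simp: affine_n_space_Suc gL common_zeros_def)
    moreover have "inj_on (\<lambda>t. t(?d := c)) ?T"
    proof (rule inj_onI)
      fix s t assume "s \<in> ?T" "t \<in> ?T" "s(?d := c) = t(?d := c)"
      then have "(\<lambda>(x, a). x(?d := a)) (s, c) = (\<lambda>(x, a). x(?d := a)) (t, c)" by simp
      from inj_onD[OF inj_on_affine_n_space_upd this] show "s = t"
        using \<open>s \<in> ?T\<close> \<open>t \<in> ?T\<close> by auto
    qed
    moreover have "{x \<in> P. v + scl c (v' - v) + x \<in> ?Z} = L ` ?T"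
      using LP(1) by auto
    moreover have "inj_on L ?T" by (rule inj_on_subset[OF LP(2)]) auto
    ultimately show ?thesis by (simp add: cnt_def card_image)
  qed
  have "[card {t \<in> affine_n_space (Suc ?d). t ?d = 1 \<and> (\<forall>i\<in>{..<r}. g i t = 0)}
      = card {t \<in> affine_n_space (Suc ?d). t ?d = 0 \<and> (\<forall>i\<in>{..<r}. g i t = 0)}] (mod p ^ k)"
    using pg by (intro slice_card_cong[where D = "\<lambda>i. total_degree (f i)"]) (auto simp: system_degree_def)
  then show ?thesis unfolding slice by (simp add: cong_sym)
qed

lemma warning_set_common_zeros:
  assumes "system_degree r (f :: nat \<Rightarrow> 'a mvpoly) < n"
  shows "warning_set (p ^ k) n (system_degree r f) (common_zeros n r f)"
proof
  show "CARD('a) = p ^ k" by (rule card_field)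
  show "common_zeros n r f \<subseteq> affine_n_space n" by (auto simp: common_zeros_def)
qed (use assms common_zeros_parallel in auto)

end

section \<open>Zero sets of homogeneous systems as cones\<close>

lemma eval_homogeneous:
  assumes "homogeneous_form e f"
  shows "eval_mvpoly f (scl c x) = c ^ e * eval_mvpoly f x"
proof -
  have "(\<Prod>i\<in>Poly_Mapping.keys m. scl c x i ^ Poly_Mapping.lookup m i)
      = c ^ e * (\<Prod>i\<in>Poly_Mapping.keys m. x i ^ Poly_Mapping.lookup m i)" if "m \<in> Poly_Mapping.keys f" for m
    using assms that
    by (auto simp: homogeneous_form_def monom_degree_def power_mult_distrib prod.distrib power_sum)
  then show ?thesis
    unfolding eval_mvpoly_def sum_distrib_left by (intro sum.cong) (auto simp: mult_ac)
qed

lemma common_zeros_cone: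
  assumes "homogeneous_system r f" "x \<in> common_zeros n r f"
  shows "scl c x \<in> common_zeros n r f"
  using assms eval_homogeneous[of _ "f _" c x]
  by (auto simp: common_zeros_def homogeneous_system_def affine_n_space_def)

lemma cone_not_affine:
  fixes Z :: "(nat \<Rightarrow> 'a::field) set"
  assumes "Z \<subseteq> affine_n_space n" "Z \<noteq> {}" "\<And>c x. x \<in> Z \<Longrightarrow> scl c x \<in> Z" "\<not> is_affine_space n Z"
  shows "\<exists>x\<in>Z. \<exists>y\<in>Z. x + y \<notin> Z"
proof (rule ccontr)
  assume "\<not> ?thesis"
  moreover have "0 \<in> Z" using assms(2) assms(3)[of _ 0] by auto
  ultimately have "lin_sub Z" using assms(3) by (auto simp: lin_sub_def)
  moreover have "(0 :: nat \<Rightarrow> 'a) \<in> affine_n_space n" by (rule lin_sub_0[OF lin_sub_affine_n_space])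
  ultimately have "is_affine_space n Z"
    unfolding is_affine_space_def lin_sub_iff_seq_subspace[symmetric] using assms(1)
    by (intro bexI[of _ 0] exI[of _ Z]) auto
  then show False using assms(4) by simp
qed

lemma affine_with_0_lin_sub:
  assumes "is_affine_space n S" "0 \<in> S"
  shows "lin_sub S"
proof -
  obtain v W where W: "lin_sub W" "S = (\<lambda>w. v + w) ` W"
    using assms(1) unfolding is_affine_space_def lin_sub_iff_seq_subspace[symmetric] by blast
  obtain w where w: "w \<in> W" "v + w = 0" using W(2) assms(2) by (metis imageE)
  then have "v = scl (- 1) w" by (simp add: scl_uminus eq_neg_iff_add_eq_0)
  then have v: "v \<in> W" using lin_sub_scl[OF W(1) w(1)] by simp
  have "S = W"
  proof (intro set_eqI iffI)
    fix x assume "x \<in> S"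
    then show "x \<in> W" using W v lin_sub_add by blast
  next
    fix x assume "x \<in> W"
    then have "x - v \<in> W" "x = v + (x - v)" using lin_sub_diff[OF W(1)] v by auto
    then show "x \<in> S" unfolding W(2) by (metis imageI)
  qed
  then show ?thesis using W(1) by simp
qed

text \<open>Here X stands for q^(n-d) and s for n - d. Each alternative is rewritten as the target
  plus products such as (q - b) (X - q) that are visibly nonnegative.\<close>

lemma homogeneous_bounds:
  fixes q s b N :: int
  assumes q: "q \<ge> 2" and X: "X \<ge> q" and b: "2 \<le> b" "b \<le> q"
    and N: "q * X + (q - 1) * b \<le> N \<or> 1 + (q - 1) * b + (2 * q + 1 - b) * (X - 1) \<le> N \<or>
      2 * b \<le> q + 2 \<and> 1 + (q - 1) * b + (q + 1 - b) * (X - 1) \<le> N"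
    and s: "s \<ge> 1" "s = 1 \<Longrightarrow> X = q"
  shows "q \<ge> 3 \<Longrightarrow> 2 * X + (q - 2) * q \<le> N" and "q * (q * X - 1) < N * ((q - 1) * (s + 2))"
proof -
  have prod: "(q - b) * (X - q) \<ge> 0" using X b by simp
  have A: "q * X \<le> N \<or> (2 * b \<le> q + 2 \<and> (q + 1 - b) * X + q * (b - 1) \<le> N)"
  proof -
    have "q * X \<le> N" if "1 + (q - 1) * b + (2 * q + 1 - b) * (X - 1) \<le> N"
    proof -
      have "1 + (q - 1) * b + (2 * q + 1 - b) * (X - 1) = q * X + X + q * (q - 2) + (q - b) * (X - q)"
        by (simp add: algebra_simps)
      moreover have "q * (q - 2) \<ge> 0" using q by simp
      ultimately show ?thesis using that prod X q by linarith
    qed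
    moreover have "q * X \<le> N" if "q * X + (q - 1) * b \<le> N"
    proof -
      have "(q - 1) * b \<ge> 0" using q b by simp
      then show ?thesis using that by linarith
    qed
    moreover have "1 + (q - 1) * b + (q + 1 - b) * (X - 1) = (q + 1 - b) * X + q * (b - 1)"
      by (simp add: algebra_simps)
    ultimately show ?thesis using N by fastforce
  qed
  show "2 * X + (q - 2) * q \<le> N" if q3: "q \<ge> 3"
  proof -
    consider "q * X + (q - 1) * b \<le> N" | "1 + (q - 1) * b + (2 * q + 1 - b) * (X - 1) \<le> N"
      | "2 * b \<le> q + 2" "1 + (q - 1) * b + (q + 1 - b) * (X - 1) \<le> N" using N by blast
    then show ?thesis
    proof cases
      case 1
      have "(q - 2) * q \<le> (q - 2) * X" using X q by (intro mult_left_mono) auto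
      moreover have "(q - 1) * b \<ge> 0" using q b by simp
      moreover have "(q - 2) * X = q * X - 2 * X" by (simp add: algebra_simps)
      ultimately show ?thesis using 1 by linarith
    next
      case 2
      have "1 + (q - 1) * b + (2 * q + 1 - b) * (X - 1) = 2 * X + (q - 2) * q + (q - 1) * X + (q - b) * (X - q)"
        by (simp add: algebra_simps)
      moreover have "(q - 1) * X \<ge> 0" using X q by simp
      ultimately show ?thesis using 2 prod by linarith
    next
      case 3
      \<comment> \<open>From 2 b <= q + 2 and q >= 3 it follows that b <= q - 1, so the last product
        is nonnegative; it vanishes for X = q.\<close>
      have "1 + (q - 1) * b + (q + 1 - b) * (X - 1) = 2 * X + (q - 2) * q + (q - 1 - b) * (X - q)"
        by (simp add: algebra_simps)
      moreover have "(q - 1 - b) * (X - q) \<ge> 0" using 3(1) q3 X by simp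
      ultimately show ?thesis using 3(2) by linarith
    qed
  qed
  have N0: "N \<ge> 0"
  proof -
    have "q * X \<ge> 0" "(q + 1 - b) * X \<ge> 0" "q * (b - 1) \<ge> 0" using q X b by simp_all
    then show ?thesis using A by linarith
  qed
  have "N * ((q - 1) * 3) \<le> N * ((q - 1) * (s + 2))"
    using N0 q s(1) by (intro mult_left_mono) auto
  moreover have "q * (q * X - 1) < N * ((q - 1) * 3)" if "q * X \<le> N \<or> q \<ge> 3"
  proof -
    \<comment> \<open>Doubling avoids fractions: the third alternative only gives N >= q X / 2,
      which suffices as 2 q <= 3 (q - 1). Of s + 2 only the value 3 is used here.\<close>
    have "2 * (q * (q * X)) \<le> 2 * (N * ((q - 1) * 3))"
    proof (cases "q * X \<le> N")
      case True
      have "q * (q * X) \<le> ((q - 1) * 3) * (q * X)" using q X by (intro mult_right_mono) auto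
      also have "\<dots> \<le> ((q - 1) * 3) * N" using True q by (intro mult_left_mono) auto
      finally show ?thesis by (simp add: mult.commute)
    next
      case False
      then have q3: "q \<ge> 3" and c: "2 * b \<le> q + 2" "(q + 1 - b) * X + q * (b - 1) \<le> N" using that A by auto
      have "q * X \<le> (2 * (q + 1 - b)) * X" using c(1) X q by (intro mult_right_mono) auto
      moreover have "q * (b - 1) \<ge> 0" using q b by simp
      moreover have "(2 * (q + 1 - b)) * X = 2 * ((q + 1 - b) * X)" by (rule mult.assoc)
      ultimately have 2: "q * X \<le> 2 * N" using c(2) by linarith
      have "(2 * q) * (q * X) \<le> ((q - 1) * 3) * (q * X)" using q3 X by (intro mult_right_mono) auto
      also have "\<dots> \<le> ((q - 1) * 3) * (2 * N)" using 2 q by (intro mult_left_mono) auto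
      finally show ?thesis by (simp add: mult_ac)
    qed
    moreover have "q * (q * X - 1) = q * (q * X) - q" by (simp add: algebra_simps)
    ultimately show ?thesis using q by linarith
  qed
  \<comment> \<open>Only q = b = 2 with N >= X + 2 remains. The factor 3 is too weak for large X,
    but it occurs only with X = 2; otherwise s + 2 >= 4.\<close>
  moreover have "q * (q * X - 1) < N * ((q - 1) * (s + 2))" if "\<not> (q * X \<le> N \<or> q \<ge> 3)"
  proof -
    have q2: "q = 2" using that q by linarith
    moreover from this have "b = 2" using b by linarith
    ultimately have "X + 2 \<le> N" using that A by simp
    show ?thesis
    proof (cases "s = 1")
      case True
      then show ?thesis using q2 s(2) \<open>X + 2 \<le> N\<close> by simp
    next
      case False
      then have "N * 4 \<le> N * (s + 2)" using N0 s(1) by (intro mult_left_mono) auto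
      then show ?thesis using q2 \<open>X + 2 \<le> N\<close> by simp
    qed
  qed
  ultimately show "q * (q * X - 1) < N * ((q - 1) * (s + 2))" by linarith
qed

section \<open>Systems attaining the bounds\<close>

lemma eval_mvpoly_superset:
  assumes "finite S" "Poly_Mapping.keys f \<subseteq> S"
  shows "eval_mvpoly f x = (\<Sum>m\<in>S. Poly_Mapping.lookup f m *
    (\<Prod>i\<in>Poly_Mapping.keys m. x i ^ Poly_Mapping.lookup m i))"
  unfolding eval_mvpoly_def
  by (rule sum.mono_neutral_left) (use assms in \<open>auto simp: in_keys_iff\<close>)

lemma eval_mvpoly_add: "eval_mvpoly (f + g) x = eval_mvpoly f x + eval_mvpoly g x"
proof -
  let ?S = "Poly_Mapping.keys f \<union> Poly_Mapping.keys g"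
  show ?thesis
    using keys_add[of f g]
    by (subst (1 2 3) eval_mvpoly_superset[of ?S]) (auto simp: lookup_add distrib_right sum.distrib)
qed

lemma eval_mvpoly_0 [simp]: "eval_mvpoly 0 x = 0"
  by (simp add: eval_mvpoly_def)

lemma eval_mvpoly_sum: "eval_mvpoly (\<Sum>i\<in>A. f i) x = (\<Sum>i\<in>A. eval_mvpoly (f i) x)"
  by (induction A rule: infinite_finite_induct) (simp_all add: eval_mvpoly_add)

lemma eval_mvpoly_single:
  "eval_mvpoly (Poly_Mapping.single m c) x = c * (\<Prod>i\<in>Poly_Mapping.keys m. x i ^ Poly_Mapping.lookup m i)"
  by (cases "c = 0") (simp_all add: eval_mvpoly_def)

definition bounded_poly :: "nat \<Rightarrow> nat \<Rightarrow> 'a::zero mvpoly \<Rightarrow> bool" where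
  "bounded_poly n D f \<longleftrightarrow> (\<forall>m\<in>Poly_Mapping.keys f. Poly_Mapping.keys m \<subseteq> {..<n} \<and> monom_degree m \<le> D)"

lemma bounded_poly_add: "bounded_poly n D f \<Longrightarrow> bounded_poly n D g \<Longrightarrow> bounded_poly n D (f + g)"
  for f g :: "'a::comm_monoid_add mvpoly"
  using keys_add[of f g] by (auto simp: bounded_poly_def)

lemma bounded_poly_0: "bounded_poly n D 0"
  by (simp add: bounded_poly_def)

lemma bounded_poly_sum: "(\<And>i. i \<in> A \<Longrightarrow> bounded_poly n D (f i)) \<Longrightarrow> bounded_poly n D (\<Sum>i\<in>A. f i)"
  for f :: "'i \<Rightarrow> 'a::comm_monoid_add mvpoly"
  by (induction A rule: infinite_finite_induct) (simp_all add: bounded_poly_0 bounded_poly_add)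

lemma bounded_poly_single_power:
  "i < n \<Longrightarrow> e \<le> D \<Longrightarrow> bounded_poly n D (Poly_Mapping.single (Poly_Mapping.single i e) c)"
  by (auto simp: bounded_poly_def monom_degree_def)

lemma bounded_poly_mvpolys: "bounded_poly n D f \<Longrightarrow> f \<in> mvpolys n"
  by (auto simp: bounded_poly_def mvpolys_def)

lemma bounded_poly_total_degree: "bounded_poly n D f \<Longrightarrow> total_degree f \<le> D"
  unfolding total_degree_def by (intro Max.boundedI) (auto simp: bounded_poly_def)

lemma eval_single_power:
  "eval_mvpoly (Poly_Mapping.single (Poly_Mapping.single i e) c) x = c * x i ^ e"
  by (cases "e = 0") (simp_all add: eval_mvpoly_single)

text \<open>The cone x0 x1 = x2^2 with n = 3 and d = 2. It has q^2 zeros, which is 2 q + (q - 2) q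
  in general and 2 + 2 for q = 2.\<close>

definition quadric :: "'a::comm_ring_1 mvpoly" where
  "quadric = Poly_Mapping.single (Poly_Mapping.single 0 1 + Poly_Mapping.single 1 1) 1
     + Poly_Mapping.single (Poly_Mapping.single 2 2) (- 1)"

lemma keys_quadric_monomial:
  "Poly_Mapping.keys (Poly_Mapping.single (0::nat) (1::nat) + Poly_Mapping.single 1 1) = {0, 1}"
  by (auto simp: in_keys_iff lookup_add lookup_single when_def split: if_splits)

lemma eval_quadric: "eval_mvpoly quadric x = x 0 * x 1 - x 2 ^ 2"
  unfolding quadric_def eval_mvpoly_add eval_single_power
  unfolding eval_mvpoly_single keys_quadric_monomial by (simp add: lookup_add lookup_single)

lemma quadric_monomials:
  "Poly_Mapping.keys (quadric :: 'a::comm_ring_1 mvpoly)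
     = {Poly_Mapping.single 0 1 + Poly_Mapping.single 1 1, Poly_Mapping.single 2 2}"
  "monom_degree (Poly_Mapping.single 0 1 + Poly_Mapping.single 1 1) = 2"
  "monom_degree (Poly_Mapping.single 2 2) = 2"
proof -
  let ?m = "Poly_Mapping.single (0::nat) (1::nat) + Poly_Mapping.single 1 1" and ?m' = "Poly_Mapping.single (2::nat) (2::nat)"
  have ne: "?m \<noteq> ?m'"
  proof
    assume "?m = ?m'"
    then have "Poly_Mapping.lookup ?m 0 = Poly_Mapping.lookup ?m' 0" by simp
    then show False by (simp add: lookup_add lookup_single)
  qed
  show "Poly_Mapping.keys (quadric :: 'a mvpoly) = {?m, ?m'}"
    using ne by (auto simp: quadric_def in_keys_iff lookup_add lookup_single when_def split: if_splits)
  show "monom_degree ?m = 2"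
    unfolding monom_degree_def keys_quadric_monomial by (simp add: lookup_add lookup_single)
  show "monom_degree ?m' = 2" by (simp add: monom_degree_def)
qed

lemma total_degree_quadric: "total_degree (quadric :: 'a::comm_ring_1 mvpoly) = 2"
  unfolding total_degree_def quadric_monomials(1) image_insert quadric_monomials(2,3) by simp

lemma homogeneous_quadric: "homogeneous_form 2 (quadric :: 'a::comm_ring_1 mvpoly)"
proof -
  have "(quadric :: 'a mvpoly) \<noteq> 0"
    using quadric_monomials(1)[where 'a='a] by (metis insert_not_empty keys_zero)
  moreover have "monom_degree m = 2" if "m \<in> Poly_Mapping.keys (quadric :: 'a mvpoly)" for m
    using that unfolding quadric_monomials(1) by (elim insertE emptyE) (simp_all only: quadric_monomials(2,3))
  ultimately show ?thesis unfolding homogeneous_form_def by blast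
qed

lemma quadric_mvpolys: "quadric \<in> mvpolys 3"
  unfolding mvpolys_def mem_Collect_eq quadric_monomials(1) using keys_quadric_monomial by auto

lemma system_degree_1: "system_degree 1 f = total_degree (f 0)"
  by (simp add: system_degree_def)

lemma common_zeros_1: "common_zeros n 1 f = {x \<in> affine_n_space n. eval_mvpoly (f 0) x = 0}"
  by (simp add: common_zeros_def)

definition vec3 :: "'a::zero \<Rightarrow> 'a \<Rightarrow> 'a \<Rightarrow> nat \<Rightarrow> 'a" where
  "vec3 a b c = (\<lambda>i. if i = 0 then a else if i = 1 then b else if i = 2 then c else 0)"

lemma vec3_in: "vec3 a b c \<in> affine_n_space 3"
  by (auto simp: vec3_def affine_n_space_def)

lemma vec3_apply [simp]: "vec3 a b c 0 = a" "vec3 a b c 1 = b" "vec3 a b c (Suc 0) = b" "vec3 a b c 2 = c"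
  by (auto simp: vec3_def)

lemma vec3_cases: "x \<in> affine_n_space 3 \<Longrightarrow> x = vec3 (x 0) (x 1) (x 2)"
  by (auto simp: vec3_def affine_n_space_def fun_eq_iff)

lemma common_zeros_quadric:
  "common_zeros 3 1 (\<lambda>_. quadric) = {x \<in> affine_n_space 3. x 0 * x 1 = x 2 ^ 2}"
  unfolding common_zeros_1 by (simp add: eval_quadric)

lemma num_zeros_quadric: "num_zeros 3 1 (\<lambda>_. quadric :: 'a::{field,finite} mvpoly) = CARD('a) ^ 2"
proof -
  \<comment> \<open>If x0 = 0, then x2 = 0 and x1 is free; otherwise x2 is free and determines
    x1.\<close>
  let ?h = "\<lambda>(a::'a, t). if a = 0 then vec3 0 t 0 else vec3 a (t ^ 2 / a) t"
  have "common_zeros 3 1 (\<lambda>_. quadric :: 'a mvpoly) = ?h ` UNIV"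
  proof (intro set_eqI iffI)
    fix x :: "nat \<Rightarrow> 'a" assume "x \<in> common_zeros 3 1 (\<lambda>_. quadric)"
    then have x: "x = vec3 (x 0) (x 1) (x 2)" "x 0 * x 1 = x 2 ^ 2"
      unfolding common_zeros_quadric by (auto dest: vec3_cases)
    show "x \<in> ?h ` UNIV"
    proof (cases "x 0 = 0")
      case True
      then have "x = ?h (0, x 1)" using x by simp
      then show ?thesis by (rule range_eqI)
    next
      case False
      then have "x 1 = x 2 ^ 2 / x 0" using x(2) by (simp add: field_simps)
      then have "x = ?h (x 0, x 2)" using x(1) False by simp
      then show ?thesis by (rule range_eqI)
    qed
  next
    fix x :: "nat \<Rightarrow> 'a" assume "x \<in> ?h ` UNIV"
    then show "x \<in> common_zeros 3 1 (\<lambda>_. quadric)"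
      unfolding common_zeros_quadric by (auto simp: vec3_in split: if_splits)
  qed
  moreover have "inj ?h"
  proof (rule injI)
    fix z z' assume zz: "?h z = ?h z'"
    obtain a s b t where z: "z = (a, s)" "z' = (b, t)" by (cases z, cases z')
    from zz have eq: "?h (a, s) = ?h (b, t)" unfolding z .
    from fun_cong[OF eq, of 0] have ab: "a = b" by (auto split: if_splits)
    moreover have "s = t"
      using fun_cong[OF eq, of 1] fun_cong[OF eq, of 2] ab by (auto split: if_splits)
    ultimately show "z = z'" unfolding z by simp
  qed
  ultimately show ?thesis
    by (simp add: num_zeros_def card_image power2_eq_square card_prod)
qed

lemma standing_hypotheses_quadric: "standing_hypotheses 3 1 (\<lambda>_. quadric :: 'a::field mvpoly)"
proof -
  let ?Z = "common_zeros 3 1 (\<lambda>_. quadric :: 'a mvpoly)"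
  have mem: "vec3 a b c \<in> ?Z \<longleftrightarrow> a * b = c ^ 2" for a b c
    unfolding common_zeros_quadric by (simp add: vec3_in)
  have zero: "(0 :: nat \<Rightarrow> 'a) = vec3 0 0 0" by (simp add: vec3_def fun_eq_iff)
  have "\<not> is_affine_space 3 ?Z"
  proof
    assume "is_affine_space 3 ?Z"
    then have "lin_sub ?Z" using mem[of 0 0 0] zero by (intro affine_with_0_lin_sub) auto
    then have "vec3 1 0 0 + vec3 0 1 0 \<in> ?Z" by (rule lin_sub_add; subst mem) simp_all
    also have "vec3 1 0 0 + vec3 0 1 0 = vec3 1 1 (0::'a)" by (simp add: vec3_def fun_eq_iff)
    finally show False using mem[of 1 1 0] by simp
  qed
  moreover have "?Z \<noteq> {}" using mem[of 0 0 0] by auto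
  ultimately show ?thesis
    unfolding standing_hypotheses_def system_degree_1 total_degree_quadric by (simp add: quadric_mvpolys)
qed

text \<open>On \<open>x\<close> this takes the value \<open>a + b\<close>, where \<open>a\<close> is the number of nonzero coordinates among the first
  \<open>q - 2\<close> and \<open>b\<close> is 0 or 1 according to whether the next coordinate is in \<open>{0, 1}\<close>. As \<open>a + b < q\<close>,
  for prime \<open>q\<close> it vanishes only if \<open>a = b = 0\<close>.\<close>

definition two_lines_poly :: "nat \<Rightarrow> 'a::comm_ring_1 mvpoly" where
  "two_lines_poly q =
     (\<Sum>i<q - 2. Poly_Mapping.single (Poly_Mapping.single i (q - 1)) 1)
     + Poly_Mapping.single (Poly_Mapping.single (q - 2) (q - 1)) 1
     + (\<Sum>j<q. Poly_Mapping.single (Poly_Mapping.single (q - 2) j) 1)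
     + Poly_Mapping.single (Poly_Mapping.single 0 0) (- 1)"

lemma bounded_two_lines_poly:
  assumes "q \<ge> 3"
  shows "bounded_poly q (q - 1) (two_lines_poly q :: 'a::comm_ring_1 mvpoly)"
  unfolding two_lines_poly_def
  by (intro bounded_poly_add bounded_poly_sum bounded_poly_single_power) (use assms in auto)

lemma eval_two_lines_poly:
  fixes x :: "nat \<Rightarrow> 'a::{field,finite}"
  assumes q: "CARD('a) = q" "q \<ge> 3"
  shows "eval_mvpoly (two_lines_poly q) x =
    of_nat (card {i\<in>{..<q - 2}. x i \<noteq> 0} + (if x (q - 2) = 0 \<or> x (q - 2) = 1 then 0 else 1))"
proof -
  have pw: "y ^ (q - 1) = (if y = 0 then 0 else 1)" for y :: 'a
    using power_card_minus_1[of y] q by (simp add: power_0_left)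
  let ?t = "x (q - 2)"
  have geo: "(\<Sum>j<q. ?t ^ j) = (if ?t = 1 then 0 else 1)"
  proof (cases "?t = 1")
    case True
    then show ?thesis using of_nat_card_field[where 'a='a] q by simp
  next
    case False
    have "(?t - 1) * (\<Sum>j<q. ?t ^ j) = ?t ^ q - 1" by (simp add: power_diff_1_eq)
    also have "?t ^ q = ?t" using power_card_eq[of ?t] q by simp
    finally show ?thesis using False by simp
  qed
  have "eval_mvpoly (two_lines_poly q) x = (\<Sum>i<q - 2. x i ^ (q - 1)) + ?t ^ (q - 1) + (\<Sum>j<q. ?t ^ j) - 1"
    unfolding two_lines_poly_def eval_mvpoly_add eval_mvpoly_sum eval_single_power by simp
  also have "(\<Sum>i<q - 2. x i ^ (q - 1)) = of_nat (card {i\<in>{..<q - 2}. x i \<noteq> 0})"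
    unfolding pw by (simp add: sum.If_cases Int_def conj_commute)
  \<comment> \<open>The last three terms give 0 + 1 - 1 at 0, 1 + 0 - 1 at 1 and 1 + 1 - 1
    elsewhere.\<close>
  finally show ?thesis unfolding geo pw by auto
qed

lemma num_zeros_two_lines:
  assumes q: "CARD('a::{field,finite}) = q" "q \<ge> 3" "prime q"
  shows "common_zeros q 1 (\<lambda>_. two_lines_poly q :: 'a mvpoly)
    = (\<lambda>(t, s) i. if i = q - 2 then t else if i = q - 1 then s else 0) ` ({0, 1} \<times> UNIV)" (is "?Z = ?h ` _")
    and "num_zeros q 1 (\<lambda>_. two_lines_poly q :: 'a mvpoly) = 2 * q"
proof -
  interpret finite_field_card q 1 "TYPE('a)"
    using q by unfold_locales simp_all
  have iff: "x \<in> ?Z \<longleftrightarrow> x \<in> affine_n_space q \<and> (\<forall>i<q - 2. x i = 0) \<and> (x (q - 2) = 0 \<or> x (q - 2) = 1)"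
    for x :: "nat \<Rightarrow> 'a"
  proof -
    let ?c = "card {i\<in>{..<q - 2}. x i \<noteq> 0} + (if x (q - 2) = 0 \<or> x (q - 2) = 1 then 0 else 1)"
    have "card {i\<in>{..<q - 2}. x i \<noteq> 0} \<le> card {..<q - 2}" by (intro card_mono) auto
    then have "?c \<le> (q - 2) + 1" by (intro add_mono) auto
    then have c_less: "?c < q" using q(2) by linarith
    have zero_iff: "(of_nat c = (0::'a)) \<longleftrightarrow> c = 0" if "c < q" for c
      using that nat_dvd_not_less[of c q] unfolding of_nat_eq_0_iff_char_dvd CHAR_eq_p by auto
    have c_zero: "?c = 0 \<longleftrightarrow> (\<forall>i<q - 2. x i = 0) \<and> (x (q - 2) = 0 \<or> x (q - 2) = 1)"
      by (auto simp: card_eq_0_iff)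
    show ?thesis
      unfolding common_zeros_1 mem_Collect_eq eval_two_lines_poly[OF q(1,2)] zero_iff[OF c_less] c_zero ..
  qed
  show Z: "?Z = ?h ` ({0, 1} \<times> UNIV)"
  proof (intro set_eqI iffI)
    fix x assume x: "x \<in> ?Z"
    have "x = ?h (x (q - 2), x (q - 1))"
    proof
      fix i
      have "i < q - 2 \<or> i = q - 2 \<or> i = q - 1 \<or> i \<ge> q" by linarith
      then show "x i = ?h (x (q - 2), x (q - 1)) i"
        using x unfolding iff by (auto simp: affine_n_space_def)
    qed
    moreover have "(x (q - 2), x (q - 1)) \<in> {0, 1} \<times> UNIV" using x unfolding iff by auto
    ultimately show "x \<in> ?h ` ({0, 1} \<times> UNIV)" by (rule image_eqI)
  next
    fix x assume "x \<in> ?h ` ({0, 1} \<times> UNIV)"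
    then show "x \<in> ?Z" unfolding iff using q(2) by (auto simp: affine_n_space_def)
  qed
  have "inj_on ?h ({0, 1} \<times> UNIV)"
  proof (rule inj_onI)
    fix z z' assume zz: "?h z = ?h z'"
    obtain t s t' s' where z: "z = (t, s)" "z' = (t', s')" by (cases z, cases z')
    from zz have eq: "?h (t, s) = ?h (t', s')" unfolding z .
    have "q - 1 \<noteq> q - 2" using q(2) by simp
    then show "z = z'"
      unfolding z using fun_cong[OF eq, of "q - 2"] fun_cong[OF eq, of "q - 1"] by simp
  qed
  then show "num_zeros q 1 (\<lambda>_. two_lines_poly q :: 'a mvpoly) = 2 * q"
    unfolding num_zeros_def Z by (simp add: card_image card_cartesian_product q(1))
qed

lemma standing_hypotheses_two_lines:
  assumes q: "CARD('a::{field,finite}) = q" "q \<ge> 3" "prime q"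
  shows "standing_hypotheses q 1 (\<lambda>_. two_lines_poly q :: 'a mvpoly)"
proof -
  let ?Z = "common_zeros q 1 (\<lambda>_. two_lines_poly q :: 'a mvpoly)"
  let ?h = "\<lambda>(t::'a, s) i. if i = q - 2 then t else if i = q - 1 then s else 0"
  have mem: "?h (t, 0) \<in> ?Z \<longleftrightarrow> t = 0 \<or> t = 1" for t
  proof
    assume "?h (t, 0) \<in> ?Z"
    then obtain t' s' where t': "t' = 0 \<or> t' = 1" and eq: "?h (t, 0) = ?h (t', s')"
      unfolding num_zeros_two_lines(1)[OF q] by auto
    from fun_cong[OF eq, of "q - 2"] t' show "t = 0 \<or> t = 1" by simp
  next
    assume "t = 0 \<or> t = 1"
    then show "?h (t, 0) \<in> ?Z" unfolding num_zeros_two_lines(1)[OF q] by (intro imageI) auto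
  qed
  have zero: "?h (0, 0) = 0" by (auto simp: fun_eq_iff)
  obtain c :: 'a where c: "c \<noteq> 0" "c \<noteq> 1" using exists_neq_0_1[where 'a='a] q by auto
  have "\<not> is_affine_space q ?Z"
  proof
    assume "is_affine_space q ?Z"
    then have "lin_sub ?Z" using mem[of 0] zero by (intro affine_with_0_lin_sub) auto
    then have "scl c (?h (1, 0)) \<in> ?Z" by (rule lin_sub_scl) (rule mem[THEN iffD2], simp)
    also have "scl c (?h (1, 0)) = ?h (c, 0)" by (auto simp: fun_eq_iff)
    finally show False using mem[of c] c by blast
  qed
  moreover have "?Z \<noteq> {}" using mem[of 0] by blast
  moreover have "total_degree (two_lines_poly q :: 'a mvpoly) < q"
    using bounded_poly_total_degree[OF bounded_two_lines_poly[OF q(2), where 'a='a]] q(2) by linarith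
  ultimately show ?thesis
    unfolding standing_hypotheses_def system_degree_1
    using bounded_poly_mvpolys[OF bounded_two_lines_poly[OF q(2)]] by simp
qed

section \<open>Assembling the bounds and their sharpness\<close>

lemma lower_bounds:
  fixes f :: "nat \<Rightarrow> 'a::{field,finite} mvpoly"
  assumes p: "prime p" and q: "q = p ^ k" and card: "CARD('a) = q"
    and hyp: "standing_hypotheses n r f" and d: "d = system_degree r f"
  shows "q = 2 \<Longrightarrow> 2 ^ (n - d) + 2 \<le> num_zeros n r f"
    and "q \<ge> 3 \<Longrightarrow> 2 * q ^ (n - d) \<le> num_zeros n r f"
    and "homogeneous_system r f \<Longrightarrow>
      (real q ^ (n + 1 - d) - 1) / (real q - 1) * (real q / real (n + 2 - d)) < real (num_zeros n r f)"
    and "q \<ge> 3 \<Longrightarrow> homogeneous_system r f \<Longrightarrow> 2 * q ^ (n - d) + (q - 2) * q \<le> num_zeros n r f"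
proof -
  interpret finite_field_card p k "TYPE('a)"
    using p q card by unfold_locales simp_all
  let ?Z = "common_zeros n r f"
  have dn: "d < n" and ne: "?Z \<noteq> {}" and na: "\<not> is_affine_space n ?Z"
    using hyp d by (auto simp: standing_hypotheses_def)
  interpret W: warning_set q n d ?Z
    using warning_set_common_zeros dn unfolding d q by blast
  show "q = 2 \<Longrightarrow> 2 ^ (n - d) + 2 \<le> num_zeros n r f"
    using W.card_ge_add_2[OF _ ne na] by (simp add: num_zeros_def)
  show "q \<ge> 3 \<Longrightarrow> 2 * q ^ (n - d) \<le> num_zeros n r f"
    using W.card_ge_2_mult[OF _ ne na] by (simp add: num_zeros_def)
  define X where "X = int (q ^ (n - d))"
  define N where "N = int (num_zeros n r f)"
  have q2: "q \<ge> 2" by (rule W.q_ge_2)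
  have *: "(q \<ge> 3 \<longrightarrow> 2 * X + (int q - 2) * int q \<le> N) \<and>
      int q * (int q * X - 1) < N * ((int q - 1) * (int (n - d) + 2))" if hom: "homogeneous_system r f"
  proof -
    have cone: "scl c x \<in> ?Z" if "x \<in> ?Z" for c x
      by (rule common_zeros_cone[OF hom that])
    have "\<exists>x\<in>?Z. \<exists>y\<in>?Z. x + y \<notin> ?Z"
      by (rule cone_not_affine[OF W.Z_subset ne cone na])
    from W.cone_bound[OF cone this] obtain b where b: "2 \<le> b" "b \<le> q" and
      N: "q ^ (n - d + 1) + (q - 1) * b \<le> card ?Z \<or>
        1 + (q - 1) * b + (2 * q + 1 - b) * (q ^ (n - d) - 1) \<le> card ?Z \<or>
        2 * b \<le> q + 2 \<and> 1 + (q - 1) * b + (q + 1 - b) * (q ^ (n - d) - 1) \<le> card ?Z" by blast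
    have X1: "q ^ (n - d) \<ge> 1" using q2 by simp
    have int_q: "int (q - 1) = int q - 1" "int (2 * q + 1 - b) = 2 * int q + 1 - int b"
      "int (q + 1 - b) = int q + 1 - int b" "int (q ^ (n - d) - 1) = X - 1"
      using q2 b X1 by (simp_all add: X_def of_nat_diff)
    have "int (q ^ (n - d + 1) + (q - 1) * b) \<le> N \<or>
        int (1 + (q - 1) * b + (2 * q + 1 - b) * (q ^ (n - d) - 1)) \<le> N \<or>
        int (2 * b) \<le> int (q + 2) \<and> int (1 + (q - 1) * b + (q + 1 - b) * (q ^ (n - d) - 1)) \<le> N"
      using N unfolding N_def num_zeros_def of_nat_le_iff .
    moreover have "int (q ^ (n - d + 1)) = int q * X" by (simp add: X_def)
    ultimately have N': "int q * X + (int q - 1) * int b \<le> N \<or>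
        1 + (int q - 1) * int b + (2 * int q + 1 - int b) * (X - 1) \<le> N \<or>
        2 * int b \<le> int q + 2 \<and> 1 + (int q - 1) * int b + (int q + 1 - int b) * (X - 1) \<le> N"
      by (simp only: of_nat_add of_nat_mult int_q of_nat_1 of_nat_numeral)
    have "q ^ 1 \<le> q ^ (n - d)" using dn q2 by (intro power_increasing) auto
    then have Xq: "int q \<le> X" unfolding X_def by simp
    have "X = int q" if "int (n - d) = 1"
    proof -
      from that have "n - d = 1" by linarith
      then show ?thesis by (simp add: X_def)
    qed
    moreover have "int (n - d) \<ge> 1" using dn by linarith
    ultimately have facts: "int (n - d) \<ge> 1" "int (n - d) = 1 \<Longrightarrow> X = int q" by blast+
    then show ?thesis
      using homogeneous_bounds[OF _ Xq _ _ N' facts] q2 b by simp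
  qed
  show "homogeneous_system r f \<Longrightarrow>
      (real q ^ (n + 1 - d) - 1) / (real q - 1) * (real q / real (n + 2 - d)) < real (num_zeros n r f)"
  proof -
    assume "homogeneous_system r f"
    then have "int q * (int q * X - 1) < N * ((int q - 1) * (int (n - d) + 2))" using * by blast
    then have "real_of_int (int q * (int q * X - 1)) < real_of_int (N * ((int q - 1) * (int (n - d) + 2)))"
      by (simp only: of_int_less_iff)
    moreover have "n + 2 - d = (n - d) + 2" "n + 1 - d = Suc (n - d)" using dn by auto
    ultimately have "(real q ^ (n + 1 - d) - 1) * real q
        < real (num_zeros n r f) * ((real q - 1) * real (n + 2 - d))"
      by (simp add: X_def N_def mult_ac add_ac)
    moreover have "(real q - 1) * real (n + 2 - d) > 0" using q2 dn by simp
    ultimately show ?thesis unfolding times_divide_times_eq by (subst pos_divide_less_eq)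
  qed
  show "q \<ge> 3 \<Longrightarrow> homogeneous_system r f \<Longrightarrow> 2 * q ^ (n - d) + (q - 2) * q \<le> num_zeros n r f"
  proof -
    assume q3: "q \<ge> 3" and "homogeneous_system r f"
    then have "2 * X + (int q - 2) * int q \<le> N" using * by blast
    moreover have "int (2 * q ^ (n - d) + (q - 2) * q) = 2 * X + (int q - 2) * int q"
      using q3 by (simp add: X_def of_nat_diff)
    ultimately show ?thesis unfolding N_def by linarith
  qed
qed

theorem theorem1p4:
  fixes q p k :: nat
  assumes "prime p" and "k \<ge> 1" and "q = p ^ k"
    and "CARD('a::{field,finite}) = q"
  shows
    "(\<forall>n r (f :: nat \<Rightarrow> 'a mvpoly) d.
        standing_hypotheses n r f \<and> d = system_degree r f \<longrightarrow>
          (q = 2 \<longrightarrow> num_zeros n r f \<ge> 2 ^ (n - d) + 2) \<and>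
          (q \<ge> 3 \<longrightarrow> num_zeros n r f \<ge> 2 * q ^ (n - d)) \<and>
          (q \<ge> 2 \<and> homogeneous_system r f \<longrightarrow>
             real (num_zeros n r f) >
               (real q ^ (n + 1 - d) - 1) / (real q - 1) * (real q / real (n + 2 - d))) \<and>
          (q \<ge> 3 \<and> homogeneous_system r f \<longrightarrow>
             num_zeros n r f \<ge> 2 * q ^ (n - d) + (q - 2) * q))
     \<and> (q = 2 \<longrightarrow>
          (\<exists>n r (f :: nat \<Rightarrow> 'a mvpoly). standing_hypotheses n r f \<and>
             num_zeros n r f = 2 ^ (n - system_degree r f) + 2))
     \<and> (q \<ge> 3 \<and> prime q \<longrightarrow>
          (\<exists>n r (f :: nat \<Rightarrow> 'a mvpoly). standing_hypotheses n r f \<and>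
             num_zeros n r f = 2 * q ^ (n - system_degree r f)))
     \<and> (q \<ge> 3 \<longrightarrow>
          (\<exists>n r (f :: nat \<Rightarrow> 'a mvpoly). standing_hypotheses n r f \<and> homogeneous_system r f \<and>
             num_zeros n r f = 2 * q ^ (n - system_degree r f) + (q - 2) * q))"
proof (intro conjI impI allI)
  note bounds = lower_bounds[OF assms(1,3,4)]
  fix n r d and f :: "nat \<Rightarrow> 'a mvpoly"
  assume h: "standing_hypotheses n r f \<and> d = system_degree r f"
  note b = bounds[OF conjunct1[OF h] conjunct2[OF h]]
  show "q = 2 \<Longrightarrow> num_zeros n r f \<ge> 2 ^ (n - d) + 2" by (rule b(1))
  show "q \<ge> 3 \<Longrightarrow> num_zeros n r f \<ge> 2 * q ^ (n - d)" by (rule b(2))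
  show "q \<ge> 2 \<and> homogeneous_system r f \<Longrightarrow> real (num_zeros n r f) >
      (real q ^ (n + 1 - d) - 1) / (real q - 1) * (real q / real (n + 2 - d))" using b(3) by blast
  show "q \<ge> 3 \<and> homogeneous_system r f \<Longrightarrow>
      num_zeros n r f \<ge> 2 * q ^ (n - d) + (q - 2) * q" using b(4) by blast
next
  let ?f = "\<lambda>_::nat. quadric :: 'a mvpoly"
  have N: "num_zeros 3 1 ?f = q ^ 2" using num_zeros_quadric[where 'a='a] assms(4) by simp
  have d: "system_degree 1 ?f = 2" by (simp only: system_degree_1 total_degree_quadric)
  show "\<exists>n r (f :: nat \<Rightarrow> 'a mvpoly). standing_hypotheses n r f \<and>
      num_zeros n r f = 2 ^ (n - system_degree r f) + 2" if "q = 2"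
  proof (intro exI conjI)
    show "num_zeros 3 1 ?f = 2 ^ (3 - system_degree 1 ?f) + 2"
      unfolding N d that by simp
  qed (rule standing_hypotheses_quadric)
  show "\<exists>n r (f :: nat \<Rightarrow> 'a mvpoly). standing_hypotheses n r f \<and> homogeneous_system r f \<and>
      num_zeros n r f = 2 * q ^ (n - system_degree r f) + (q - 2) * q" if "q \<ge> 3"
  proof (intro exI conjI)
    show "homogeneous_system 1 ?f"
      by (simp add: homogeneous_system_def total_degree_quadric homogeneous_quadric)
    show "num_zeros 3 1 ?f = 2 * q ^ (3 - system_degree 1 ?f) + (q - 2) * q"
      unfolding N d using that by (simp add: power2_eq_square diff_mult_distrib)
  qed (rule standing_hypotheses_quadric)
next
  assume q: "q \<ge> 3 \<and> prime q"
  let ?f = "\<lambda>_::nat. two_lines_poly q :: 'a mvpoly"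
  have st: "standing_hypotheses q 1 ?f" using q assms(4) by (intro standing_hypotheses_two_lines) auto
  have N: "num_zeros q 1 ?f = 2 * q" using q assms(4) by (intro num_zeros_two_lines) auto
  \<comment> \<open>The degree of the example is so far only known to be at most q - 1. Applying the
    lower bound to the example itself forces equality.\<close>
  have "2 * q ^ (q - system_degree 1 ?f) \<le> 2 * q"
    using lower_bounds(2)[OF assms(1,3,4) st refl] q unfolding N by blast
  then have "q ^ (q - system_degree 1 ?f) \<le> q ^ 1" by simp
  then have "q - system_degree 1 ?f \<le> 1" using q by (subst (asm) power_increasing_iff) auto
  moreover have "system_degree 1 ?f < q" using st by (simp add: standing_hypotheses_def)
  ultimately have "q - system_degree 1 ?f = 1" by linarith
  then have "num_zeros q 1 ?f = 2 * q ^ (q - system_degree 1 ?f)" unfolding N by simp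
  with st show "\<exists>n r (f :: nat \<Rightarrow> 'a mvpoly). standing_hypotheses n r f \<and>
      num_zeros n r f = 2 * q ^ (n - system_degree r f)" by blast
qed

end
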